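(* Let $\mathcal C$ be a constraint that is admissible for $[0,1]$, let $l\ge i_k$ (with $l\geq 1$), and for each large enough $n$ let $(m_1^{(n)},\dots,m_n^{(n)})$ be drawn from the uniform distribution on $\mathcal M_n^{\mathcal C}([0,1])$. Then, as $n\to\infty$, $$\sqrt n\Big((m_1^{(n)},\dots,m_l^{(n)})-\big(m_1(\mu^{\mathcal C}),\dots,m_l(\mu^{\mathcal C})\big)\Big)\to\mathcal N(0,\Sigma_l)$$ in distribution, where $\mathcal N(0,\Sigma_l)$ denotes the multivariate normal distribution with mean $0$ and covariance matrix $\Sigma_l$, and $\Sigma_l$ is an $l\times l$ matrix of rank $l-k$ that consists of zeros in the columns and rows $i_1,\dots,i_k$.
   Context: For a Borel set $E\subset\mathbb R$, $\mathcal P(E)$ is the set of Borel probability measures on $E$ possessing moments of all orders, $m_j(\mu):=\int x^j\,d\mu(x)$, and $\mathcal M_n(E):=\{(m_1(\mu),\dots,m_n(\mu)):\mu\in\mathcal P(E)\}$. A constraint $\mathcal C=\{m_{i_1}=c_{i_1},\dots,m_{i_k}=c_{i_k}\}$ consists of finitely many integers $1\le i_1<\dots<i_k$ and real values $c_{i_1},\dots,c_{i_k}$; $k=0$ (no constraint) is allowed, with $i_k:=0$. Put $\mathcal P^{\mathcal C}(E):=\{\mu\in\mathcal P(E): m_{i_j}(\mu)=c_{i_j},\ 1\le j\le k\}$ and $\mathcal M^{\mathcal C}_n(E):=\{(m_1(\mu),\dots,m_n(\mu)):\mu\in\mathcal P^{\mathcal C}(E)\}$. $\mathcal C$ is admissible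 for $E$ if $\mathcal M^{\mathcal C}_{i_k}(E)\cap\operatorname{Int}\mathcal M_{i_k}(E)\neq\emptyset$ (automatic if $k=0$). Uniform distribution: for $n\ge i_k$, $\mathcal M_n^{\mathcal C}([0,1])$ is identified with its projection to the $n-k$ unconstrained coordinates $(m_j,\ 1\le j\le n,\ j\ne i_1,\dots,i_k)$, a compact convex subset of $[0,1]^{n-k}$ of positive Lebesgue measure; the uniform distribution on $\mathcal M_n^{\mathcal C}([0,1])$ is the push-forward, under this identification, of normalized $(n-k)$-dimensional Lebesgue measure on the projection. $\mu^0(dx):=\frac{1}{\pi\sqrt{x(1-x)}}dx$ on $[0,1]$ is the arcsine distribution; $\mathcal K(\mu^0|\mu):=\int\log\frac{d\mu^0}{d\mu}\,d\mu^0$ if $\mu^0\ll\mu$ and $\infty$ otherwise; $\mu^{\mathcal C}$ is the unique minimizer of $\mu\mapsto\mathcal K(\mu^0|\mu)$ over $\mathcal P^{\mathcal C}([0,1])$. *)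

theory Defs
  imports "HOL-Probability.Probability" "Jordan_Normal_Form.DL_Rank"
begin

text \<open>
  A point of \<open>\<real>\<^sup>n\<close> is an extensional function on the index set \<open>{1..n}\<close>, so that the index of
  a coordinate is the order of the moment. The Euclidean topology is then the product
  topology, the Borel sigma-algebra is \<open>\<Pi>\<^sub>M i\<in>{1..n}. borel\<close>, and Lebesgue measure
  is the product of copies of \<open>lborel\<close>; all three make sense for any finite index set.
\<close>

abbreviation coord_topology :: "nat set \<Rightarrow> (nat \<Rightarrow> real) topology" where
  "coord_topology I \<equiv> product_topology (\<lambda>_. euclideanreal) I"

abbreviation coord_borel :: "nat set \<Rightarrow> (nat \<Rightarrow> real) measure" where
  "coord_borel I \<equiv> Pi\<^sub>M I (\<lambda>_. borel)"

abbreviation coord_lebesgue :: "nat set \<Rightarrow> (nat \<Rightarrow> real) measure" where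
  "coord_lebesgue I \<equiv> Pi\<^sub>M I (\<lambda>_. lborel)"


definition moment :: "real measure \<Rightarrow> nat \<Rightarrow> real" where
  "moment \<mu> j = (\<integral>x. x ^ j \<partial>\<mu>)"

text \<open>A probability measure on \<open>E\<close> is represented by the Borel measure on \<open>\<real>\<close> it induces.\<close>

definition moment_measures :: "real set \<Rightarrow> real measure set" where
  "moment_measures E = {\<mu>. sets \<mu> = sets borel \<and> prob_space \<mu> \<and> emeasure \<mu> E = 1 \<and>
     (\<forall>j. integrable \<mu> (\<lambda>x. x ^ j))}"

definition moment_vector :: "nat \<Rightarrow> real measure \<Rightarrow> nat \<Rightarrow> real" where
  "moment_vector n \<mu> = (\<lambda>j\<in>{1..n}. moment \<mu> j)"

definition moment_space :: "nat \<Rightarrow> real set \<Rightarrow> (nat \<Rightarrow> real) set" where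
  "moment_space n E = moment_vector n ` moment_measures E"


text \<open>
  A constraint \<open>{m\<^sub>i = c\<^sub>i | i \<in> {i\<^sub>1, \<dots>, i\<^sub>k}}\<close> is a finite partial map \<open>C\<close> with
  \<open>C i = Some c\<^sub>i\<close>; thus \<open>dom C = {i\<^sub>1, \<dots>, i\<^sub>k}\<close> and \<open>k = card (dom C)\<close>.
\<close>

definition moment_constraint :: "(nat \<rightharpoonup> real) \<Rightarrow> bool" where
  "moment_constraint C \<longleftrightarrow> finite (dom C) \<and> 0 \<notin> dom C"

definition last_index :: "(nat \<rightharpoonup> real) \<Rightarrow> nat" where
  "last_index C = Max (insert 0 (dom C))"

definition constrained_measures :: "(nat \<rightharpoonup> real) \<Rightarrow> real set \<Rightarrow> real measure set" where
  "constrained_measures C E =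
     {\<mu> \<in> moment_measures E. \<forall>i c. C i = Some c \<longrightarrow> moment \<mu> i = c}"

definition constrained_moment_space ::
    "(nat \<rightharpoonup> real) \<Rightarrow> nat \<Rightarrow> real set \<Rightarrow> (nat \<Rightarrow> real) set" where
  "constrained_moment_space C n E = moment_vector n ` constrained_measures C E"

definition admissible :: "(nat \<rightharpoonup> real) \<Rightarrow> real set \<Rightarrow> bool" where
  "admissible C E \<longleftrightarrow>
     constrained_moment_space C (last_index C) E \<inter>
     (coord_topology {1..last_index C} interior_of moment_space (last_index C) E) \<noteq> {}"


text \<open>
  For \<open>n \<ge> last_index C\<close>: normalized Lebesgue measure on the projection to the unconstrained
  coordinates, pushed forward under the inverse of the projection, which fills in the
  prescribed values.
\<close>

definition free_indices :: "(nat \<rightharpoonup> real) \<Rightarrow> nat \<Rightarrow> nat set" where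
  "free_indices C n = {1..n} - dom C"

definition fill_in :: "(nat \<rightharpoonup> real) \<Rightarrow> nat \<Rightarrow> (nat \<Rightarrow> real) \<Rightarrow> nat \<Rightarrow> real" where
  "fill_in C n y = (\<lambda>j\<in>{1..n}. case C j of Some c \<Rightarrow> c | None \<Rightarrow> y j)"

definition uniform_moments :: "(nat \<rightharpoonup> real) \<Rightarrow> nat \<Rightarrow> (nat \<Rightarrow> real) measure" where
  "uniform_moments C n =
     distr
       (uniform_measure (coord_lebesgue (free_indices C n))
          ((\<lambda>m. restrict m (free_indices C n)) ` constrained_moment_space C n {0..1}))
       (coord_borel {1..n}) (fill_in C n)"


definition arcsine :: "real measure" where
  "arcsine = density lborel
     (\<lambda>x. ennreal (indicator {0<..<1} x * (1 / (pi * sqrt (x * (1 - x))))))"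

text \<open>
  \<open>\<K>(\<nu>|\<mu>)\<close>. The library's \<open>KL_divergence b \<mu> \<nu>\<close> is the Bochner integral of
  \<open>log b (d\<nu>/d\<mu>)\<close> with respect to \<open>\<nu>\<close>, which is \<open>0\<close> for non-integrable functions. For
  probability measures with \<open>\<nu> \<lless> \<mu>\<close> the negative part of the integrand is always integrable,
  so non-integrability means that the divergence is infinite.
\<close>

definition kullback :: "real measure \<Rightarrow> real measure \<Rightarrow> ereal" where
  "kullback \<nu> \<mu> =
     (if absolutely_continuous \<mu> \<nu> \<and> integrable \<nu> (entropy_density (exp 1) \<mu> \<nu>)
      then ereal (KL_divergence (exp 1) \<mu> \<nu>) else \<infinity>)"

definition constraint_minimizer :: "(nat \<rightharpoonup> real) \<Rightarrow> real measure" where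
  "constraint_minimizer C =
     (THE \<mu>. is_arg_min (kullback arcsine) (\<lambda>\<mu>. \<mu> \<in> constrained_measures C {0..1}) \<mu>)"


text \<open>
  \<open>N = \<N>(0, V)\<close> on \<open>\<real>\<^sup>l\<close>, for a possibly singular covariance matrix \<open>V\<close>, by its characteristic
  function. Symmetry of \<open>V\<close> has to be required, as the quadratic form only depends on the symmetric
  part of \<open>V\<close>; positive semidefiniteness is then implied by the bound \<open>1\<close> on characteristic
  functions. Library matrices are indexed from \<open>0\<close>, hence the shift.
\<close>

definition centered_normal ::
    "nat \<Rightarrow> real mat \<Rightarrow> (nat \<Rightarrow> real) measure \<Rightarrow> bool" where
  "centered_normal l V N \<longleftrightarrow>
     V \<in> carrier_mat l l \<and> transpose_mat V = V \<and>
     prob_space N \<and> sets N = sets (coord_borel {1..l}) \<and>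
     (\<forall>t :: nat \<Rightarrow> real.
        (CLINT x|N. iexp (\<Sum>i\<in>{1..l}. t i * x i)) =
        of_real (exp (- (\<Sum>i\<in>{1..l}. \<Sum>j\<in>{1..l}. t i * V $$ (i - 1, j - 1) * t j) / 2)))"

definition weak_conv_vec ::
    "nat \<Rightarrow> (nat \<Rightarrow> (nat \<Rightarrow> real) measure) \<Rightarrow> (nat \<Rightarrow> real) measure \<Rightarrow> bool" where
  "weak_conv_vec l M N \<longleftrightarrow>
     (\<forall>f :: (nat \<Rightarrow> real) \<Rightarrow> real.
        continuous_map (coord_topology {1..l}) euclideanreal f \<longrightarrow>
        bounded (f ` topspace (coord_topology {1..l})) \<longrightarrow>
        (\<lambda>n. \<integral>x. f x \<partial>M n) \<longlonglongrightarrow> (\<integral>x. f x \<partial>N))"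

end

(*
Put x = (1 - cos t) / 2. Then the cosine moments c_k of a measure on [0,1] are affine in its moments
m_1, ..., m_k, and the arcsine law becomes Lebesgue measure on the circle. Let r_n be the squared
distance from z^n to the lower powers in L^2 of the circle. The Szego recursion gives
r_(n+1) = r_n (1 - a_n^2) with a_n affine in m_(n+1) of slope proportional to 1 / r_n, so the set of
all (m_(l+1), ..., m_n) that extend given m_1, ..., m_l has volume const * r_l^(n-l). Hence the law of
the first l moments has density proportional to r_l^(n-l) on the constrained slice, and Laplace's
method applies at the maximizer of r_l. There r_l has an explicit second-order expansion as a sum of
squares, which gives a global quadratic upper bound as well as the Gaussian limit.

At the maximizer, the first-order condition says that W = |Phi_l|^2 / r_l, viewed as a polynomial
in x, has no coefficients in the free directions. So the integral of W is the same for all measures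
satisfying the constraint, and the Bernstein--Szego measure (arcsine law divided by W), which has
the maximizing moments, minimizes the divergence by ln s >= 1 - 1/s.
*)
theory Submission
  imports Defs "HOL-Complex_Analysis.Cauchy_Integral_Formula"
begin

hide_const (open) Module.smult

section \<open>Toeplitz forms and the Szego recursion\<close>

text \<open>The recursion is kept on arbitrary real sequences, with x / 0 = 0, so that every
  quantity is a total measurable function of the moments and positivity is a separate predicate
  \<open>pdef\<close>. The key variational fact is that r_l is the minimum of the form over monic
  polynomials of degree l, an infimum of functionals linear in the moments: test polynomials give
  upper bounds, and a maximizing sequence, along which r_l stays away from zero, has a limit inside
  the positive definite region.

  Three obstacles shape the rest. The moment set differs from the positive definite set by boundary
  points, which are removed by Fubini in the last moment. The density r_l^(n-l) must be dominated by
  one Gaussian on the whole slice; cosine moments lie in [-1,1], so every displacement has entries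
  of size at most 2, and this crude size is enough for the perturbation bound. Finally, the
  covariance has to be invertible on the free coordinates: a direction with vanishing second-order
  term makes Phi_l orthogonal to all powers up to l, and running the recursion backwards shows that
  the direction is zero.\<close>

text \<open>With truncated subtraction, \<open>(i - j) + (j - i)\<close> is \<open>|i - j|\<close>: this is the inner product of
  \<open>L\<^sup>2\<close> of the circle restricted to real polynomials, for a symmetric measure with cosine moments \<open>c\<close>.\<close>

definition tform :: "(nat \<Rightarrow> real) \<Rightarrow> real poly \<Rightarrow> real poly \<Rightarrow> real" where
  "tform c p q = (\<Sum>i\<le>degree p. \<Sum>j\<le>degree q. coeff p i * coeff q j * c ((i - j) + (j - i)))"

lemma tform_eq_sum:
  assumes "degree p \<le> N" "degree q \<le> M"
  shows "tform c p q = (\<Sum>i\<le>N. \<Sum>j\<le>M. coeff p i * coeff q j * c ((i - j) + (j - i)))"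
proof -
  have "(\<Sum>j\<le>degree q. coeff p i * coeff q j * c ((i - j) + (j - i))) =
        (\<Sum>j\<le>M. coeff p i * coeff q j * c ((i - j) + (j - i)))" for i
    by (rule sum.mono_neutral_left) (use assms in \<open>auto simp: coeff_eq_0\<close>)
  then have "tform c p q = (\<Sum>i\<le>degree p. \<Sum>j\<le>M. coeff p i * coeff q j * c ((i - j) + (j - i)))"
    by (simp add: tform_def)
  also have "\<dots> = (\<Sum>i\<le>N. \<Sum>j\<le>M. coeff p i * coeff q j * c ((i - j) + (j - i)))"
    by (rule sum.mono_neutral_left) (use assms in \<open>auto simp: coeff_eq_0\<close>)
  finally show ?thesis .
qed

lemma tform_commute: "tform c p q = tform c q p"
  unfolding tform_def by (subst sum.swap) (simp add: mult.commute mult.left_commute add.commute)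

lemma tform_add_left: "tform c (p + p') q = tform c p q + tform c p' q"
proof -
  define N where "N = max (degree p) (degree p')"
  have "degree p \<le> N" "degree p' \<le> N" "degree (p + p') \<le> N"
    by (auto simp: N_def degree_add_le)
  then show ?thesis
    by (simp add: tform_eq_sum[where N = N and M = "degree q"] sum.distrib distrib_right)
qed

lemma tform_smult_left: "tform c (smult a p) q = a * tform c p q"
  by (simp add: tform_eq_sum[where N = "degree p" and M = "degree q"] degree_smult_le
      sum_distrib_left mult.assoc)

lemma tform_add_right: "tform c q (p + p') = tform c q p + tform c q p'"
  by (metis tform_add_left tform_commute)

lemma tform_smult_right: "tform c q (smult a p) = a * tform c q p"
  by (metis tform_smult_left tform_commute)

lemma tform_zero_left [simp]: "tform c 0 q = 0"
  and tform_zero_right [simp]: "tform c q 0 = 0"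
  by (simp_all add: tform_def)

lemma tform_diff_left: "tform c (p - p') q = tform c p q - tform c p' q"
  using tform_add_left[of c p "smult (-1) p'" q] tform_smult_left[of c "-1" p' q] by simp

lemma tform_diff_right: "tform c q (p - p') = tform c q p - tform c q p'"
  by (metis tform_diff_left tform_commute)

lemma tform_sum_left: "tform c (sum f A) q = (\<Sum>x\<in>A. tform c (f x) q)"
  by (induction A rule: infinite_finite_induct) (simp_all add: tform_add_left)

lemmas tform_linear = tform_add_left tform_add_right tform_diff_left tform_diff_right
  tform_smult_left tform_smult_right

lemma tform_plus: "tform (\<lambda>k. c k + d k) p q = tform c p q + tform d p q"
  by (simp add: tform_def sum.distrib algebra_simps)

lemma tform_scale: "tform (\<lambda>k. a * c k) p q = a * tform c p q"
  by (simp add: tform_def sum_distrib_left algebra_simps)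

lemma tform_cong:
  assumes "degree p \<le> n" "degree q \<le> n" "\<And>k. k \<le> n \<Longrightarrow> c k = d k"
  shows "tform c p q = tform d p q"
  unfolding tform_def by (intro sum.cong refl) (use assms in auto)

text \<open>Shifting both indices by one leaves their difference unchanged: multiplication by z is
  an isometry of the form. The recursion rests on this Toeplitz property.\<close>

lemma tform_pCons: "tform c (pCons 0 p) (pCons 0 q) = tform c p q"
  by (simp add: tform_eq_sum[where N = "Suc (degree p)" and M = "Suc (degree q)"]
      degree_pCons_le tform_def sum.atMost_Suc_shift del: sum.atMost_Suc)

lemma tform_monom_mult: "tform c (monom 1 k * p) (monom 1 k * q) = tform c p q"
proof (induction k)
  case (Suc k)
  have "monom 1 (Suc k) * r = pCons 0 (monom 1 k * r)" for r :: "real poly"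
    by (simp add: monom_Suc)
  then show ?case using Suc by (simp only: tform_pCons)
qed simp

lemma tform_monom:
  assumes "degree p \<le> n"
  shows "tform c p (monom 1 j) = (\<Sum>i\<le>n. coeff p i * c ((i - j) + (j - i)))"
proof -
  have "tform c p (monom 1 j) =
      (\<Sum>i\<le>n. \<Sum>k\<le>j. coeff p i * coeff (monom 1 j) k * c ((i - k) + (k - i)))"
    by (rule tform_eq_sum) (use assms in \<open>auto simp: degree_monom_eq\<close>)
  also have "\<dots> = (\<Sum>i\<le>n. coeff p i * c ((i - j) + (j - i)))"
  proof (intro sum.cong refl)
    fix i
    have "(\<Sum>k\<le>j. coeff p i * coeff (monom 1 j) k * c ((i - k) + (k - i))) =
      (\<Sum>k\<in>{j}. coeff p i * coeff (monom 1 j) k * c ((i - k) + (k - i)))"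
      by (rule sum.mono_neutral_right) auto
    then show "(\<Sum>k\<le>j. coeff p i * coeff (monom 1 j) k * c ((i - k) + (k - i))) =
      coeff p i * c ((i - j) + (j - i))" by simp
  qed
  finally show ?thesis .
qed

text \<open>The reflection i -> n - i preserves |i - j|, so reversing the coefficients turns a
  pairing with z^j into one with z^(n-j). This replaces complex conjugation on the circle.\<close>

lemma tform_reverse_monom:
  assumes "degree p \<le> n" "degree p' \<le> n" "\<And>i. i \<le> n \<Longrightarrow> coeff p' i = coeff p (n - i)" "j \<le> n"
  shows "tform c p' (monom 1 (n - j)) = tform c p (monom 1 j)"
proof -
  have "tform c p' (monom 1 (n - j)) = (\<Sum>i\<le>n. coeff p (n - i) * c ((i - (n - j)) + ((n - j) - i)))"
    using assms by (simp add: tform_monom)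
  also have "\<dots> = (\<Sum>i\<le>n. coeff p i * c ((i - j) + (j - i)))"
    by (rule sum.reindex_bij_witness[of _ "\<lambda>i. n - i" "\<lambda>i. n - i"])
      (use assms(4) in \<open>auto intro!: arg_cong[where f = c]\<close>)
  also have "\<dots> = tform c p (monom 1 j)" using assms by (simp add: tform_monom)
  finally show ?thesis .
qed

text \<open>Serves the boundary of the moment space, where the form is only semidefinite.\<close>

lemma tform_cauchy_schwarz_zero:
  assumes psd: "\<And>r. degree r \<le> n \<Longrightarrow> tform c r r \<ge> 0"
    and "degree p \<le> n" "degree q \<le> n" "tform c p p = 0"
  shows "tform c p q = 0"
proof (rule ccontr)
  assume nz: "tform c p q \<noteq> 0"
  \<comment> \<open>With this \<open>t\<close> the form at q + t p would be -1.\<close>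
  define t where "t = - (tform c q q + 1) / (2 * tform c p q)"
  have "degree (q + smult t p) \<le> n"
    using assms(2,3) by (meson degree_add_le degree_smult_le order_trans)
  then have "0 \<le> tform c (q + smult t p) (q + smult t p)" by (rule psd)
  also have "\<dots> = tform c q q + 2 * t * tform c p q"
    using assms(4) by (simp add: tform_linear tform_commute[of c q p] algebra_simps)
  also have "\<dots> = -1" using nz by (simp add: t_def field_simps)
  finally show False by simp
qed

text \<open>The second component is the reversed polynomial Psi_n(z) = z^n Phi_n(1/z), carried along
  so that no reversal has to be defined. Where the norm vanishes, a = 0 by the convention x / 0 = 0,
  and the recursion stays total.\<close>

fun szego :: "(nat \<Rightarrow> real) \<Rightarrow> nat \<Rightarrow> real poly \<times> real poly" where
  "szego c 0 = (1, 1)"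
| "szego c (Suc n) = (let (p, q) = szego c n; a = tform c (pCons 0 p) 1 / tform c p p
     in (pCons 0 p - smult a q, q - smult a (pCons 0 p)))"

definition opoly :: "(nat \<Rightarrow> real) \<Rightarrow> nat \<Rightarrow> real poly" where "opoly c n = fst (szego c n)"
definition rpoly :: "(nat \<Rightarrow> real) \<Rightarrow> nat \<Rightarrow> real poly" where "rpoly c n = snd (szego c n)"
definition opnorm :: "(nat \<Rightarrow> real) \<Rightarrow> nat \<Rightarrow> real" where
  "opnorm c n = tform c (opoly c n) (opoly c n)"
definition verblunsky :: "(nat \<Rightarrow> real) \<Rightarrow> nat \<Rightarrow> real" where
  "verblunsky c n = tform c (pCons 0 (opoly c n)) 1 / opnorm c n"

lemma opoly_0 [simp]: "opoly c 0 = 1" and rpoly_0 [simp]: "rpoly c 0 = 1"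
  by (simp_all add: opoly_def rpoly_def)

lemma opoly_Suc: "opoly c (Suc n) = pCons 0 (opoly c n) - smult (verblunsky c n) (rpoly c n)"
  and rpoly_Suc: "rpoly c (Suc n) = rpoly c n - smult (verblunsky c n) (pCons 0 (opoly c n))"
  by (simp_all add: opoly_def rpoly_def verblunsky_def opnorm_def Let_def case_prod_beta)

lemma opnorm_0: "opnorm c 0 = c 0"
  by (simp add: opnorm_def tform_def)

text \<open>Reversal at order n + 1 exchanges z Phi_n and Psi_n, hence also the two combinations
  formed from them. The four facts support each other in one induction.\<close>

lemma opoly_rpoly:
  "degree (opoly c n) \<le> n \<and> degree (rpoly c n) \<le> n \<and> coeff (opoly c n) n = 1 \<and>
   (\<forall>i\<le>n. coeff (rpoly c n) i = coeff (opoly c n) (n - i))"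
proof (induction n)
  case (Suc n)
  then have dp: "degree (opoly c n) \<le> n" and dq: "degree (rpoly c n) \<le> n"
    and lc: "coeff (opoly c n) n = 1"
    and rv: "\<And>i. i \<le> n \<Longrightarrow> coeff (rpoly c n) i = coeff (opoly c n) (n - i)"
    by auto
  have dz: "degree (pCons 0 (opoly c n)) \<le> Suc n"
    using dp degree_pCons_le[of 0 "opoly c n"] by linarith
  have rv': "coeff (opoly c n) i = coeff (rpoly c n) (n - i)" if "i \<le> n" for i
    using rv[of "n - i"] that by simp
  have z: "coeff (rpoly c n) (Suc n) = 0" using dq by (simp add: coeff_eq_0)
  have z': "coeff (opoly c n) (Suc n) = 0" using dp by (simp add: coeff_eq_0)
  have "coeff (rpoly c (Suc n)) i = coeff (opoly c (Suc n)) (Suc n - i)" if "i \<le> Suc n" for i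
  proof (cases i)
    case 0
    then show ?thesis using rv[of 0] lc by (simp add: opoly_Suc rpoly_Suc z)
  next
    case (Suc k)
    then have k: "k \<le> n" using that by simp
    show ?thesis
    proof (cases "k = n")
      case True
      then show ?thesis using Suc lc z rv[of 0] by (simp add: opoly_Suc rpoly_Suc)
    next
      case False
      then obtain m where m: "n - k = Suc m" using k by (metis Suc_diff_Suc le_neq_implies_less)
      have "coeff (rpoly c n) (Suc k) = coeff (opoly c n) m"
        using rv[of "Suc k"] m k False by (metis Suc_leI diff_Suc_1 diff_Suc_eq_diff_pred diff_commute diff_diff_left le_neq_implies_less plus_1_eq_Suc)
      moreover have "coeff (opoly c n) k = coeff (rpoly c n) (Suc m)"
        using rv'[OF k] m by simp
      ultimately show ?thesis using Suc m by (simp add: opoly_Suc rpoly_Suc)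
    qed
  qed
  moreover have "degree (opoly c (Suc n)) \<le> Suc n" "degree (rpoly c (Suc n)) \<le> Suc n"
    unfolding opoly_Suc rpoly_Suc
    using dz dq by (meson degree_diff_le degree_smult_le le_Suc_eq order_trans)+
  moreover have "coeff (opoly c (Suc n)) (Suc n) = 1"
    by (simp add: opoly_Suc lc z)
  ultimately show ?case by blast
qed simp

lemma degree_opoly [simp]: "degree (opoly c n) = n"
  using opoly_rpoly[of c n] le_degree[of "opoly c n" n] by simp

lemma coeff_opoly_top [simp]: "coeff (opoly c n) n = 1"
  using opoly_rpoly[of c n] by simp

lemma degree_rpoly_le: "degree (rpoly c n) \<le> n"
  using opoly_rpoly[of c n] by simp

lemma coeff_rpoly: "i \<le> n \<Longrightarrow> coeff (rpoly c n) i = coeff (opoly c n) (n - i)"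
  using opoly_rpoly[of c n] by simp

lemma opoly_nonzero [simp]: "opoly c n \<noteq> 0"
  by (metis coeff_opoly_top coeff_0 zero_neq_one)

text \<open>The form may belong to a sequence \<open>d\<close> other than the one that generated the
  polynomials; this is how \<open>d\<close> is recovered in \<open>szego_determines\<close>.\<close>

lemma tform_rpoly_monom: "j \<le> n \<Longrightarrow> tform d (rpoly c n) (monom 1 (n - j)) = tform d (opoly c n) (monom 1 j)"
  by (rule tform_reverse_monom) (simp_all add: degree_rpoly_le coeff_rpoly)

lemma tform_pCons_opoly_one:
  "tform d (pCons 0 (opoly c n)) 1 = tform d (rpoly c n) (monom 1 (Suc n))"
proof -
  have "tform d (rpoly c n) (monom 1 (Suc n - 0)) = tform d (pCons 0 (opoly c n)) (monom 1 0)"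
  proof (rule tform_reverse_monom)
    show "degree (pCons 0 (opoly c n)) \<le> Suc n" by simp
    show "degree (rpoly c n) \<le> Suc n" using degree_rpoly_le[of c n] by simp
    show "coeff (rpoly c n) i = coeff (pCons 0 (opoly c n)) (Suc n - i)" if "i \<le> Suc n" for i
      using that degree_rpoly_le[of c n] coeff_rpoly[of i n c]
      by (cases "i = Suc n") (auto simp: coeff_eq_0 Suc_diff_le)
  qed simp
  then show ?thesis by (simp add: monom_0 one_pCons)
qed

lemma poly_sub_smult_opoly_degree:
  assumes "degree p \<le> n" "p - smult (coeff p n) (opoly c n) \<noteq> 0"
  shows "degree (p - smult (coeff p n) (opoly c n)) < n"
proof -
  let ?q = "p - smult (coeff p n) (opoly c n)"
  have "degree ?q \<le> n" using assms(1) by (intro degree_diff_le) (auto intro: order_trans[OF degree_smult_le])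
  moreover have "coeff ?q n = 0" by simp
  ultimately show ?thesis using assms(2) by (metis leading_coeff_0_iff le_neq_implies_less)
qed

text \<open>The disjunct \<open>p = 0\<close> is there for \<open>n = 0\<close>, since the zero
  polynomial has degree 0. The functional is abstract because it stands for pairings in the forms of
  several sequences.\<close>

lemma additive_zero_on_monoms:
  fixes f :: "real poly \<Rightarrow> real"
  assumes lin: "\<And>p q. f (p + q) = f p + f q" "\<And>a p. f (smult a p) = a * f p"
    and z: "\<And>j. j < n \<Longrightarrow> f (monom 1 j) = 0" and p: "degree p < n \<or> p = 0"
  shows "f p = 0"
proof -
  have f0: "f 0 = 0" using lin(2)[of 0 0] by simp
  have fs: "f (sum g A) = (\<Sum>x\<in>A. f (g x))" for g and A :: "nat set"
    by (induction A rule: infinite_finite_induct) (simp_all add: lin f0)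
  have "p = (\<Sum>i\<le>degree p. smult (coeff p i) (monom 1 i))"
    by (simp add: smult_monom poly_as_sum_of_monoms)
  then have "f p = (\<Sum>i\<le>degree p. coeff p i * f (monom 1 i))"
    by (metis (no_types, lifting) fs lin(2) sum.cong)
  also have "\<dots> = 0" using p z by (auto intro!: sum.neutral)
  finally show ?thesis .
qed

text \<open>Each Phi_j is monic of degree j, so subtracting a multiple of one lowers the
  degree.\<close>

lemma additive_zero_on_opolys:
  fixes f :: "real poly \<Rightarrow> real"
  assumes lin: "\<And>p q. f (p + q) = f p + f q" "\<And>a p. f (smult a p) = a * f p"
    and z: "\<And>j. j < n \<Longrightarrow> f (opoly c j) = 0" and p: "degree p < n \<or> p = 0"
  shows "f p = 0"
  using p
proof (induction "degree p" arbitrary: p rule: less_induct)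
  case less
  have f0: "f 0 = 0" using lin(2)[of 0 0] by simp
  show ?case
  proof (cases "p = 0")
    case False
    let ?q = "p - smult (coeff p (degree p)) (opoly c (degree p))"
    have "f ?q = 0"
    proof (cases "?q = 0")
      case False
      then have "degree ?q < degree p" by (rule poly_sub_smult_opoly_degree[rotated]) simp
      then show ?thesis using less False \<open>p \<noteq> 0\<close> by (meson less_trans)
    qed (simp only: f0)
    moreover have "f p = f (?q + smult (coeff p (degree p)) (opoly c (degree p)))" by simp
    ultimately show ?thesis using less.prems False z by (simp only: lin) auto
  qed (simp add: f0)
qed

text \<open>For 1 <= j <= n, z Phi_n is orthogonal to z^j by the shift and Psi_n by reversal; the
  coefficient a is chosen for j = 0. Nonvanishing norms suffice for this argument.\<close>

lemma szego_orthogonal: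
  assumes "\<And>j. j < n \<Longrightarrow> opnorm c j \<noteq> 0" "j < n"
  shows "tform c (opoly c n) (monom 1 j) = 0"
  using assms
proof (induction n arbitrary: j)
  case (Suc n)
  then have ort: "\<And>j. j < n \<Longrightarrow> tform c (opoly c n) (monom 1 j) = 0" and nz: "opnorm c n \<noteq> 0" by auto
  have top: "tform c (opoly c n) (monom 1 n) = opnorm c n"
  proof -
    have "tform c (opoly c n) (opoly c n - monom 1 n) = 0"
    proof (rule additive_zero_on_monoms[where f = "tform c (opoly c n)" and n = n])
      have "degree (opoly c n - monom 1 n) \<le> n" by (intro degree_diff_le) (simp_all add: degree_monom_le)
      moreover have "coeff (opoly c n - monom 1 n) n = 0" by simp
      ultimately show "degree (opoly c n - monom 1 n) < n \<or> opoly c n - monom 1 n = 0"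
        by (metis leading_coeff_0_iff le_neq_implies_less)
    qed (simp_all add: tform_linear ort)
    then show ?thesis by (simp add: tform_linear opnorm_def)
  qed
  show ?case
  proof (cases j)
    case 0
    \<comment> \<open>Psi_n pairs with 1 as Phi_n does with z^n, which gives r_n; hence a r_n = <z
      Phi_n, 1> is exactly what cancels.\<close>
    have "tform c (rpoly c n) (monom 1 0) = opnorm c n"
      using tform_rpoly_monom[of n n c c] top by simp
    then show ?thesis using 0 nz by (simp add: opoly_Suc tform_linear verblunsky_def)
  next
    case (Suc k)
    then have k: "k < n" using Suc.prems by simp
    have "tform c (rpoly c n) (monom 1 (n - (n - Suc k))) = tform c (opoly c n) (monom 1 (n - Suc k))"
      by (rule tform_rpoly_monom) simp
    also have "\<dots> = 0" by (rule ort) (use k in simp)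
    finally have "tform c (rpoly c n) (monom 1 (Suc k)) = 0" using k by simp
    moreover have "tform c (pCons 0 (opoly c n)) (monom 1 (Suc k)) = 0"
      using ort[OF k] by (simp add: monom_Suc tform_pCons)
    ultimately show ?thesis using Suc by (simp add: opoly_Suc tform_linear)
  qed
qed simp

lemma opoly_orthogonal_lower:
  assumes "\<And>j. j < n \<Longrightarrow> opnorm c j \<noteq> 0" "degree p < n \<or> p = 0"
  shows "tform c (opoly c n) p = 0"
  by (rule additive_zero_on_monoms[where f = "tform c (opoly c n)" and n = n])
    (use assms szego_orthogonal[of n c] in \<open>auto simp: tform_linear\<close>)

lemma monic_minus_monic:
  fixes p q :: "real poly"
  assumes "degree p \<le> n" "degree q \<le> n" "coeff p n = coeff q n"
  shows "degree (p - q) < n \<or> p - q = 0"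
proof -
  have "degree (p - q) \<le> n" using assms by (intro degree_diff_le)
  moreover have "coeff (p - q) n = 0" using assms by simp
  ultimately show ?thesis by (metis leading_coeff_0_iff le_neq_implies_less)
qed

lemma opoly_top:
  assumes "\<And>j. j < n \<Longrightarrow> tform d (opoly c n) (monom 1 j) = 0"
  shows "tform d (opoly c n) (opoly c n) = tform d (opoly c n) (monom 1 n)"
proof -
  have "tform d (opoly c n) (opoly c n - monom 1 n) = 0"
    by (rule additive_zero_on_monoms[where f = "tform d (opoly c n)" and n = n])
      (use assms monic_minus_monic[of "opoly c n" n "monom 1 n"] in \<open>simp_all add: tform_linear degree_monom_eq\<close>)
  then show ?thesis by (simp add: tform_linear)
qed

text \<open>Pair Phi_(n+1) with its top power: z Phi_n against z^(n+1) gives r_n by the shift, and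
  Psi_n against z^(n+1) gives <z Phi_n, 1> = a r_n by reversal.\<close>

lemma opnorm_Suc:
  assumes "\<And>j. j \<le> n \<Longrightarrow> opnorm c j \<noteq> 0"
  shows "opnorm c (Suc n) = opnorm c n * (1 - (verblunsky c n)\<^sup>2)"
proof -
  have "opnorm c (Suc n) = tform c (opoly c (Suc n)) (monom 1 (Suc n))"
    unfolding opnorm_def by (rule opoly_top, rule szego_orthogonal) (use assms in auto)
  also have "\<dots> = tform c (opoly c n) (monom 1 n) - verblunsky c n * tform c (pCons 0 (opoly c n)) 1"
    by (simp add: opoly_Suc tform_linear tform_pCons_opoly_one) (simp add: monom_Suc tform_pCons)
  also have "tform c (opoly c n) (monom 1 n) = opnorm c n"
    unfolding opnorm_def by (rule opoly_top[symmetric], rule szego_orthogonal) (use assms in auto)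
  also have "tform c (pCons 0 (opoly c n)) 1 = verblunsky c n * opnorm c n"
    using assms[of n] by (simp add: verblunsky_def)
  finally show ?thesis by (simp add: power2_eq_square algebra_simps)
qed

section \<open>Positive definite sequences and the variational characterization of the norm\<close>

definition pdef :: "nat \<Rightarrow> (nat \<Rightarrow> real) \<Rightarrow> bool" where
  "pdef n c \<longleftrightarrow> (\<forall>p. p \<noteq> 0 \<longrightarrow> degree p \<le> n \<longrightarrow> tform c p p > 0)"

lemma pdefD: "pdef n c \<Longrightarrow> p \<noteq> 0 \<Longrightarrow> degree p \<le> n \<Longrightarrow> tform c p p > 0"
  by (simp add: pdef_def)

lemma pdef_nonneg: "pdef n c \<Longrightarrow> degree p \<le> n \<Longrightarrow> tform c p p \<ge> 0"
  by (metis pdefD tform_zero_left less_eq_real_def order_refl)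

lemma pdef_mono: "pdef n c \<Longrightarrow> m \<le> n \<Longrightarrow> pdef m c"
  by (auto simp: pdef_def)

lemma pdef_opnorm: "pdef n c \<Longrightarrow> j \<le> n \<Longrightarrow> opnorm c j > 0"
  unfolding opnorm_def by (rule pdefD) auto

text \<open>Orthogonality of Phi_n involves the norms of lower index, so definiteness up to order n
  - 1 suffices; the case \<open>n = Suc m\<close> is the one that \<open>pdef_split\<close>
  uses.\<close>

lemma opoly_orthogonal:
  assumes "pdef m c" "n \<le> Suc m" "degree p < n \<or> p = 0"
  shows "tform c (opoly c n) p = 0"
proof (rule opoly_orthogonal_lower)
  show "opnorm c j \<noteq> 0" if "j < n" for j
    using pdef_opnorm[OF assms(1), of j] that assms(2) by simp
qed (rule assms(3))

lemma pdef_0: "pdef 0 c \<longleftrightarrow> c 0 > 0"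
proof
  assume "pdef 0 c" then show "c 0 > 0" using pdef_opnorm[of 0 c 0] by (simp add: opnorm_0)
next
  assume "c 0 > 0" then show "pdef 0 c"
    by (auto simp: pdef_def tform_def zero_less_mult_iff not_less_iff_gr_or_eq)
       (metis leading_coeff_0_iff linorder_neqE_linordered_idom)
qed

lemma pdef_split:
  assumes "pdef n c" "degree p \<le> Suc n"
  obtains q where "p = smult (coeff p (Suc n)) (opoly c (Suc n)) + q" "degree q \<le> n"
    "tform c p p = (coeff p (Suc n))\<^sup>2 * opnorm c (Suc n) + tform c q q"
proof
  let ?q = "p - smult (coeff p (Suc n)) (opoly c (Suc n))"
  show "p = smult (coeff p (Suc n)) (opoly c (Suc n)) + ?q" by simp
  have q: "degree ?q < Suc n \<or> ?q = 0"
    by (rule monic_minus_monic) (use assms in \<open>auto intro: order_trans[OF degree_smult_le]\<close>)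
  then show "degree ?q \<le> n" by auto
  have o: "tform c (opoly c (Suc n)) ?q = 0"
    by (intro opoly_orthogonal[OF assms(1)] q) simp
  have "tform c (smult a P + q) (smult a P + q) = a\<^sup>2 * tform c P P + tform c q q"
    if "tform c P q = 0" for a P q
    using that by (simp add: tform_linear tform_commute[of c q P] power2_eq_square)
  from this[OF o, of "coeff p (Suc n)"]
  show "tform c p p = (coeff p (Suc n))\<^sup>2 * opnorm c (Suc n) + tform c ?q ?q"
    by (simp add: opnorm_def)
qed

lemma pdef_Suc: "pdef (Suc n) c \<longleftrightarrow> pdef n c \<and> opnorm c (Suc n) > 0"
proof
  assume "pdef (Suc n) c"
  then show "pdef n c \<and> opnorm c (Suc n) > 0" by (auto intro: pdef_mono pdef_opnorm)
next
  assume a: "pdef n c \<and> opnorm c (Suc n) > 0"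
  show "pdef (Suc n) c" unfolding pdef_def
  proof (intro allI impI)
    fix p :: "real poly" assume p: "p \<noteq> 0" "degree p \<le> Suc n"
    obtain q where q: "p = smult (coeff p (Suc n)) (opoly c (Suc n)) + q" "degree q \<le> n"
      "tform c p p = (coeff p (Suc n))\<^sup>2 * opnorm c (Suc n) + tform c q q"
      using pdef_split a p by metis
    show "tform c p p > 0"
    proof (cases "coeff p (Suc n) = 0")
      case True
      then show ?thesis using q p a by (metis add.left_neutral mult_zero_left pdefD power_zero_numeral smult_0_left)
    next
      case False
      then show ?thesis using q a pdef_nonneg[of n c q] by (simp add: add_pos_nonneg)
    qed
  qed
qed

text \<open>Given a positive definite start, the possible next entries are those with a in (-1,1),
  an interval that does not depend on the start. Fibre volumes become explicit through this
  coordinate.\<close>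

lemma pdef_Suc_verblunsky: "pdef (Suc n) c \<longleftrightarrow> pdef n c \<and> \<bar>verblunsky c n\<bar> < 1"
proof -
  have "opnorm c (Suc n) > 0 \<longleftrightarrow> \<bar>verblunsky c n\<bar> < 1" if "pdef n c"
  proof -
    have r: "opnorm c n > 0" using pdef_opnorm[OF that] by simp
    have "opnorm c (Suc n) = opnorm c n * (1 - (verblunsky c n)\<^sup>2)"
      by (rule opnorm_Suc) (use pdef_opnorm[OF that] in force)
    then show ?thesis using r by (simp add: zero_less_mult_iff abs_square_less_1)
  qed
  then show ?thesis by (auto simp: pdef_Suc)
qed

text \<open>Pythagoras: a monic competitor differs from Phi_n by a polynomial orthogonal to it. The
  right side is linear in \<open>c\<close>, which is the source of the upper bounds on
  \<open>opnorm\<close> and of its upper semicontinuity.\<close>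

lemma opnorm_minimal:
  assumes "pdef n c" "degree p \<le> n" "coeff p n = 1"
  shows "opnorm c n \<le> tform c p p"
proof -
  let ?q = "p - opoly c n"
  have q: "degree ?q < n \<or> ?q = 0" by (rule monic_minus_monic) (use assms in auto)
  then have o: "tform c (opoly c n) ?q = 0"
    by (intro opoly_orthogonal[OF assms(1)]) simp_all
  have "tform c (P + q) (P + q) = tform c P P + tform c q q" if "tform c P q = 0" for P q
    using that by (simp add: tform_linear tform_commute[of c q P])
  from this[OF o] have "tform c p p = opnorm c n + tform c ?q ?q" by (simp add: opnorm_def)
  moreover have "tform c ?q ?q \<ge> 0" by (rule pdef_nonneg[OF assms(1)]) (use q in auto)
  ultimately show ?thesis by simp
qed

lemma szego_cong:
  assumes "\<And>k. k \<le> n \<Longrightarrow> c k = d k"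
  shows "opoly c n = opoly d n \<and> rpoly c n = rpoly d n"
  using assms
proof (induction n)
  case (Suc n)
  then have e: "opoly c n = opoly d n" "rpoly c n = rpoly d n" by auto
  have "opnorm c n = opnorm d n" unfolding opnorm_def e by (rule tform_cong[where n = n]) (use Suc in auto)
  moreover have "tform c (pCons 0 (opoly c n)) 1 = tform d (pCons 0 (opoly c n)) 1"
    by (rule tform_cong[where n = "Suc n"]) (use Suc in auto)
  ultimately show ?case by (simp add: opoly_Suc rpoly_Suc verblunsky_def e)
qed simp

lemma opoly_cong: "(\<And>k. k \<le> n \<Longrightarrow> c k = d k) \<Longrightarrow> opoly c n = opoly d n"
  using szego_cong by blast

lemma opnorm_cong: "(\<And>k. k \<le> n \<Longrightarrow> c k = d k) \<Longrightarrow> opnorm c n = opnorm d n"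
  using opoly_cong[of n c d] unfolding opnorm_def by (auto intro!: tform_cong[where n = n])

lemma pdef_cong:
  assumes "\<And>k. k \<le> n \<Longrightarrow> c k = d k" shows "pdef n c \<longleftrightarrow> pdef n d"
  unfolding pdef_def using tform_cong[of _ n _ c d] assms by metis

text \<open>The recursion can be run backwards, since \<open>(1 - a\<^sup>2) z \<Phi>\<^sub>n = \<Phi>\<^sub>n\<^sub>+\<^sub>1 + a \<Psi>\<^sub>n\<^sub>+\<^sub>1\<close>.\<close>

lemma szego_determines:
  assumes "pdef n c"
    and "\<And>j. j \<le> n \<Longrightarrow> tform d (opoly c n) (monom 1 j) = (if j = n then \<rho> else 0)"
    and "k \<le> n"
  shows "d k = \<rho> / opnorm c n * c k"
  using assms
proof (induction n arbitrary: \<rho> k)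
  case 0
  have "d 0 = \<rho>" using "0.prems"(2)[of 0] by (simp add: tform_def monom_0 one_pCons)
  then show ?case using 0 by (simp add: opnorm_0 pdef_0)
next
  case (Suc n)
  let ?a = "verblunsky c n" and ?P = "opoly c (Suc n)" and ?R = "rpoly c (Suc n)"
  have pd: "pdef n c" and a: "\<bar>?a\<bar> < 1" using Suc.prems(1) by (auto simp: pdef_Suc_verblunsky)
  have a2: "1 - ?a\<^sup>2 > 0" using a by (simp add: abs_square_less_1)
  have r: "opnorm c (Suc n) = opnorm c n * (1 - ?a\<^sup>2)"
    by (rule opnorm_Suc) (use pdef_opnorm[OF pd] in force)
  have id: "smult (1 - ?a\<^sup>2) (pCons 0 (opoly c n)) = ?P + smult ?a ?R"
    by (rule poly_eqI) (simp add: opoly_Suc rpoly_Suc coeff_pCons algebra_simps power2_eq_square split: nat.splits)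
  have R: "tform d ?R (monom 1 (Suc j)) = 0" if "j \<le> n" for j
  proof -
    have "tform d ?R (monom 1 (Suc n - (n - j))) = tform d ?P (monom 1 (n - j))"
      by (rule tform_rpoly_monom) simp
    also have "Suc n - (n - j) = Suc j" using that by simp
    also have "tform d ?P (monom 1 (n - j)) = 0" using Suc.prems(2)[of "n - j"] by auto
    finally show ?thesis .
  qed
  have "tform d (opoly c n) (monom 1 j) = (if j = n then \<rho> / (1 - ?a\<^sup>2) else 0)" if "j \<le> n" for j
  proof -
    have "(1 - ?a\<^sup>2) * tform d (opoly c n) (monom 1 j)
        = tform d (smult (1 - ?a\<^sup>2) (pCons 0 (opoly c n))) (monom 1 (Suc j))"
      by (simp add: tform_linear monom_Suc tform_pCons)
    also have "\<dots> = (if j = n then \<rho> else 0)"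
      unfolding id using that R[of j] Suc.prems(2)[of "Suc j"] by (simp add: tform_linear)
    finally show ?thesis using a2 by (simp add: field_simps split: if_splits)
  qed
  from Suc.IH[OF pd this]
  have low: "d k = \<rho> / opnorm c (Suc n) * c k" if "k \<le> n" for k using that r by (simp add: field_simps)
  \<comment> \<open>Phi_(n+1) is monic, so the last entry enters its pairing with 1 with coefficient
    1; orthogonality to 1 is a recurrence that fixes it.\<close>
  have expand: "e (Suc n) = tform e ?P 1 - (\<Sum>i\<le>n. coeff ?P i * e i)" for e
    using tform_monom[of ?P "Suc n" e 0] by (simp add: monom_0 one_pCons)
  have "tform c ?P 1 = 0"
    using szego_orthogonal[of "Suc n" c 0] pdef_opnorm[OF pd] by (force simp: monom_0 one_pCons less_Suc_eq_le)
  then have c: "c (Suc n) = - (\<Sum>i\<le>n. coeff ?P i * c i)" using expand[of c] by simp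
  have "tform d ?P 1 = 0" using Suc.prems(2)[of 0] by (simp add: monom_0 one_pCons)
  then have "d (Suc n) = - (\<Sum>i\<le>n. coeff ?P i * d i)" using expand[of d] by simp
  also have "\<dots> = - (\<Sum>i\<le>n. coeff ?P i * (\<rho> / opnorm c (Suc n) * c i))" using low by simp
  also have "\<dots> = \<rho> / opnorm c (Suc n) * c (Suc n)"
    by (simp add: c sum_distrib_left algebra_simps)
  finally show ?case using low Suc.prems(3) le_Suc_eq by auto
qed

section \<open>Relative bounds and second-order perturbation of the minimal norm\<close>

lemma tform_minus_left: "tform c (- p) q = - tform c p q"
  using tform_diff_left[of c 0 p q] by simp

lemma tform_minus_right: "tform c q (- p) = - tform c q p"
  using tform_diff_right[of c q 0 p] by simp

lemma tform_sum_right: "tform c q (sum f A) = (\<Sum>x\<in>A. tform c q (f x))"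
  by (simp add: tform_commute[of c q] tform_sum_left)

text \<open>Equivalence with the Euclidean norm of the coefficients, by induction along the
  orthogonal split p = a Phi_(n+1) + q. The inequality (x + y)^2 <= 2 x^2 + 2 y^2 produces the two
  summands of \<open>L\<close>, one for each part.\<close>

lemma pdef_coercive:
  assumes "pdef n c"
  shows "\<exists>K>0. \<forall>p. degree p \<le> n \<longrightarrow> (\<Sum>i\<le>n. (coeff p i)\<^sup>2) \<le> K * tform c p p"
  using assms
proof (induction n)
  case 0
  then have c: "c 0 > 0" by (simp add: pdef_0)
  have "tform c p p = (coeff p 0)\<^sup>2 * c 0" if "degree p \<le> 0" for p
    using that by (simp add: tform_eq_sum[where N = 0 and M = 0] power2_eq_square)
  then show ?case
    using c by (intro exI[of _ "1 / c 0"]) simp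
next
  case (Suc n)
  let ?P = "opoly c (Suc n)"
  have pd: "pdef n c" and r: "opnorm c (Suc n) > 0" using Suc.prems by (auto simp: pdef_Suc)
  obtain K where K: "K > 0" "\<And>p. degree p \<le> n \<Longrightarrow> (\<Sum>i\<le>n. (coeff p i)\<^sup>2) \<le> K * tform c p p"
    using Suc.IH[OF pd] by blast
  define S where "S = (\<Sum>i\<le>Suc n. (coeff ?P i)\<^sup>2)"
  define L where "L = 2 * S / opnorm c (Suc n) + 2 * K"
  have S0: "S \<ge> 0" by (simp add: S_def sum_nonneg)
  have L: "L > 0" using K S0 r by (simp add: L_def add_nonneg_pos)
  have "(\<Sum>i\<le>Suc n. (coeff p i)\<^sup>2) \<le> L * tform c p p" if dp: "degree p \<le> Suc n" for p
  proof -
    obtain q where q: "p = smult (coeff p (Suc n)) ?P + q" "degree q \<le> n"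
      "tform c p p = (coeff p (Suc n))\<^sup>2 * opnorm c (Suc n) + tform c q q"
      by (rule pdef_split[OF pd dp])
    define a where "a = coeff p (Suc n)"
    have sq: "(x + y)\<^sup>2 \<le> 2 * x\<^sup>2 + 2 * y\<^sup>2" for x y :: real
      using sum_squares_bound[of x y] unfolding power2_sum by linarith
    have "(\<Sum>i\<le>Suc n. (coeff p i)\<^sup>2) = (\<Sum>i\<le>Suc n. (a * coeff ?P i + coeff q i)\<^sup>2)"
    proof (intro sum.cong refl)
      fix i show "(coeff p i)\<^sup>2 = (a * coeff ?P i + coeff q i)\<^sup>2"
        using arg_cong[OF q(1), of "\<lambda>p. coeff p i"] by (simp add: a_def)
    qed
    also have "\<dots> \<le> (\<Sum>i\<le>Suc n. 2 * (a * coeff ?P i)\<^sup>2 + 2 * (coeff q i)\<^sup>2)"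
      by (intro sum_mono sq)
    also have "\<dots> = 2 * a\<^sup>2 * S + 2 * (\<Sum>i\<le>Suc n. (coeff q i)\<^sup>2)"
      by (simp only: S_def sum.distrib sum_distrib_left power_mult_distrib mult.assoc)
    also have "(\<Sum>i\<le>Suc n. (coeff q i)\<^sup>2) = (\<Sum>i\<le>n. (coeff q i)\<^sup>2)"
      using q(2) by (simp add: coeff_eq_0)
    also have "2 * a\<^sup>2 * S + 2 * (\<Sum>i\<le>n. (coeff q i)\<^sup>2) \<le> 2 * a\<^sup>2 * S + 2 * (K * tform c q q)"
      using K(2)[OF q(2)] by simp
    also have "\<dots> \<le> L * tform c p p"
    proof -
      have t: "tform c q q \<ge> 0" by (rule pdef_nonneg[OF pd q(2)])
      have "L * tform c p p = 2 * a\<^sup>2 * S + 2 * (K * tform c q q)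
          + (2 * K * (a\<^sup>2 * opnorm c (Suc n)) + 2 * S / opnorm c (Suc n) * tform c q q)"
        using r by (simp add: q(3) L_def field_simps flip: a_def)
      moreover have "2 * K * (a\<^sup>2 * opnorm c (Suc n)) \<ge> 0" using K r by simp
      moreover have "2 * S / opnorm c (Suc n) * tform c q q \<ge> 0" using S0 r t by simp
      ultimately show ?thesis by linarith
    qed
    finally show ?thesis .
  qed
  with L show ?case by blast
qed

lemma tform_abs_le:
  assumes "degree p \<le> n" "\<And>k. k \<le> n \<Longrightarrow> \<bar>d k\<bar> \<le> M"
  shows "\<bar>tform d p p\<bar> \<le> M * (real n + 1) * (\<Sum>i\<le>n. (coeff p i)\<^sup>2)"
proof -
  have "\<bar>coeff p i * coeff p j * d ((i - j) + (j - i))\<bar> \<le> M * ((coeff p i)\<^sup>2 + (coeff p j)\<^sup>2) / 2"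
    if "i \<le> n" "j \<le> n" for i j
  proof -
    have d: "\<bar>d ((i - j) + (j - i))\<bar> \<le> M" by (rule assms(2)) (use that in auto)
    have "\<bar>coeff p i * coeff p j\<bar> \<le> ((coeff p i)\<^sup>2 + (coeff p j)\<^sup>2) / 2"
      using zero_le_power2[of "coeff p i - coeff p j"] zero_le_power2[of "coeff p i + coeff p j"]
      by (simp add: power2_eq_square algebra_simps abs_le_iff)
    then have "\<bar>coeff p i * coeff p j\<bar> * \<bar>d ((i - j) + (j - i))\<bar> \<le> ((coeff p i)\<^sup>2 + (coeff p j)\<^sup>2) / 2 * M"
      by (intro mult_mono d) auto
    then show ?thesis by (simp add: abs_mult mult.commute)
  qed
  then have "\<bar>tform d p p\<bar> \<le> (\<Sum>i\<le>n. \<Sum>j\<le>n. M * ((coeff p i)\<^sup>2 + (coeff p j)\<^sup>2) / 2)"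
    unfolding tform_eq_sum[OF assms(1) assms(1)]
    by (intro order_trans[OF sum_abs] sum_mono) auto
  also have "\<dots> = M * (real n + 1) * (\<Sum>i\<le>n. (coeff p i)\<^sup>2)"
  proof -
    define T where "T = (\<Sum>i\<le>n. (coeff p i)\<^sup>2)"
    have "(\<Sum>i\<le>n. \<Sum>j\<le>n. M * ((coeff p i)\<^sup>2 + (coeff p j)\<^sup>2) / 2)
       = M / 2 * (\<Sum>i\<le>n. \<Sum>j\<le>n. (coeff p i)\<^sup>2 + (coeff p j)\<^sup>2)"
      by (simp only: sum_distrib_left times_divide_eq_left)
    also have "(\<Sum>i\<le>n. \<Sum>j\<le>n. (coeff p i)\<^sup>2 + (coeff p j)\<^sup>2) = 2 * (real n + 1) * T"
      by (simp add: T_def sum.distrib algebra_simps flip: sum_distrib_left)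
    also have "M / 2 * (2 * (real n + 1) * T) = M * (real n + 1) * T" by simp
    finally show ?thesis by (simp only: T_def)
  qed
  finally show ?thesis .
qed

text \<open>Bounds a perturbation by \<open>c\<close> itself as a quadratic form. The perturbation
  estimates measure smallness in this relative sense, and \<open>K\<close> depends on
  \<open>c\<close> and \<open>n\<close> only.\<close>

lemma pdef_dominates:
  assumes "pdef n c"
  obtains K where "K > 0"
    "\<And>d M p. \<lbrakk>degree p \<le> n; \<And>k. k \<le> n \<Longrightarrow> \<bar>d k\<bar> \<le> M\<rbrakk> \<Longrightarrow> \<bar>tform d p p\<bar> \<le> K * M * tform c p p"
proof -
  obtain K where K: "K > 0" "\<And>p. degree p \<le> n \<Longrightarrow> (\<Sum>i\<le>n. (coeff p i)\<^sup>2) \<le> K * tform c p p"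
    using pdef_coercive[OF assms] by blast
  have "\<bar>tform d p p\<bar> \<le> (real n + 1) * K * M * tform c p p"
    if "degree p \<le> n" "\<And>k. k \<le> n \<Longrightarrow> \<bar>d k\<bar> \<le> M" for d M p
  proof -
    have M: "M \<ge> 0" using that(2)[of 0] by linarith
    have "\<bar>tform d p p\<bar> \<le> M * (real n + 1) * (\<Sum>i\<le>n. (coeff p i)\<^sup>2)"
      by (rule tform_abs_le) (use that in auto)
    also have "\<dots> \<le> M * (real n + 1) * (K * tform c p p)"
      by (intro mult_left_mono K(2) that(1)) (use M in auto)
    finally show ?thesis by (simp add: algebra_simps)
  qed
  then show ?thesis using K(1) that[of "(real n + 1) * K"] by simp
qed

text \<open>The second-order term of \<open>opnorm\<close> at \<open>c\<close> in direction \<open>d\<close>, already diagonalized; \<open>riesz\<close> is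
  the corresponding first-order change of the orthogonal polynomial.\<close>

definition second_order :: "(nat \<Rightarrow> real) \<Rightarrow> nat \<Rightarrow> (nat \<Rightarrow> real) \<Rightarrow> real" where
  "second_order c l d = (\<Sum>j<l. (tform d (opoly c l) (opoly c j))\<^sup>2 / opnorm c j)"

definition riesz :: "(nat \<Rightarrow> real) \<Rightarrow> nat \<Rightarrow> (nat \<Rightarrow> real) \<Rightarrow> real poly" where
  "riesz c l d = (\<Sum>j<l. smult (- tform d (opoly c l) (opoly c j) / opnorm c j) (opoly c j))"

lemma degree_riesz: "degree (riesz c l d) < l \<or> riesz c l d = 0"
proof (cases "l = 0")
  case False
  then have "degree (riesz c l d) < l"
    unfolding riesz_def by (intro degree_sum_less) (auto intro: le_less_trans[OF degree_smult_le])
  then show ?thesis ..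
qed (simp add: riesz_def)

text \<open>By linearity it is enough to test on the orthogonal basis Phi_j, where a single summand
  survives: \<open>riesz\<close> represents the functional -<Phi_l, .>_d on the lower
  degrees.\<close>

lemma tform_riesz:
  assumes "pdef l c" "degree q < l \<or> q = 0"
  shows "tform c (riesz c l d) q = - tform d (opoly c l) q"
proof -
  have "tform c (riesz c l d) q + tform d (opoly c l) q = 0"
  proof (rule additive_zero_on_opolys[where n = l and c = c and
        f = "\<lambda>q. tform c (riesz c l d) q + tform d (opoly c l) q"])
    fix j assume j: "j < l"
    have z: "tform c (opoly c i) (opoly c j) = 0" if "i < l" "i \<noteq> j" for i
    proof (cases "i < j")
      case True
      then show ?thesis using opoly_orthogonal[OF assms(1), of j "opoly c i"] j by (simp add: tform_commute)
    next
      case False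
      then show ?thesis using opoly_orthogonal[OF assms(1), of i "opoly c j"] that by simp
    qed
    have "tform c (riesz c l d) (opoly c j) =
      (\<Sum>i<l. - tform d (opoly c l) (opoly c i) / opnorm c i * tform c (opoly c i) (opoly c j))"
      by (simp add: riesz_def tform_sum_left tform_smult_left tform_minus_left)
    also have "\<dots> = (\<Sum>i\<in>{j}. - tform d (opoly c l) (opoly c i) / opnorm c i * tform c (opoly c i) (opoly c j))"
      by (rule sum.mono_neutral_right) (use j z in auto)
    also have "\<dots> = - tform d (opoly c l) (opoly c j)"
      using pdef_opnorm[OF assms(1), of j] j by (simp add: opnorm_def)
    finally show "tform c (riesz c l d) (opoly c j) + tform d (opoly c l) (opoly c j) = 0" by simp
  qed (use assms in \<open>simp_all add: tform_linear algebra_simps\<close>)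
  then show ?thesis by simp
qed

lemma tform_riesz_self:
  assumes "pdef l c"
  shows "tform c (riesz c l d) (riesz c l d) = second_order c l d"
proof -
  have "tform c (riesz c l d) (riesz c l d) = - tform d (opoly c l) (riesz c l d)"
    by (rule tform_riesz[OF assms degree_riesz])
  also have "\<dots> = second_order c l d"
    by (simp add: riesz_def tform_sum_right tform_smult_right tform_minus_right second_order_def
        power2_eq_square sum_negf)
  finally show ?thesis .
qed

lemma second_order_nonneg: "pdef l c \<Longrightarrow> second_order c l d \<ge> 0"
  unfolding second_order_def by (intro sum_nonneg) (auto intro!: divide_nonneg_pos pdef_opnorm)

lemma second_order_scale: "second_order c l (\<lambda>k. a * d k) = a\<^sup>2 * second_order c l d"
  by (simp add: second_order_def tform_scale power_mult_distrib sum_distrib_left)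

text \<open>If the sum of squares vanishes, Phi_l is \<open>d\<close>-orthogonal to all lower
  powers, and \<open>G\<close> adds z^l. Then \<open>szego_determines\<close> with \<rho> = 0 forces
  \<open>d\<close> to vanish up to l. For \<open>d = c\<close> the sum vanishes too, so
  \<open>G\<close> carries weight.\<close>

lemma second_order_pos:
  assumes pd: "pdef l c" and G: "tform d (opoly c l) (opoly c l) = 0" and "k \<le> l" "d k \<noteq> 0"
  shows "second_order c l d > 0"
proof (rule ccontr)
  assume "\<not> second_order c l d > 0"
  then have "second_order c l d = 0" using second_order_nonneg[OF pd, of d] by linarith
  then have "\<forall>j\<in>{..<l}. (tform d (opoly c l) (opoly c j))\<^sup>2 / opnorm c j = 0"
    unfolding second_order_def
    by (subst (asm) sum_nonneg_eq_0_iff) (auto intro!: divide_nonneg_pos pdef_opnorm[OF pd])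
  then have z: "tform d (opoly c l) (opoly c j) = 0" if "j < l" for j
    using that pdef_opnorm[OF pd, of j] by auto
  have low: "tform d (opoly c l) (monom 1 j) = 0" if "j < l" for j
    by (rule additive_zero_on_opolys[where f = "tform d (opoly c l)" and n = l and c = c])
      (use that z in \<open>simp_all add: tform_linear degree_monom_eq\<close>)
  have "tform d (opoly c l) (monom 1 l) = 0" using opoly_top[of l d c] low G by simp
  then have "tform d (opoly c l) (monom 1 j) = (if j = l then 0 else 0)" if "j \<le> l" for j
    using low that by (cases "j = l") auto
  from szego_determines[OF pd this \<open>k \<le> l\<close>] show False using \<open>d k \<noteq> 0\<close> by simp
qed

text \<open>Testing the minimality of \<open>opnorm\<close> with a shortened Newton step gives a bound without any
  smallness assumption on \<open>d\<close>.\<close>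

lemma opnorm_perturb_upper:
  assumes pd: "pdef l c" and pd': "pdef l (\<lambda>k. c k + d k)" and M: "L \<ge> 0"
    and dom: "\<And>p. degree p \<le> l \<Longrightarrow> \<bar>tform d p p\<bar> \<le> L * tform c p p"
  shows "opnorm (\<lambda>k. c k + d k) l \<le>
    opnorm c l + tform d (opoly c l) (opoly c l) - second_order c l d / (1 + L)"
proof -
  \<comment> \<open>\<open>s\<close> minimizes s^2 (1 + L) - 2 s, the factor of B in the estimate
    below; adding s D keeps the test polynomial monic.\<close>
  define P D B s where "P = opoly c l" and "D = riesz c l d" and "B = second_order c l d"
    and "s = 1 / (1 + L)"
  have D: "degree D < l \<or> D = 0" unfolding D_def by (rule degree_riesz)
  then have dD: "degree D \<le> l" by auto
  have "coeff D l = 0" using D by (auto simp: coeff_eq_0)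
  then have "opnorm (\<lambda>k. c k + d k) l \<le> tform (\<lambda>k. c k + d k) (P + smult s D) (P + smult s D)"
    by (intro opnorm_minimal pd') (use dD in \<open>auto simp: P_def intro!: degree_add_le order_trans[OF degree_smult_le]\<close>)
  also have "\<dots> = tform c P P + 2 * s * tform c P D + s\<^sup>2 * tform c D D +
      (tform d P P + 2 * s * tform d P D + s\<^sup>2 * tform d D D)"
    unfolding tform_plus
    by (simp add: tform_linear tform_commute[of _ D P] power2_eq_square algebra_simps)
  also have "tform c P D = 0" unfolding P_def by (rule opoly_orthogonal[OF pd _ D]) simp
  also have "tform c D D = B" unfolding D_def B_def by (rule tform_riesz_self[OF pd])
  also have "tform d P D = - B" using tform_riesz[OF pd D, of d] tform_riesz_self[OF pd, of d]
    by (simp add: D_def B_def P_def)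
  also have "tform c P P + 2 * s * 0 + s\<^sup>2 * B + (tform d P P + 2 * s * (- B) + s\<^sup>2 * tform d D D)
     \<le> tform c P P + 2 * s * 0 + s\<^sup>2 * B + (tform d P P + 2 * s * (- B) + s\<^sup>2 * (L * B))"
    using dom[OF dD] tform_riesz_self[OF pd, of d]
    using M by (intro add_mono mult_left_mono) (auto simp: D_def B_def s_def)
  also have "\<dots> = tform c P P + tform d P P + B * (s * (s * (1 + L)) - 2 * s)"
    by (simp add: algebra_simps power2_eq_square)
  also have "s * (1 + L) = 1" using M by (simp add: s_def)
  finally show ?thesis by (simp add: P_def B_def opnorm_def s_def)
qed

text \<open>Here Phi_l + p is the new orthogonal polynomial itself. The perturbed form dominates t =
  1 - L times the old one, and expanding the square of t p - D gives t <p,p> - 2 <D,p> >= -<D,D> /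
  t.\<close>

lemma opnorm_perturb_lower:
  assumes pd: "pdef l c" and L: "0 \<le> L" "L < 1"
    and dom: "\<And>p. degree p \<le> l \<Longrightarrow> \<bar>tform d p p\<bar> \<le> L * tform c p p"
  shows "pdef l (\<lambda>k. c k + d k)"
    and "opnorm c l + tform d (opoly c l) (opoly c l) - second_order c l d / (1 - L) \<le>
      opnorm (\<lambda>k. c k + d k) l"
proof -
  have ge: "tform (\<lambda>k. c k + d k) p p \<ge> (1 - L) * tform c p p" if "degree p \<le> l" for p
    using dom[OF that] by (simp add: tform_plus algebra_simps abs_le_iff)
  then show pd': "pdef l (\<lambda>k. c k + d k)"
    unfolding pdef_def using L pdefD[OF pd] by (metis diff_gt_0_iff_gt less_le_trans mult_pos_pos)
  let ?e = "\<lambda>k. c k + d k"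
  define P p D B where "P = opoly c l" and "p = opoly ?e l - P" and "D = riesz c l d"
    and "B = second_order c l d"
  have p: "degree p < l \<or> p = 0" unfolding p_def P_def by (rule monic_minus_monic) auto
  have Pp: "tform c P p = 0" unfolding P_def by (rule opoly_orthogonal[OF pd _ p]) simp
  have dp: "tform d P p = - tform c D p"
    using tform_riesz[OF pd p, of d] by (simp add: P_def D_def)
  have BD: "tform c D D = B" unfolding D_def B_def by (rule tform_riesz_self[OF pd])
  have "opnorm ?e l = tform ?e (P + p) (P + p)" by (simp add: opnorm_def p_def)
  also have "\<dots> = tform ?e P P + 2 * tform ?e P p + tform ?e p p"
    by (simp add: tform_linear tform_commute[of _ p P])
  also have "tform ?e P P = opnorm c l + tform d P P" by (simp add: tform_plus opnorm_def P_def)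
  also have "tform ?e P p = - tform c D p" by (simp add: tform_plus Pp dp)
  finally have eq: "opnorm ?e l = opnorm c l + tform d P P + 2 * - tform c D p + tform ?e p p" .
  define t where "t = 1 - L"
  have t: "t > 0" using L by (simp add: t_def)
  have "degree p \<le> l" using p by auto
  then have ge_p: "tform ?e p p \<ge> t * tform c p p" unfolding t_def by (rule ge)
  have "0 \<le> tform c (smult t p - D) (smult t p - D)"
  proof (rule pdef_nonneg[OF pd])
    have "degree D \<le> l" using degree_riesz[of c l d] unfolding D_def by auto
    then show "degree (smult t p - D) \<le> l" using \<open>degree p \<le> l\<close>
      by (intro degree_diff_le order_trans[OF degree_smult_le])
  qed
  also have "\<dots> = t * (t * tform c p p - 2 * tform c D p + B / t)"
    using t BD by (simp add: tform_linear tform_commute[of c p D] field_simps)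
  finally have "t * tform c p p - 2 * tform c D p \<ge> - (B / t)"
    using t by (simp add: zero_le_mult_iff)
  with eq ge_p show "opnorm c l + tform d (opoly c l) (opoly c l) - second_order c l d / (1 - L) \<le> opnorm ?e l"
    by (simp add: P_def B_def t_def)
qed

section \<open>Values on the circle and zeros of the reversed polynomial\<close>

definition cpoly :: "real poly \<Rightarrow> complex \<Rightarrow> complex" where
  "cpoly p z = (\<Sum>i\<le>degree p. complex_of_real (coeff p i) * z ^ i)"

lemma cpoly_eq_sum: "degree p \<le> n \<Longrightarrow> cpoly p z = (\<Sum>i\<le>n. complex_of_real (coeff p i) * z ^ i)"
  unfolding cpoly_def by (rule sum.mono_neutral_left) (auto simp: coeff_eq_0)

lemma cpoly_1 [simp]: "cpoly 1 z = 1"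
  by (simp add: cpoly_def)

lemma cpoly_diff: "cpoly (p - q) z = cpoly p z - cpoly q z"
proof -
  define N where "N = max (degree p) (degree q)"
  have "degree p \<le> N" "degree q \<le> N" "degree (p - q) \<le> N"
    by (auto simp: N_def degree_diff_le)
  then show ?thesis by (simp add: cpoly_eq_sum[where n = N] sum_subtractf left_diff_distrib)
qed

lemma cpoly_smult: "cpoly (smult a p) z = of_real a * cpoly p z"
  by (simp add: cpoly_eq_sum[where n = "degree p"] degree_smult_le sum_distrib_left mult.assoc)

lemma cpoly_pCons_0: "cpoly (pCons 0 p) z = z * cpoly p z"
  by (simp add: cpoly_eq_sum[where n = "Suc (degree p)"] cpoly_def degree_pCons_le
      sum.atMost_Suc_shift sum_distrib_left mult_ac del: sum.atMost_Suc)

text \<open>|1 - a w|^2 - |w - a|^2 = (1 - a^2) (1 - |w|^2).\<close>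

lemma mobius_le:
  fixes w :: complex and a :: real
  assumes "norm w \<le> 1" "\<bar>a\<bar> \<le> 1"
  shows "norm (w - of_real a) \<le> norm (1 - of_real a * w)"
proof -
  have "(norm (w - of_real a))\<^sup>2 = (Re w - a)\<^sup>2 + (Im w)\<^sup>2"
    by (simp add: cmod_power2)
  also have "\<dots> = (1 - a * Re w)\<^sup>2 + (a * Im w)\<^sup>2 - (1 - a\<^sup>2) * (1 - ((Re w)\<^sup>2 + (Im w)\<^sup>2))"
    by (simp add: power2_eq_square algebra_simps)
  also have "\<dots> \<le> (1 - a * Re w)\<^sup>2 + (a * Im w)\<^sup>2"
    using assms by (simp add: abs_square_le_1 flip: cmod_power2)
  also have "\<dots> = (norm (1 - of_real a * w))\<^sup>2"
    by (simp add: cmod_power2)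
  finally show ?thesis by (simp add: power2_le_iff_abs_le)
qed

text \<open>Schur's argument: w = z Phi_n / Psi_n stays in the closed disc, and the next quotient
  Phi / Psi is the Moebius image (w - a) / (1 - a w). The bound on the quotient is what keeps the
  next Psi from vanishing, so both claims go together.\<close>

lemma szego_disc:
  assumes "\<And>j. j < n \<Longrightarrow> \<bar>verblunsky c j\<bar> < 1" "norm z \<le> 1"
  shows "norm (cpoly (opoly c n) z) \<le> norm (cpoly (rpoly c n) z) \<and> cpoly (rpoly c n) z \<noteq> 0"
  using assms
proof (induction n)
  case (Suc n)
  define A B a where "A = cpoly (opoly c n) z" and "B = cpoly (rpoly c n) z" and "a = verblunsky c n"
  have AB: "norm A \<le> norm B" "B \<noteq> 0" using Suc by (auto simp: A_def B_def)
  have a: "\<bar>a\<bar> < 1" using Suc.prems by (simp add: a_def)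
  define w where "w = z * A / B"
  have w: "norm w \<le> 1"
    using AB Suc.prems(2) mult_mono[of "norm z" 1 "norm A" "norm B"]
    by (simp add: w_def norm_divide norm_mult divide_le_eq)
  have P: "cpoly (opoly c (Suc n)) z = B * (w - of_real a)"
    using AB by (simp add: opoly_Suc cpoly_diff cpoly_smult cpoly_pCons_0 w_def A_def B_def a_def field_simps)
  have R: "cpoly (rpoly c (Suc n)) z = B * (1 - of_real a * w)"
    using AB by (simp add: rpoly_Suc cpoly_diff cpoly_smult cpoly_pCons_0 w_def A_def B_def a_def field_simps)
  have "norm (of_real a * w) < 1"
    using a w mult_left_mono[OF w, of "\<bar>a\<bar>"] by (simp add: norm_mult)
  then have "of_real a * w \<noteq> 1" by auto
  then show ?case using AB mobius_le[OF w, of a] a by (simp add: P R norm_mult mult_left_mono)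
qed simp

lemma pdef_disc:
  assumes "pdef n c" "norm z \<le> 1"
  shows "cpoly (rpoly c n) z \<noteq> 0"
proof -
  have "\<bar>verblunsky c j\<bar> < 1" if "j < n" for j
    using pdef_mono[OF assms(1), of "Suc j"] that by (simp add: pdef_Suc_verblunsky)
  then show ?thesis using szego_disc assms(2) by blast
qed

text \<open>On the circle 1/z = cnj z, so the reversed polynomial is the conjugate up to the factor
  z^n; in particular |Psi_n| = |Phi_n| there.\<close>

lemma cpoly_rpoly_circle:
  assumes "norm z = 1"
  shows "cpoly (rpoly c n) z = z ^ n * cnj (cpoly (opoly c n) z)"
proof -
  have zc: "z * cnj z = 1" using assms complex_norm_square[of z] by simp
  have pw: "z ^ n * cnj z ^ i = z ^ (n - i)" if "i \<le> n" for i
  proof -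
    have "z ^ n * cnj z ^ i = z ^ (n - i) * (z ^ i * cnj z ^ i)"
      using that by (metis le_add_diff_inverse2 mult.assoc power_add)
    then show ?thesis by (simp add: zc flip: power_mult_distrib)
  qed
  have "cpoly (rpoly c n) z = (\<Sum>i\<le>n. complex_of_real (coeff (opoly c n) (n - i)) * z ^ i)"
    by (simp add: cpoly_eq_sum[OF degree_rpoly_le] coeff_rpoly)
  also have "\<dots> = (\<Sum>i\<le>n. complex_of_real (coeff (opoly c n) i) * z ^ (n - i))"
    by (rule sum.reindex_bij_witness[of _ "\<lambda>i. n - i" "\<lambda>i. n - i"]) auto
  also have "\<dots> = (\<Sum>i\<le>n. z ^ n * cnj (complex_of_real (coeff (opoly c n) i) * z ^ i))"
    by (intro sum.cong refl) (simp add: pw[symmetric])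
  also have "\<dots> = z ^ n * cnj (cpoly (opoly c n) z)"
    by (simp add: cpoly_eq_sum[of "opoly c n" n] sum_distrib_left)
  finally show ?thesis .
qed

text \<open>The numbers cos(k t) are the moments of two half masses at \<open>cis t\<close> and its
  conjugate. Integrating over t turns this pointwise identity into the form of a measure.\<close>

lemma tform_cis:
  "tform (\<lambda>k. cos (real k * t)) p q = Re (cpoly p (cis t) * cnj (cpoly q (cis t)))"
proof -
  have c: "cos (real ((i - j) + (j - i)) * t) = Re (cis t ^ i * cnj (cis t ^ j))" for i j :: nat
  proof -
    have "cis t ^ i * cnj (cis t ^ j) = cis (real i * t - real j * t)"
      by (simp only: Complex.DeMoivre cis_cnj cis_mult) simp
    then have "Re (cis t ^ i * cnj (cis t ^ j)) = cos (real i * t - real j * t)" by simp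
    moreover have "cos (real ((i - j) + (j - i)) * t) = cos (real i * t - real j * t)"
    proof (cases "i \<le> j")
      case True
      then show ?thesis using cos_minus[of "real i * t - real j * t"] by (simp add: of_nat_diff algebra_simps)
    qed (simp add: of_nat_diff algebra_simps)
    ultimately show ?thesis by simp
  qed
  have Re_mult: "Re (of_real a * w) = a * Re w" for a w by simp
  have "cpoly p (cis t) * cnj (cpoly q (cis t)) = (\<Sum>i\<le>degree p. \<Sum>j\<le>degree q.
      of_real (coeff p i * coeff q j) * (cis t ^ i * cnj (cis t ^ j)))"
    by (simp add: cpoly_def sum_product mult_ac)
  also have "Re \<dots> = (\<Sum>i\<le>degree p. \<Sum>j\<le>degree q.
      coeff p i * coeff q j * Re (cis t ^ i * cnj (cis t ^ j)))"
    by (simp only: Re_sum Re_mult)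
  finally show ?thesis by (simp only: tform_def c)
qed

section \<open>Chebyshev coordinates\<close>

text \<open>T_n(1 - 2x) for the Chebyshev polynomial T_n, which is cos(n t) at x = (1 - cos t) /
  2.\<close>

fun cheb :: "nat \<Rightarrow> real poly" where
  "cheb 0 = 1"
| "cheb (Suc 0) = [:1, -2:]"
| "cheb (Suc (Suc n)) = [:2, -4:] * cheb (Suc n) - cheb n"

lemma poly_cheb: "poly (cheb n) ((1 - cos t) / 2) = cos (real n * t)"
proof (induction n rule: cheb.induct)
  case (3 n)
  have "cos (real (Suc (Suc n)) * t) = 2 * cos t * cos (real (Suc n) * t) - cos (real n * t)"
  proof -
    have e: "real (Suc (Suc n)) * t = real (Suc n) * t + t" "real n * t = real (Suc n) * t - t"
      by (simp_all add: algebra_simps)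
    show ?thesis unfolding e cos_add cos_diff by simp
  qed
  moreover have "poly [:2, -4:] ((1 - cos t) / 2) = 2 * cos t" by (simp add: field_simps)
  moreover have "poly (cheb (Suc (Suc n))) x = poly [:2, -4:] x * poly (cheb (Suc n)) x - poly (cheb n) x" for x
    by (simp only: cheb.simps poly_diff poly_mult)
  ultimately show ?case by (simp only: 3)
qed (simp_all add: field_simps)

lemma cheb_degree_top: "degree (cheb n) \<le> n \<and> coeff (cheb n) n \<noteq> 0"
proof (induction n rule: cheb.induct)
  case (3 n)
  have "degree ([:2, -4:] * cheb (Suc n)) \<le> Suc (Suc n)"
    using 3 degree_mult_le[of "[:2, -4:]" "cheb (Suc n)"] by simp
  then have "degree (cheb (Suc (Suc n))) \<le> Suc (Suc n)"
    using 3 by (auto intro!: degree_diff_le)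
  moreover have "coeff (cheb (Suc (Suc n))) (Suc (Suc n)) = - 4 * coeff (cheb (Suc n)) (Suc n)"
    using 3 by (simp add: coeff_eq_0)
  ultimately show ?case using 3 by simp
qed simp_all

lemma degree_cheb: "degree (cheb n) \<le> n" and coeff_cheb_top: "coeff (cheb n) n \<noteq> 0"
  using cheb_degree_top by auto

text \<open>The linear functional x^j -> a_j applied to T_k(1 - 2x); for moments \<open>a\<close>
  these are the cosine moments. The map is triangular with diagonal entries
  \<open>coeff (cheb k) k\<close>.\<close>

definition cheb_seq :: "(nat \<Rightarrow> real) \<Rightarrow> nat \<Rightarrow> real" where
  "cheb_seq a k = (\<Sum>j\<le>k. coeff (cheb k) j * a j)"

lemma cheb_seq_0 [simp]: "cheb_seq a 0 = a 0"
  by (simp add: cheb_seq_def)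

lemma cheb_seq_cong: "(\<And>j. j \<le> k \<Longrightarrow> a j = b j) \<Longrightarrow> cheb_seq a k = cheb_seq b k"
  by (simp add: cheb_seq_def)

lemma cheb_seq_add: "cheb_seq (\<lambda>j. a j + b j) = (\<lambda>k. cheb_seq a k + cheb_seq b k)"
  by (rule ext) (simp add: cheb_seq_def sum.distrib algebra_simps)

lemma cheb_seq_scale: "cheb_seq (\<lambda>j. s * a j) = (\<lambda>k. s * cheb_seq a k)"
  by (rule ext) (simp add: cheb_seq_def sum_distrib_left algebra_simps)

lemma cheb_seq_power: "cheb_seq (\<lambda>j. x ^ j) k = poly (cheb k) x"
proof -
  have "poly (cheb k) x = (\<Sum>j\<le>degree (cheb k). coeff (cheb k) j * x ^ j)" by (rule poly_altdef)
  also have "\<dots> = (\<Sum>j\<le>k. coeff (cheb k) j * x ^ j)"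
    by (rule sum.mono_neutral_left) (auto simp: degree_cheb coeff_eq_0)
  finally show ?thesis by (simp add: cheb_seq_def)
qed

lemma cheb_seq_top:
  assumes "\<And>j. j < n \<Longrightarrow> a j = b j"
  shows "cheb_seq a n - cheb_seq b n = coeff (cheb n) n * (a n - b n)"
proof -
  have "(\<Sum>j<n. coeff (cheb n) j * a j) = (\<Sum>j<n. coeff (cheb n) j * b j)" using assms by simp
  then show ?thesis by (simp add: cheb_seq_def algebra_simps flip: lessThan_Suc_atMost)
qed

lemma cheb_seq_inj:
  assumes "\<And>k. k \<le> n \<Longrightarrow> cheb_seq a k = cheb_seq b k" "j \<le> n"
  shows "a j = b j"
  using assms(2)
proof (induction j rule: less_induct)
  case (less j)
  have "coeff (cheb j) j * (a j - b j) = 0"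
    using cheb_seq_top[of j a b] less assms(1)[of j] by simp
  then show ?case using coeff_cheb_top by simp
qed

text \<open>The polynomial in x with value Re(p cnj q) at the point \<open>cis t\<close>; it turns
  the Toeplitz form of \<open>cheb_seq a\<close> into the functional of \<open>a\<close> applied to
  one polynomial.\<close>

definition toep_poly :: "real poly \<Rightarrow> real poly \<Rightarrow> real poly" where
  "toep_poly p q = (\<Sum>i\<le>degree p. \<Sum>j\<le>degree q. smult (coeff p i * coeff q j) (cheb ((i - j) + (j - i))))"

lemma degree_toep_poly:
  assumes "degree p \<le> n" "degree q \<le> n"
  shows "degree (toep_poly p q) \<le> n"
  unfolding toep_poly_def
proof (intro degree_sum_le)
  fix i j assume "i \<in> {..degree p}" "j \<in> {..degree q}"
  then have "(i - j) + (j - i) \<le> n" using assms by auto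
  then show "degree (smult (coeff p i * coeff q j) (cheb ((i - j) + (j - i)))) \<le> n"
    using degree_cheb[of "(i - j) + (j - i)"] degree_smult_le order_trans by metis
qed simp_all

lemma tform_cheb_seq:
  assumes "degree p \<le> n" "degree q \<le> n"
  shows "tform (cheb_seq a) p q = (\<Sum>j\<le>n. coeff (toep_poly p q) j * a j)"
proof -
  have c: "cheb_seq a ((i - j) + (j - i)) = (\<Sum>k\<le>n. coeff (cheb ((i - j) + (j - i))) k * a k)"
    if "i \<le> degree p" "j \<le> degree q" for i j
    unfolding cheb_seq_def
  proof (rule sum.mono_neutral_left)
    show "{..i - j + (j - i)} \<subseteq> {..n}" using that assms by auto
    show "\<forall>k\<in>{..n} - {..i - j + (j - i)}. coeff (cheb (i - j + (j - i))) k * a k = 0"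
      using degree_cheb[of "i - j + (j - i)"] by (auto simp: coeff_eq_0)
  qed simp
  have "tform (cheb_seq a) p q = (\<Sum>i\<le>degree p. \<Sum>j\<le>degree q. \<Sum>k\<le>n.
      coeff p i * coeff q j * coeff (cheb ((i - j) + (j - i))) k * a k)"
    unfolding tform_def by (intro sum.cong refl) (simp add: c sum_distrib_left mult.assoc)
  also have "\<dots> = (\<Sum>i\<le>degree p. \<Sum>k\<le>n. \<Sum>j\<le>degree q.
      coeff p i * coeff q j * coeff (cheb ((i - j) + (j - i))) k * a k)"
    by (subst sum.swap) (rule refl)
  also have "\<dots> = (\<Sum>k\<le>n. \<Sum>i\<le>degree p. \<Sum>j\<le>degree q.
      coeff p i * coeff q j * coeff (cheb ((i - j) + (j - i))) k * a k)"
    by (rule sum.swap)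
  also have "\<dots> = (\<Sum>k\<le>n. coeff (toep_poly p q) k * a k)"
    by (simp add: toep_poly_def coeff_sum sum_distrib_right)
  finally show ?thesis .
qed

lemma poly_toep_poly: "poly (toep_poly p q) x = tform (cheb_seq (\<lambda>j. x ^ j)) p q"
  by (simp add: toep_poly_def poly_sum tform_def cheb_seq_power)

lemma poly_toep_poly_cos:
  "poly (toep_poly p q) ((1 - cos t) / 2) = Re (cpoly p (cis t) * cnj (cpoly q (cis t)))"
proof -
  have "cheb_seq (\<lambda>j. ((1 - cos t) / 2) ^ j) = (\<lambda>k. cos (real k * t))"
    by (rule ext) (simp add: cheb_seq_power poly_cheb)
  then show ?thesis by (simp add: poly_toep_poly tform_cis)
qed

lemma unit_interval_cos:
  assumes "x \<in> {0..1::real}" obtains t where "t \<in> {0..pi}" "x = (1 - cos t) / 2"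
proof
  show "arccos (1 - 2 * x) \<in> {0..pi}" using assms by (auto intro!: arccos_lbound arccos_ubound)
  show "x = (1 - cos (arccos (1 - 2 * x))) / 2" using assms by (simp add: cos_arccos)
qed

lemma poly_toep_poly_self_nonneg: "x \<in> {0..1} \<Longrightarrow> poly (toep_poly p p) x \<ge> 0"
  by (erule unit_interval_cos) (simp only: poly_toep_poly_cos complex_norm_square[symmetric]
      Re_complex_of_real zero_le_power2)

lemma poly_toep_poly_opoly_pos:
  assumes "pdef n c" "x \<in> {0..1}"
  shows "poly (toep_poly (opoly c n) (opoly c n)) x > 0"
proof -
  obtain t where t: "x = (1 - cos t) / 2" using unit_interval_cos[OF assms(2)] by blast
  have "cpoly (opoly c n) (cis t) \<noteq> 0"
    using pdef_disc[OF assms(1), of "cis t"] cpoly_rpoly_circle[of "cis t" c n] by auto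
  then show ?thesis
    unfolding t by (simp only: poly_toep_poly_cos complex_norm_square[symmetric]
      Re_complex_of_real zero_less_power2 norm_eq_zero not_False_eq_True)
qed

text \<open>Test the form on 1 + z^k and 1 - z^k. With mass one this confines all entries to [-1,1],
  which later gives a global bound.\<close>

lemma pdef_abs_le:
  assumes "pdef n c" "k \<le> n" shows "\<bar>c k\<bar> \<le> c 0"
proof (cases "k = 0")
  case True
  then show ?thesis using pdef_mono[OF assms(1), of 0] by (simp add: pdef_0)
next
  case False
  have e: "tform c (1 + smult s (monom 1 k)) (1 + smult s (monom 1 k)) = (1 + s\<^sup>2) * c 0 + 2 * s * c k" for s
  proof -
    have "tform c (monom 1 k) (monom 1 k) = c 0"
      by (simp add: tform_monom[where n = k] degree_monom_eq if_distrib[where f = "\<lambda>x. x * _"] cong: if_cong)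
    moreover have "tform c 1 (monom 1 k) = c k" by (simp add: tform_monom[where n = 0])
    moreover have "tform c 1 1 = c 0" by (simp add: tform_def)
    ultimately show ?thesis
      by (simp add: tform_linear tform_commute[of c "monom 1 k" 1] power2_eq_square algebra_simps)
  qed
  have "degree (1 + smult s (monom (1::real) k)) \<le> n" for s
    using assms(2) by (intro degree_add_le order_trans[OF degree_smult_le]) (simp_all add: degree_monom_eq)
  then have "(1 + s\<^sup>2) * c 0 + 2 * s * c k \<ge> 0" for s
    unfolding e[symmetric] by (rule pdef_nonneg[OF assms(1)])
  from this[of 1] this[of "-1"] show ?thesis by (simp add: abs_le_iff)
qed

lemma verblunsky_diff:
  assumes "\<And>k. k \<le> n \<Longrightarrow> c k = d k" 
  shows "verblunsky d n - verblunsky c n = (d (Suc n) - c (Suc n)) / opnorm c n"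
proof -
  have e: "opoly d n = opoly c n" "opnorm d n = opnorm c n"
    using opoly_cong[of n d c] opnorm_cong[of n d c] assms by auto
  have t: "tform f (pCons 0 (opoly c n)) 1 = f (Suc n) + (\<Sum>i\<le>n. coeff (pCons 0 (opoly c n)) i * f i)" for f
    using tform_monom[of "pCons 0 (opoly c n)" "Suc n" f 0] by (simp add: monom_0 one_pCons)
  have "(\<Sum>i\<le>n. coeff (pCons 0 (opoly c n)) i * d i) = (\<Sum>i\<le>n. coeff (pCons 0 (opoly c n)) i * c i)"
    using assms by simp
  then show ?thesis by (simp add: verblunsky_def e t flip: diff_divide_distrib)
qed

section \<open>Moments of measures on the unit interval\<close>

lemma moment_measures_facts:
  assumes "\<mu> \<in> moment_measures {0..1}"
  shows "prob_space \<mu>" "sets \<mu> = sets borel" "space \<mu> = UNIV" "AE x in \<mu>. x \<in> {0..1}"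
    "integrable \<mu> (\<lambda>x. x ^ j)" "moment \<mu> 0 = 1" "integrable \<mu> (poly p)"
proof -
  interpret prob_space \<mu> using assms by (simp add: moment_measures_def)
  show "prob_space \<mu>" by (rule prob_space_axioms)
  show s: "sets \<mu> = sets borel" using assms by (simp add: moment_measures_def)
  show "space \<mu> = UNIV" using sets_eq_imp_space_eq[OF s] by simp
  show "AE x in \<mu>. x \<in> {0..1}"
    by (rule AE_prob_1) (use assms in \<open>simp add: moment_measures_def emeasure_eq_measure\<close>)
  show i: "integrable \<mu> (\<lambda>x. x ^ j)" for j using assms by (simp add: moment_measures_def)
  show "moment \<mu> 0 = 1" by (simp add: moment_def prob_space)
  show "integrable \<mu> (poly p)" unfolding poly_altdef by (intro Bochner_Integration.integrable_sum integrable_mult_right i)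
qed

lemma moment_measuresI:
  assumes "prob_space \<mu>" "sets \<mu> = sets borel" "AE x in \<mu>. x \<in> {0..1}"
  shows "\<mu> \<in> moment_measures {0..1}"
proof -
  interpret prob_space \<mu> by fact
  have m: "f \<in> borel_measurable \<mu>" if "f \<in> borel_measurable borel" for f :: "real \<Rightarrow> real"
    using that measurable_cong_sets[OF assms(2) refl] by auto
  have "integrable \<mu> (\<lambda>x. x ^ j)" for j
  proof (rule integrable_const_bound[of _ 1])
    show "AE x in \<mu>. norm (x ^ j) \<le> 1" using assms(3) by eventually_elim (auto simp: power_le_one)
  qed (auto intro!: m)
  moreover have "emeasure \<mu> {0..1} = 1"
    by (rule emeasure_eq_1_AE) (use assms in auto)
  ultimately show ?thesis using assms by (simp add: moment_measures_def)
qed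

lemma moment_bounds:
  assumes "\<mu> \<in> moment_measures {0..1}"
  shows "0 \<le> moment \<mu> j \<and> moment \<mu> j \<le> 1"
proof -
  note f = moment_measures_facts[OF assms]
  interpret prob_space \<mu> by (rule f)
  have "moment \<mu> j \<le> (\<integral>x. 1 \<partial>\<mu>)" unfolding moment_def
    by (rule integral_mono_AE[OF f(5)]) (use f(4) in \<open>auto intro!: power_le_one\<close>)
  moreover have "0 \<le> moment \<mu> j" unfolding moment_def
    by (rule integral_nonneg_AE) (use f(4) in \<open>auto\<close>)
  ultimately show ?thesis by (simp add: prob_space)
qed

lemma integral_poly:
  assumes "\<mu> \<in> moment_measures {0..1}" "degree p \<le> n"
  shows "(\<integral>x. poly p x \<partial>\<mu>) = (\<Sum>j\<le>n. coeff p j * moment \<mu> j)"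
proof -
  have "poly p x = (\<Sum>j\<le>n. coeff p j * x ^ j)" for x
    unfolding poly_altdef by (rule sum.mono_neutral_left) (use assms(2) in \<open>auto simp: coeff_eq_0\<close>)
  then have "(\<integral>x. poly p x \<partial>\<mu>) = (\<integral>x. (\<Sum>j\<le>n. coeff p j * x ^ j) \<partial>\<mu>)" by simp
  also have "\<dots> = (\<Sum>j\<le>n. coeff p j * moment \<mu> j)"
    using moment_measures_facts(5)[OF assms(1)]
    by (subst Bochner_Integration.integral_sum) (simp_all add: moment_def)
  finally show ?thesis .
qed

lemma tform_moment:
  assumes "\<mu> \<in> moment_measures {0..1}"
  shows "tform (cheb_seq (moment \<mu>)) p q = (\<integral>x. poly (toep_poly p q) x \<partial>\<mu>)"
  using tform_cheb_seq[of p "max (degree p) (degree q)" q "moment \<mu>"]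
    integral_poly[OF assms, of "toep_poly p q" "max (degree p) (degree q)"]
    degree_toep_poly[of p "max (degree p) (degree q)" q] by simp

lemma tform_moment_nonneg:
  assumes "\<mu> \<in> moment_measures {0..1}"
  shows "tform (cheb_seq (moment \<mu>)) p p \<ge> 0"
  unfolding tform_moment[OF assms]
proof (rule integral_nonneg_AE)
  show "AE x in \<mu>. 0 \<le> poly (toep_poly p p) x"
    using moment_measures_facts(4)[OF assms]
    by eventually_elim (rule poly_toep_poly_self_nonneg)
qed

text \<open>On the boundary the last moment is either an end point of its range or is determined by a
  linear recurrence.\<close>

lemma finite_boundary_fibre:
  "finite {t. \<exists>\<mu>\<in>moment_measures {0..1}. (\<forall>j\<in>{1..n}. moment \<mu> j = a j) \<and> moment \<mu> (Suc n) = t \<and>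
      \<not> pdef (Suc n) (cheb_seq (moment \<mu>))}" (is "finite ?T")
proof -
  define c where "c = cheb_seq (a(0 := 1))"
  define top where "top t = cheb_seq (a(0 := 1, Suc n := t)) (Suc n)" for t
  have c0: "c 0 = 1" by (simp add: c_def)
  have low: "cheb_seq (moment \<mu>) k = c k" if "\<mu> \<in> moment_measures {0..1}" "\<forall>j\<in>{1..n}. moment \<mu> j = a j" "k \<le> n" for \<mu> k
    unfolding c_def by (rule cheb_seq_cong) (use that moment_measures_facts(6)[OF that(1)] in auto)
  have high: "cheb_seq (moment \<mu>) (Suc n) = top t" if "\<mu> \<in> moment_measures {0..1}"
    "\<forall>j\<in>{1..n}. moment \<mu> j = a j" "moment \<mu> (Suc n) = t" for \<mu> t
    unfolding top_def by (rule cheb_seq_cong) (use that moment_measures_facts(6)[OF that(1)] in auto)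
  have inj: "inj top"
  proof
    fix s t assume e: "top s = top t"
    have "top s - top t = coeff (cheb (Suc n)) (Suc n) * (s - t)"
      unfolding top_def by (subst cheb_seq_top) auto
    then show "s = t" using e coeff_cheb_top[of "Suc n"] by simp
  qed
  have "\<exists>S. finite S \<and> top ` ?T \<subseteq> S"
  proof (cases "pdef n c")
    case True
    define r where "r = opnorm c n"
    \<comment> \<open>The two end points: a next norm that is nonnegative but not positive means a^2
      = 1.\<close>
    define S where "S = (\<lambda>s. c (Suc n) + (s - verblunsky c n) * r) ` {1, -1}"
    have r: "r > 0" unfolding r_def by (rule pdef_opnorm[OF True order_refl])
    have "top t \<in> S" if t: "t \<in> ?T" for t
    proof -
      obtain \<mu> where m: "\<mu> \<in> moment_measures {0..1}" "\<forall>j\<in>{1..n}. moment \<mu> j = a j" "moment \<mu> (Suc n) = t"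
        "\<not> pdef (Suc n) (cheb_seq (moment \<mu>))" using t by blast
      define d where "d = cheb_seq (moment \<mu>)"
      have cd: "c k = d k" if "k \<le> n" for k using low[OF m(1,2) that] by (simp add: d_def)
      have pd: "pdef n d" using True pdef_cong[of n c d] cd by blast
      have "\<not> \<bar>verblunsky d n\<bar> < 1" using m(4) pd by (simp add: pdef_Suc_verblunsky d_def)
      moreover have "opnorm d (Suc n) = opnorm d n * (1 - (verblunsky d n)\<^sup>2)"
        by (rule opnorm_Suc) (use pdef_opnorm[OF pd] in force)
      moreover have "opnorm d (Suc n) \<ge> 0"
        unfolding opnorm_def d_def by (rule tform_moment_nonneg[OF m(1)])
      moreover have "opnorm d n > 0" by (rule pdef_opnorm[OF pd order_refl])
      ultimately have "(verblunsky d n)\<^sup>2 = 1"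
        using abs_square_less_1[of "verblunsky d n"] by (auto simp: zero_le_mult_iff)
      then have v: "verblunsky d n \<in> {1, -1}" by (auto simp: power2_eq_1_iff)
      have "verblunsky d n - verblunsky c n = (d (Suc n) - c (Suc n)) / r"
        unfolding r_def by (rule verblunsky_diff) (rule cd)
      then have "d (Suc n) = c (Suc n) + (verblunsky d n - verblunsky c n) * r"
        using r by (simp add: field_simps)
      then have "top t = c (Suc n) + (verblunsky d n - verblunsky c n) * r"
        using high[OF m(1,2,3)] by (simp add: d_def)
      then show ?thesis using v unfolding S_def by (rule image_eqI)
    qed
    then have "top ` ?T \<subseteq> S" by blast
    moreover have "finite S" by (simp add: S_def)
    ultimately show ?thesis by blast
  next
    case False
    then obtain p where p: "p \<noteq> 0" "degree p \<le> n" "tform c p p \<le> 0"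
      unfolding pdef_def by (meson not_less)
    \<comment> \<open>Multiplying by a power of z keeps the form of p and brings the degree to
      exactly n + 1, so that the pairing of q with 1 contains the unknown moment with a nonzero
      coefficient.\<close>
    define q where "q = monom 1 (Suc n - degree p) * p"
    have q: "degree q = Suc n" using p by (simp add: q_def degree_mult_eq degree_monom_eq)
    then have lq: "coeff q (Suc n) \<noteq> 0" using p(1) leading_coeff_0_iff[of q] by (simp add: q_def)
    define s where "s = - (\<Sum>i\<le>n. coeff q i * c i) / coeff q (Suc n)"
    have "top t = s" if t: "t \<in> ?T" for t
    proof -
      obtain \<mu> where m: "\<mu> \<in> moment_measures {0..1}" "\<forall>j\<in>{1..n}. moment \<mu> j = a j" "moment \<mu> (Suc n) = t"
        using t by blast
      define d where "d = cheb_seq (moment \<mu>)"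
      have cd: "d k = c k" if "k \<le> n" for k using low[OF m(1,2) that] by (simp add: d_def)
      have "tform d p p = tform c p p" by (rule tform_cong[OF p(2) p(2) cd])
      then have "tform d p p = 0" using p(3) tform_moment_nonneg[OF m(1), of p] by (simp add: d_def)
      then have dq: "tform d q q = 0" by (simp add: q_def tform_monom_mult)
      have "tform d q 1 = 0"
      proof (rule tform_cauchy_schwarz_zero[where n = "Suc n"])
        show "0 \<le> tform d u u" for u unfolding d_def by (rule tform_moment_nonneg[OF m(1)])
      qed (simp_all add: q dq)
      then have "(\<Sum>i\<le>n. coeff q i * d i) + coeff q (Suc n) * d (Suc n) = 0"
        using tform_monom[of q "Suc n" d 0] q by (simp add: monom_0 one_pCons)
      then have "d (Suc n) = - (\<Sum>i\<le>n. coeff q i * d i) / coeff q (Suc n)"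
        using lq by (simp add: field_simps eq_neg_iff_add_eq_0)
      also have "\<dots> = s" by (simp add: s_def cd)
      finally show ?thesis using high[OF m] by (simp add: d_def)
    qed
    then have "top ` ?T \<subseteq> {s}" by blast
    then show ?thesis by blast
  qed
  then have "finite (top ` ?T)" using finite_subset by blast
  then show ?thesis by (rule finite_imageD) (rule inj_on_subset[OF inj subset_UNIV])
qed

section \<open>The arcsine law as the image of Lebesgue measure on the half circle\<close>

lemma arcsine_eq_distr:
  "arcsine = distr (uniform_measure lborel {0..pi}) borel (\<lambda>t. (1 - cos t) / 2)"
proof (rule measure_eqI)
  show "sets arcsine = sets (distr (uniform_measure lborel {0..pi}) borel (\<lambda>t. (1 - cos t) / 2))"
    by (simp add: arcsine_def)
  fix A assume "A \<in> sets arcsine"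
  then have A[measurable]: "A \<in> sets borel" by (simp add: arcsine_def)
  define f :: "real \<Rightarrow> real" where
    "f x = indicator A x * (indicator {0<..<1} x * (1 / (pi * sqrt (x * (1 - x)))))" for x
  define g :: "real \<Rightarrow> real" where "g t = (1 - cos t) / 2" for t
  have [measurable]: "f \<in> borel_measurable borel" unfolding f_def by measurable
  have [measurable]: "g \<in> borel_measurable borel" unfolding g_def by measurable
  have gA': "g -` A \<in> sets borel" by (rule measurable_sets_borel[OF _ A]) measurable
  have gA: "{0..pi} \<inter> g -` A \<in> sets borel" by (intro sets.Int gA') simp
  have g: "g 0 = 0" "g pi = 1" by (auto simp: g_def)
  \<comment> \<open>The Jacobian sin t / 2 equals sqrt(x (1 - x)) and cancels the arcsine density.
    At the end points sin t = 0, so they are excluded here and removed as null sets below.\<close>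
  have val: "f (g t) * (sin t / 2) = indicator A (g t) / pi" if "t \<in> {0<..<pi}" for t
  proof -
    have s: "sin t > 0" using that by (intro sin_gt_zero) auto
    have "cos t < 1" using cos_monotone_0_pi[of 0 t] that by simp
    moreover have "cos t > -1" using cos_monotone_0_pi[of t pi] that by simp
    ultimately have "g t \<in> {0<..<1}" by (auto simp: g_def)
    have "g t * (1 - g t) = (sin t / 2)\<^sup>2"
      by (simp add: g_def power_divide sin_squared_eq) (simp add: power2_eq_square field_simps)
    then have "sqrt (g t * (1 - g t)) = sin t / 2" using s by simp
    then have "f (g t) = indicator A (g t) * (1 / (pi * (sin t / 2)))"
      using \<open>g t \<in> {0<..<1}\<close> by (simp only: f_def indicator_simps mult_1)
    then show ?thesis using s by simp
  qed
  have "emeasure arcsine A = (\<integral>\<^sup>+x. ennreal (indicator {0<..<1} x * (1 / (pi * sqrt (x * (1 - x))))) * indicator A x \<partial>lborel)"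
    unfolding arcsine_def by (rule emeasure_density) measurable
  also have "\<dots> = (\<integral>\<^sup>+x. ennreal (f x * indicator {g 0..g pi} x) \<partial>lborel)"
  proof (rule nn_integral_cong)
    fix x show "ennreal (indicator {0<..<1} x * (1 / (pi * sqrt (x * (1 - x))))) * indicator A x =
        ennreal (f x * indicator {g 0..g pi} x)"
      unfolding g by (cases "x \<in> A"; cases "x \<in> {0<..<1}") (simp_all add: f_def)
  qed
  also have "\<dots> = (\<integral>\<^sup>+t. ennreal (f (g t) * (sin t / 2) * indicator {0..pi} t) \<partial>lborel)"
  proof (rule nn_integral_substitution)
    show "set_borel_measurable borel {g 0..g pi} f" unfolding set_borel_measurable_def by measurable
    show "(g has_real_derivative sin t / 2) (at t)" for t
      unfolding g_def by (auto intro!: derivative_eq_intros)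
  qed (auto intro!: continuous_intros sin_ge_zero)
  also have "\<dots> = (\<integral>\<^sup>+t. ennreal (1 / pi) * indicator ({0..pi} \<inter> g -` A) t \<partial>lborel)"
  proof (rule nn_integral_cong_AE)
    show "AE t in lborel. ennreal (f (g t) * (sin t / 2) * indicator {0..pi} t) =
        ennreal (1 / pi) * indicator ({0..pi} \<inter> g -` A) t"
      using AE_lborel_singleton[of 0] AE_lborel_singleton[of pi]
    proof eventually_elim
      case (elim t)
      show ?case
      proof (cases "t \<in> {0..pi}")
        case True
        then have "t \<in> {0<..<pi}" using elim by auto
        from val[OF this] show ?thesis using True by (auto simp: indicator_def)
      qed (auto simp: indicator_def)
    qed
  qed
  also have "\<dots> = ennreal (1 / pi) * emeasure lborel ({0..pi} \<inter> g -` A)"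
    by (rule nn_integral_cmult_indicator) (simp add: gA)
  also have "\<dots> = emeasure lborel ({0..pi} \<inter> g -` A) / emeasure lborel {0..pi}"
  proof -
    have "ennreal (1 / pi) = inverse (ennreal pi)" by (simp add: inverse_ennreal inverse_eq_divide)
    then show ?thesis by (simp add: divide_ennreal_def mult.commute)
  qed
  also have "\<dots> = emeasure (distr (uniform_measure lborel {0..pi}) borel g) A"
    by (subst emeasure_distr) (simp_all add: gA')
  finally show "emeasure arcsine A = emeasure (distr (uniform_measure lborel {0..pi}) borel (\<lambda>t. (1 - cos t) / 2)) A"
    by (simp add: g_def[abs_def])
qed

lemma sets_arcsine [simp, measurable_cong]: "sets arcsine = sets borel"
  by (simp add: arcsine_def)

lemma space_arcsine [simp]: "space arcsine = UNIV"
  by (simp add: arcsine_def)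

lemma prob_space_arcsine: "prob_space arcsine"
  unfolding arcsine_eq_distr
  by (intro prob_space.prob_space_distr prob_space_uniform_measure) auto

lemma AE_arcsine: "AE x in arcsine. x \<in> {0..1}"
  unfolding arcsine_def by (subst AE_density) (auto simp: indicator_def)

lemma arcsine_integral:
  assumes [measurable]: "g \<in> borel_measurable borel" and g: "continuous_on {0..1} g"
  shows "integrable arcsine g"
    and "(\<integral>x. g x \<partial>arcsine) = integral {0..pi} (\<lambda>t. g ((1 - cos t) / 2)) / pi"
proof -
  define h :: "real \<Rightarrow> real" where "h t = g ((1 - cos t) / 2)" for t
  have [measurable]: "h \<in> borel_measurable borel" unfolding h_def by measurable
  have "(1 - cos t) / 2 \<in> {0..1}" for t :: real
    using cos_ge_minus_one[of t] cos_le_one[of t] by simp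
  then have h: "continuous_on {0..pi} h" unfolding h_def
    by (intro continuous_on_compose2[OF g] continuous_intros) auto
  have si: "set_integrable lborel {0..pi} h" by (rule borel_integrable_atLeastAtMost'[OF h])
  have u: "uniform_measure lborel {0..pi} = density lborel (\<lambda>x. ennreal (indicator {0..pi} x / pi))"
    unfolding uniform_measure_def
    by (intro arg_cong[where f = "density lborel"] ext)
      (auto simp: indicator_def divide_ennreal[symmetric])
  have i: "integrable lborel (\<lambda>x. (indicator {0..pi} x / pi) *\<^sub>R h x)"
    using integrable_divide_zero[of pi, OF si[unfolded set_integrable_def]] by simp
  have iu: "integrable (uniform_measure lborel {0..pi}) h"
    unfolding u by (subst integrable_density) (use i in auto)
  then show "integrable arcsine g" unfolding arcsine_eq_distr
    by (subst integrable_distr_eq) (auto simp: h_def[abs_def])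
  have "(\<integral>x. g x \<partial>arcsine) = (\<integral>t. h t \<partial>uniform_measure lborel {0..pi})"
    unfolding arcsine_eq_distr by (subst integral_distr) (auto simp: h_def[abs_def])
  also have "\<dots> = (\<integral>t. (indicator {0..pi} t / pi) *\<^sub>R h t \<partial>lborel)"
    unfolding u by (subst integral_density) auto
  also have "\<dots> = (LINT t:{0..pi}|lborel. h t) / pi"
    by (simp add: set_lebesgue_integral_def)
  also have "(LINT t:{0..pi}|lborel. h t) = integral {0..pi} h"
    by (rule set_borel_integral_eq_integral[OF si])
  finally show "(\<integral>x. g x \<partial>arcsine) = integral {0..pi} (\<lambda>t. g ((1 - cos t) / 2)) / pi"
    by (simp add: h_def[abs_def])
qed

section \<open>Bernstein--Szego measures\<close>

lemma cpoly_cnj: "cpoly p (cnj z) = cnj (cpoly p z)"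
  by (simp add: cpoly_def)

text \<open>Cauchy's formula gives the mean over the full circle. The symmetry makes the real part
  invariant under t -> 2 pi - t, so each half contributes the same.\<close>

lemma half_circle_mean_value:
  assumes hol: "H holomorphic_on cball 0 1" and sym: "\<And>z. H (cnj z) = cnj (H z)"
  shows "integral {0..pi} (\<lambda>t. Re (H (cis t))) = pi * Re (H 0)"
proof -
  have "((\<lambda>u. H u / (u - 0)) has_contour_integral (2 * of_real pi * \<i> * H 0)) (circlepath 0 1)"
    by (rule Cauchy_integral_circlepath_simple[OF hol]) simp
  then have "((\<lambda>t. H (cis t) / cis t * \<i> * cis t) has_integral (2 * of_real pi * \<i> * H 0)) {0..2*pi}"
    unfolding circlepath_def by (subst (asm) has_contour_integral_part_circlepath_iff) simp_all
  moreover have "H (cis t) / cis t * \<i> * cis t = H (cis t) * \<i>" for t by simp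
  ultimately have "((\<lambda>t. H (cis t) * \<i>) has_integral (2 * of_real pi * \<i> * H 0)) {0..2*pi}"
    by (simp only:)
  from has_integral_mult_left[OF this, of "- \<i>"]
  have "((\<lambda>t. H (cis t)) has_integral (2 * of_real pi * H 0)) {0..2*pi}"
    by (simp add: mult_ac)
  from has_integral_linear[OF this bounded_linear_Re]
  have full: "((\<lambda>t. Re (H (cis t))) has_integral (2 * pi * Re (H 0))) {0..2*pi}"
    by (simp add: o_def)
  define h where "h t = Re (H (cis t))" for t
  have "continuous_on {0..pi} h" unfolding h_def
    by (intro continuous_intros continuous_on_compose2[OF holomorphic_on_imp_continuous_on[OF hol]])
      (auto intro!: continuous_intros)
  then have half: "(h has_integral integral {0..pi} h) {0..pi}"
    using integrable_continuous_real integrable_integral by blast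
  have refl: "h (2 * pi - t) = h t" for t
  proof -
    have "cis (2 * pi - t) = cnj (cis t)" by (simp add: complex_eq_iff cos_diff sin_diff)
    then show ?thesis by (simp add: h_def sym)
  qed
  have "((\<lambda>t. h ((-1) *\<^sub>R t + 2 * pi)) has_integral ((1 / (\<bar>-1\<bar> ^ DIM(real))) *\<^sub>R integral {0..pi} h))
      ((\<lambda>t. (1 / (-1)) *\<^sub>R t + - ((1 / (-1)) *\<^sub>R (2 * pi))) ` cbox 0 pi)"
    by (rule has_integral_affinity) (use half in auto)
  moreover have "(\<lambda>t. (1 / (-1)) *\<^sub>R t + - ((1 / (-1)) *\<^sub>R (2 * pi))) ` cbox 0 pi = {pi..2*pi}"
  proof -
    have "(\<lambda>t::real. - t + 2 * pi) ` {0..pi} = {pi..2*pi}"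
      using image_affinity_atLeastAtMost[of "-1" "2 * pi" 0 pi] by simp
    then show ?thesis by simp
  qed
  ultimately have "(h has_integral integral {0..pi} h) {pi..2*pi}"
    using refl by (simp add: add.commute[of _ "2 * pi"])
  with half have "(h has_integral (integral {0..pi} h + integral {0..pi} h)) {0..2*pi}"
    by (intro has_integral_combine[of 0 pi "2*pi"]) auto
  then have "integral {0..pi} h + integral {0..pi} h = 2 * pi * Re (H 0)"
    using full unfolding h_def by (rule has_integral_unique)
  then show ?thesis by (simp add: h_def[abs_def])
qed

lemma cpoly_holomorphic: "cpoly p holomorphic_on S"
  unfolding cpoly_def by (intro holomorphic_intros)

lemma cpoly_monom: "cpoly (monom 1 j) z = z ^ j"
proof -
  have "cpoly (monom 1 j) z = (\<Sum>i\<le>j. complex_of_real (coeff (monom 1 j) i) * z ^ i)"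
    by (rule cpoly_eq_sum) (simp add: degree_monom_le)
  also have "\<dots> = (\<Sum>i\<in>{j}. complex_of_real (coeff (monom 1 j) i) * z ^ i)"
    by (rule sum.mono_neutral_right) auto
  finally show ?thesis by simp
qed

definition bs_weight :: "(nat \<Rightarrow> real) \<Rightarrow> nat \<Rightarrow> real poly" where
  "bs_weight c n = smult (1 / opnorm c n) (toep_poly (opoly c n) (opoly c n))"

definition bs_measure :: "(nat \<Rightarrow> real) \<Rightarrow> nat \<Rightarrow> real measure" where
  "bs_measure c n = density arcsine (\<lambda>x. ennreal (1 / poly (bs_weight c n) x))"

lemma bs_weight_pos: "pdef n c \<Longrightarrow> x \<in> {0..1} \<Longrightarrow> poly (bs_weight c n) x > 0"
  using poly_toep_poly_opoly_pos[of n c x] pdef_opnorm[of n c n] by (simp add: bs_weight_def)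

lemma borel_measurable_poly [measurable]: "poly p \<in> borel_measurable borel" for p :: "real poly"
  by (intro borel_measurable_continuous_onI continuous_intros)

lemma continuous_on_poly_div_bs_weight:
  assumes "pdef n c" shows "continuous_on {0..1} (\<lambda>x. poly p x / poly (bs_weight c n) x)"
  by (intro continuous_intros) (use bs_weight_pos[OF assms] in force)

text \<open>The Bernstein--Szego measure: on the circle its density is \<open>r / |\<Phi>|\<^sup>2\<close>, and \<open>\<Phi>\<close> is
  orthogonal to the lower powers since \<open>z ^ (n - j) / \<Psi>\<close> is holomorphic in the disc.\<close>

lemma bernstein_szego:
  assumes pd: "pdef n c" and c0: "c 0 = 1"
  shows "bs_measure c n \<in> moment_measures {0..1}"
    and "k \<le> n \<Longrightarrow> cheb_seq (moment (bs_measure c n)) k = c k"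
proof -
  define P R W r where "P = opoly c n" and "R = rpoly c n" and "W = bs_weight c n" and "r = opnorm c n"
  have r: "r > 0" unfolding r_def by (rule pdef_opnorm[OF pd order_refl])
  have Wpos: "x \<in> {0..1} \<Longrightarrow> poly W x > 0" for x unfolding W_def by (rule bs_weight_pos[OF pd])
  have cont: "continuous_on {0..1} (\<lambda>x. poly p x / poly W x)" for p
    unfolding W_def by (rule continuous_on_poly_div_bs_weight[OF pd])
  note ai = arcsine_integral[OF _ cont]
  have int: "integrable arcsine (\<lambda>x. poly p x / poly W x)" for p
    by (rule ai) measurable
  \<comment> \<open>Cosine moments of the arcsine law divided by W, formed before the density is
    known to have mass one; the mass comes out as d 0 = c 0.\<close>
  define d where "d k = (\<integral>x. poly (cheb k) x / poly W x \<partial>arcsine)" for k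
  have td: "tform d p q = (\<integral>x. poly (toep_poly p q) x / poly W x \<partial>arcsine)" for p q
  proof -
    have "(\<integral>x. poly (toep_poly p q) x / poly W x \<partial>arcsine) =
      (\<integral>x. (\<Sum>i\<le>degree p. \<Sum>j\<le>degree q. coeff p i * coeff q j * (poly (cheb ((i - j) + (j - i))) x / poly W x)) \<partial>arcsine)"
      by (simp add: toep_poly_def poly_sum sum_divide_distrib)
    also have "\<dots> = tform d p q"
      unfolding tform_def d_def
      by (simp add: Bochner_Integration.integral_sum Bochner_Integration.integrable_sum int
          del: times_divide_eq_right)
    finally show ?thesis by simp
  qed
  have tP: "tform d P (monom 1 j) = (if j = n then r else 0)" if j: "j \<le> n" for j
  proof -
    define H where "H z = z ^ (n - j) / cpoly R z" for z
    have nz: "cpoly R z \<noteq> 0" if "norm z \<le> 1" for z unfolding R_def by (rule pdef_disc[OF pd that])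
    have hol: "H holomorphic_on cball 0 1"
      unfolding H_def by (intro holomorphic_intros cpoly_holomorphic) (use nz in auto)
    have sym: "H (cnj z) = cnj (H z)" for z by (simp add: H_def cpoly_cnj)
    have "cpoly R 0 = of_real (coeff R 0)" by (simp add: cpoly_def power_0_left if_distrib cong: if_cong)
    then have R0: "cpoly R 0 = 1" by (simp add: R_def coeff_rpoly)
    have on: "poly (toep_poly P (monom 1 j)) ((1 - cos t) / 2) / poly W ((1 - cos t) / 2) = r * Re (H (cis t))" for t
    proof -
      define z where "z = cis t"
      have zc: "z * cnj z = 1" by (simp add: z_def cis_cnj cis_mult)
      have Rz: "cpoly R z = z ^ n * cnj (cpoly P z)"
        unfolding R_def P_def by (rule cpoly_rpoly_circle) (simp add: z_def)
      have Pnz: "cpoly P z \<noteq> 0" using Rz nz[of z] by (auto simp: z_def)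
      have znz: "z \<noteq> 0" using zc by auto
      have "z ^ n = z ^ (n - j) * z ^ j" using j by (simp flip: power_add)
      then have "z ^ n * cnj z ^ j = z ^ (n - j) * (z * cnj z) ^ j"
        by (simp only: power_mult_distrib mult.assoc)
      then have pw: "z ^ n * cnj z ^ j = z ^ (n - j)" by (simp add: zc)
      have "H z = (z ^ n * cnj z ^ j) / (z ^ n * cnj (cpoly P z))"
        by (simp only: H_def pw Rz)
      also have "\<dots> = cnj (z ^ j) / cnj (cpoly P z)" using znz by simp
      also have "\<dots> = (cpoly P z * cnj (z ^ j)) / (cpoly P z * cnj (cpoly P z))"
        by (rule mult_divide_mult_cancel_left[symmetric]) (rule Pnz)
      also have "\<dots> = (cpoly P z * cnj (z ^ j)) / of_real ((norm (cpoly P z))\<^sup>2)"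
        by (simp only: complex_norm_square)
      finally have "Re (H z) = Re (cpoly P z * cnj (z ^ j)) / (norm (cpoly P z))\<^sup>2"
        by (simp only: Re_divide_of_real)
      moreover have "poly W ((1 - cos t) / 2) = (norm (cpoly P z))\<^sup>2 / r"
        by (simp only: W_def bs_weight_def poly_smult poly_toep_poly_cos P_def[symmetric]
            complex_norm_square[symmetric] Re_complex_of_real z_def r_def) simp
      moreover have "poly (toep_poly P (monom 1 j)) ((1 - cos t) / 2) = Re (cpoly P z * cnj (z ^ j))"
        by (simp only: poly_toep_poly_cos cpoly_monom z_def)
      ultimately show ?thesis using r by (simp add: z_def)
    qed
    have "tform d P (monom 1 j) = integral {0..pi} (\<lambda>t. r * Re (H (cis t))) / pi"
      unfolding td by (subst ai) (simp_all add: on)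
    also have "\<dots> = r * Re (H 0)"
      using half_circle_mean_value[OF hol sym] by simp
    \<comment> \<open>H(0) vanishes for j < n, and Psi_n(0) is the leading coefficient of Phi_n,
      which is 1.\<close>
    also have "\<dots> = (if j = n then r else 0)" using j by (simp add: H_def R0 power_0_left)
    finally show ?thesis .
  qed
  \<comment> \<open>With \<rho> = r = \<open>opnorm c n\<close> the factor in
    \<open>szego_determines\<close> is 1.\<close>
  have dc: "d k = c k" if "k \<le> n" for k
    using szego_determines[OF pd _ that, of d r] tP r by (simp add: P_def r_def)
  define \<mu> where "\<mu> = bs_measure c n"
  have nn: "AE x in arcsine. 0 \<le> 1 / poly W x"
    using AE_arcsine by eventually_elim (use Wpos in force)
  have \<mu>i: "(\<integral>x. poly p x \<partial>\<mu>) = (\<integral>x. poly p x / poly W x \<partial>arcsine)" for p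
    unfolding \<mu>_def bs_measure_def W_def[symmetric]
    by (subst integral_density) (use nn in auto)
  have "prob_space \<mu>"
  proof
    have "emeasure \<mu> (space \<mu>) = (\<integral>\<^sup>+x. ennreal (1 / poly W x) \<partial>arcsine)"
      unfolding \<mu>_def bs_measure_def W_def[symmetric] by (subst emeasure_density) auto
    also have "\<dots> = ennreal (\<integral>x. poly 1 x / poly W x \<partial>arcsine)"
      using nn_integral_eq_integral[OF int[of 1]] nn by simp
    also have "(\<integral>x. poly 1 x / poly W x \<partial>arcsine) = 1"
      using dc[of 0] c0 by (simp add: d_def)
    finally show "emeasure \<mu> (space \<mu>) = 1" by simp
  qed
  moreover have "AE x in \<mu>. x \<in> {0..1}"
    unfolding \<mu>_def bs_measure_def using AE_arcsine
    by (subst AE_density) (auto elim: eventually_mono)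
  ultimately have m: "\<mu> \<in> moment_measures {0..1}"
    by (intro moment_measuresI) (auto simp: \<mu>_def bs_measure_def)
  then show "bs_measure c n \<in> moment_measures {0..1}" by (simp add: \<mu>_def)
  have "cheb_seq (moment \<mu>) k = (\<integral>x. poly (cheb k) x \<partial>\<mu>)" for k
    using integral_poly[OF m degree_cheb, of k] by (simp add: cheb_seq_def)
  then show "k \<le> n \<Longrightarrow> cheb_seq (moment (bs_measure c n)) k = c k"
    using dc \<mu>i by (simp add: \<mu>_def d_def)
qed

text \<open>Tightness on the unit interval yields a weakly convergent subsequence. Powers are
  unbounded on the line, so they are tested through the clamp \<open>cl\<close>, which leaves the
  moments unchanged.\<close>

lemma moment_limit:
  assumes mk: "\<And>k. \<mu> k \<in> moment_measures {0..1}"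
    and lim: "\<And>j. j \<in> J \<Longrightarrow> (\<lambda>k. moment (\<mu> k) j) \<longlonglongrightarrow> a j"
  shows "\<exists>\<nu>\<in>moment_measures {0..1}. \<forall>j\<in>J. moment \<nu> j = a j"
proof -
  have rd: "real_distribution (\<mu> k)" for k
    using moment_measures_facts[OF mk[of k]]
    by (auto simp: real_distribution_def real_distribution_axioms_def)
  have "tight \<mu>" unfolding tight_def
  proof (intro conjI allI impI rd)
    fix e :: real assume e: "e > 0"
    have "measure (\<mu> k) {-1<..2} > 1 - e" for k
    proof -
      interpret real_distribution "\<mu> k" by (rule rd)
      \<comment> \<open>Tightness is phrased with half-open intervals, so the left end is moved
        below 0.\<close>
      have "prob {-1<..2} = 1"
        by (subst prob_eq_1) (use moment_measures_facts(4)[OF mk[of k]] in \<open>auto elim: eventually_mono\<close>)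
      then show ?thesis using e by simp
    qed
    then show "\<exists>a b. a < b \<and> (\<forall>k. measure (\<mu> k) {a<..b} > 1 - e)"
      by (intro exI[of _ "-1"] exI[of _ 2]) auto
  qed
  from tight_imp_convergent_subsubsequence[OF this strict_mono_id]
  obtain s \<nu> where s: "strict_mono s" and \<nu>: "real_distribution \<nu>" and wc: "weak_conv_m (\<mu> \<circ> id \<circ> s) \<nu>"
    by blast
  interpret \<nu>: real_distribution \<nu> by (rule \<nu>)
  have conv: "(\<lambda>k. integral\<^sup>L (\<mu> (s k)) f) \<longlonglongrightarrow> integral\<^sup>L \<nu> f"
    if "\<And>x. isCont f x" "\<And>x. norm (f x) \<le> 1" for f :: "real \<Rightarrow> real"
    using weak_conv_imp_integral_bdd_continuous_conv[OF _ \<nu> wc that] rd by (simp add: o_def)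
  define cl :: "real \<Rightarrow> real" where "cl x = max 0 (min 1 x)" for x
  have cl01: "0 \<le> cl x" "cl x \<le> 1" for x by (auto simp: cl_def)
  have ccl: "isCont cl x" for x unfolding cl_def by (intro continuous_intros)
  \<comment> \<open>\<open>h\<close> is bounded, continuous and zero exactly on the unit interval,
    so its vanishing integral shows that the limit is carried by it.\<close>
  define h where "h x = min 1 \<bar>x - cl x\<bar>" for x
  have h0: "integral\<^sup>L (\<mu> k) h = 0" for k
  proof (rule integral_eq_zero_AE)
    show "AE x in \<mu> k. h x = 0"
      using moment_measures_facts(4)[OF mk[of k]] by eventually_elim (auto simp: h_def cl_def)
  qed
  have hc: "isCont h x" for x unfolding h_def by (intro continuous_intros ccl)
  have [measurable]: "h \<in> borel_measurable borel"
    by (intro borel_measurable_continuous_onI continuous_at_imp_continuous_on) (simp add: hc)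
  have "integral\<^sup>L \<nu> h = 0"
    using conv[of h] hc by (simp add: h0 h_def LIMSEQ_const_iff)
  moreover have "integrable \<nu> h"
    by (rule \<nu>.integrable_const_bound[of _ 1]) (auto simp: h_def)
  ultimately have "AE x in \<nu>. h x = 0"
    by (subst (asm) integral_nonneg_eq_0_iff_AE) (auto simp: h_def)
  then have AE: "AE x in \<nu>. x \<in> {0..1}"
    by eventually_elim (auto simp: h_def cl_def min_def max_def split: if_splits)
  then have m: "\<nu> \<in> moment_measures {0..1}"
    by (intro moment_measuresI) (auto simp: \<nu>.prob_space_axioms)
  have mc: "moment \<kappa> j = integral\<^sup>L \<kappa> (\<lambda>x. cl x ^ j)" if "\<kappa> \<in> moment_measures {0..1}" for \<kappa> j
  proof -
    have [measurable]: "cl \<in> borel_measurable borel" unfolding cl_def by measurable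
    note f = moment_measures_facts(2,4)[OF that]
    have [measurable_cong]: "sets \<kappa> = sets borel" by (rule f)
    show ?thesis unfolding moment_def
    proof (rule integral_cong_AE)
      show "AE x in \<kappa>. x ^ j = cl x ^ j" using f(2) by eventually_elim (auto simp: cl_def)
    qed measurable
  qed
  have "moment \<nu> j = a j" if j: "j \<in> J" for j
  proof (rule LIMSEQ_unique)
    have "(\<lambda>k. integral\<^sup>L (\<mu> (s k)) (\<lambda>x. cl x ^ j)) \<longlonglongrightarrow> integral\<^sup>L \<nu> (\<lambda>x. cl x ^ j)"
      by (rule conv) (auto intro!: continuous_intros ccl simp: cl01 power_le_one)
    then show "(\<lambda>k. moment (\<mu> (s k)) j) \<longlonglongrightarrow> moment \<nu> j" by (simp add: mc m mk)
    show "(\<lambda>k. moment (\<mu> (s k)) j) \<longlonglongrightarrow> a j"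
      using LIMSEQ_subseq_LIMSEQ[OF lim[OF j] s] by (simp add: o_def)
  qed
  with m show ?thesis by blast
qed

text \<open>Moving moment k + 1 a little in both directions stays in the moment space, so a_k moves
  strictly in both directions and remains in [-1,1]; hence |a_k| < 1, and definiteness grows by one
  order.\<close>

lemma interior_moment_space_pdef:
  assumes m: "\<mu> \<in> moment_measures {0..1}"
    and int: "moment_vector n \<mu> \<in> coord_topology {1..n} interior_of moment_space n {0..1}"
  shows "pdef n (cheb_seq (moment \<mu>))"
proof -
  have "pdef k (cheb_seq (moment \<mu>))" if "k \<le> n" for k
    using that
  proof (induction k)
    case 0
    then show ?case using moment_measures_facts(6)[OF m] by (simp add: pdef_0)
  next
    case (Suc k)
    define c where "c = cheb_seq (moment \<mu>)"
    have pd: "pdef k c" using Suc by (simp add: c_def)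
    obtain U where U: "openin (coord_topology {1..n}) U" "U \<subseteq> moment_space n {0..1}" "moment_vector n \<mu> \<in> U"
      using int unfolding interior_of_def by blast
    define v where "v t = (\<lambda>j\<in>{1..n}. moment \<mu> j + (if j = Suc k then t else 0))" for t :: real
    have v0: "v 0 = moment_vector n \<mu>" by (auto simp: v_def moment_vector_def)
    have "continuous_map euclideanreal (coord_topology {1..n}) v"
      unfolding continuous_map_componentwise
    proof (intro conjI ballI)
      show "v ` topspace euclideanreal \<subseteq> extensional {1..n}" by (auto simp: v_def)
      show "continuous_map euclideanreal euclideanreal (\<lambda>x. v x i)" if "i \<in> {1..n}" for i
        using that by (cases "i = Suc k") (auto simp: v_def intro!: continuous_intros)
    qed
    then have "openin euclideanreal {t \<in> topspace euclideanreal. v t \<in> U}"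
      using U(1) by (rule openin_continuous_map_preimage)
    then have "open {t. v t \<in> U}" by simp
    moreover have "0 \<in> {t. v t \<in> U}" using U(3) v0 by simp
    ultimately obtain e where "e > 0" "ball 0 e \<subseteq> {t. v t \<in> U}"
      by (rule openE)
    then have e: "e > 0" "\<And>t. \<bar>t\<bar> < e \<Longrightarrow> v t \<in> U" by (auto simp: dist_real_def)
    have key: "\<bar>verblunsky c k + s\<bar> \<le> 1" if s: "s = coeff (cheb (Suc k)) (Suc k) * t / opnorm c k" and t: "\<bar>t\<bar> < e" for s t
    proof -
      obtain \<kappa> where \<kappa>: "\<kappa> \<in> moment_measures {0..1}" "v t = moment_vector n \<kappa>"
        using e(2)[OF t] U(2) unfolding moment_space_def by blast
      define d where "d = cheb_seq (moment \<kappa>)"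
      have mo: "moment \<kappa> j = moment \<mu> j + (if j = Suc k then t else 0)" if "j \<le> Suc k" for j
        using fun_cong[OF \<kappa>(2), of j] that Suc.prems moment_measures_facts(6)[OF m] moment_measures_facts(6)[OF \<kappa>(1)]
        by (cases "j = 0") (auto simp: v_def moment_vector_def)
      have cd: "c i = d i" if "i \<le> k" for i
        unfolding c_def d_def by (rule cheb_seq_cong) (use that mo in auto)
      have "d (Suc k) - c (Suc k) = coeff (cheb (Suc k)) (Suc k) * t"
        unfolding c_def d_def by (subst cheb_seq_top) (use mo in auto)
      then have vd: "verblunsky d k = verblunsky c k + s"
        using verblunsky_diff[of k c d] cd by (simp add: s)
      have pdd: "pdef k d" using pd pdef_cong[of k c d] cd by blast
      have "opnorm d (Suc k) = opnorm d k * (1 - (verblunsky d k)\<^sup>2)"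
        by (rule opnorm_Suc) (use pdef_opnorm[OF pdd] in force)
      moreover have "opnorm d (Suc k) \<ge> 0"
        unfolding opnorm_def d_def by (rule tform_moment_nonneg[OF \<kappa>(1)])
      moreover have "opnorm d k > 0" by (rule pdef_opnorm[OF pdd order_refl])
      ultimately show ?thesis by (simp add: zero_le_mult_iff abs_square_le_1 vd)
    qed
    define q where "q = coeff (cheb (Suc k)) (Suc k) / opnorm c k * (e / 2)"
    have "q \<noteq> 0" using coeff_cheb_top[of "Suc k"] pdef_opnorm[OF pd order_refl] e(1) by (simp add: q_def)
    moreover have "\<bar>verblunsky c k + q\<bar> \<le> 1" by (rule key[of _ "e / 2"]) (use e(1) in \<open>auto simp: q_def\<close>)
    moreover have "\<bar>verblunsky c k + - q\<bar> \<le> 1" by (rule key[of _ "- (e / 2)"]) (use e(1) in \<open>auto simp: q_def\<close>)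
    ultimately have "\<bar>verblunsky c k\<bar> < 1" by linarith
    then show ?case using pd by (simp add: pdef_Suc_verblunsky c_def)
  qed
  then show ?thesis by simp
qed

section \<open>Gaussian integrals\<close>

definition qform :: "nat set \<Rightarrow> (nat \<Rightarrow> nat \<Rightarrow> real) \<Rightarrow> (nat \<Rightarrow> real) \<Rightarrow> real" where
  "qform I A u = (\<Sum>i\<in>I. \<Sum>j\<in>I. A i j * u i * u j)"

definition pos_def_on :: "nat set \<Rightarrow> (nat \<Rightarrow> nat \<Rightarrow> real) \<Rightarrow> bool" where
  "pos_def_on I A \<longleftrightarrow> (\<forall>i\<in>I. \<forall>j\<in>I. A i j = A j i) \<and> (\<forall>u. (\<exists>i\<in>I. u i \<noteq> 0) \<longrightarrow> qform I A u > 0)"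

lemma pos_def_on_sym: "pos_def_on I A \<Longrightarrow> i \<in> I \<Longrightarrow> j \<in> I \<Longrightarrow> A i j = A j i"
  by (simp add: pos_def_on_def)

lemma pos_def_on_pos: "pos_def_on I A \<Longrightarrow> i \<in> I \<Longrightarrow> u i \<noteq> 0 \<Longrightarrow> qform I A u > 0"
  by (auto simp: pos_def_on_def)

lemma pos_def_on_nonneg: "pos_def_on I A \<Longrightarrow> qform I A u \<ge> 0"
proof (cases "\<exists>i\<in>I. u i \<noteq> 0")
  case False
  then have "qform I A u = 0" unfolding qform_def by (intro sum.neutral ballI) auto
  then show ?thesis by simp
qed (auto dest: pos_def_on_pos)

lemma qform_cong: "(\<And>i. i \<in> I \<Longrightarrow> u i = v i) \<Longrightarrow> qform I A u = qform I A v"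
  unfolding qform_def by (intro sum.cong refl) auto

lemma qform_insert:
  assumes "finite I" "k \<notin> I" "\<And>i. i \<in> I \<Longrightarrow> A i k = A k i"
  shows "qform (insert k I) A u = A k k * (u k)\<^sup>2 + 2 * u k * (\<Sum>i\<in>I. A k i * u i) + qform I A u"
proof -
  have "(\<Sum>i\<in>I. A i k * u i * u k) = u k * (\<Sum>i\<in>I. A k i * u i)"
    by (simp add: sum_distrib_left assms(3) mult_ac)
  moreover have "(\<Sum>j\<in>I. A k j * u k * u j) = u k * (\<Sum>i\<in>I. A k i * u i)"
    by (simp add: sum_distrib_left mult_ac)
  ultimately show ?thesis
    using assms(1,2) by (simp add: qform_def sum.distrib power2_eq_square algebra_simps)
qed

lemma qform_add:
  assumes "\<And>i j. i \<in> I \<Longrightarrow> j \<in> I \<Longrightarrow> A i j = A j i"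
  shows "qform I A (\<lambda>i. u i + s * v i) =
    qform I A u + 2 * s * (\<Sum>i\<in>I. (\<Sum>j\<in>I. A i j * v j) * u i) + s\<^sup>2 * qform I A v"
proof -
  have sw: "(\<Sum>i\<in>I. \<Sum>j\<in>I. A i j * v i * u j) = (\<Sum>i\<in>I. \<Sum>j\<in>I. A i j * v j * u i)"
    by (subst sum.swap) (intro sum.cong refl, simp add: assms)
  have "qform I A (\<lambda>i. u i + s * v i) = (\<Sum>i\<in>I. \<Sum>j\<in>I. A i j * u i * u j + s * (A i j * v j * u i)
      + s * (A i j * v i * u j) + s\<^sup>2 * (A i j * v i * v j))"
    unfolding qform_def by (intro sum.cong refl) (simp add: power2_eq_square algebra_simps)
  also have "\<dots> = qform I A u + s * (\<Sum>i\<in>I. \<Sum>j\<in>I. A i j * v j * u i)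
      + s * (\<Sum>i\<in>I. \<Sum>j\<in>I. A i j * v i * u j) + s\<^sup>2 * qform I A v"
    by (simp only: sum.distrib sum_distrib_left qform_def)
  finally show ?thesis by (simp add: sw sum_distrib_right)
qed

lemma measurable_qform [measurable]:
  assumes "finite I" shows "qform I A \<in> borel_measurable (Pi\<^sub>M I (\<lambda>_. borel))"
  unfolding qform_def by measurable

text \<open>Completing the square in one variable passes to the Schur complement.\<close>

lemma pos_def_on_insert:
  assumes "finite I" "k \<notin> I" and pd: "pos_def_on (insert k I) A"
  obtains a b A' where "a > 0" "pos_def_on I A'"
    "\<And>u. qform (insert k I) A u = a * (u k + (\<Sum>i\<in>I. b i * u i))\<^sup>2 + qform I A' u"
proof
  define a where "a = A k k"
  define b where "b i = A k i / a" for i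
  define A' where "A' i j = A i j - A k i * A k j / a" for i j
  have sym: "A i j = A j i" if "i \<in> insert k I" "j \<in> insert k I" for i j
    using pos_def_on_sym[OF pd] that by blast
  have ins: "qform (insert k I) A u = A k k * (u k)\<^sup>2 + 2 * u k * (\<Sum>i\<in>I. A k i * u i) + qform I A u" for u
    by (rule qform_insert[OF assms(1,2)]) (auto intro: sym)
  have pos: "qform (insert k I) A u > 0" if "\<exists>i\<in>insert k I. u i \<noteq> 0" for u
    using pos_def_on_pos[OF pd] that by blast
  have "qform (insert k I) A (\<lambda>i. if i = k then 1 else 0) = a"
  proof -
    have "(\<Sum>i\<in>I. A k i * (if i = k then 1 else 0)) = 0" using assms(2) by (intro sum.neutral) auto
    moreover have "qform I A (\<lambda>i. if i = k then 1 else 0) = 0"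
      unfolding qform_def using assms(2) by (intro sum.neutral ballI) auto
    ultimately show ?thesis by (simp add: ins a_def)
  qed
  then show a: "a > 0" using pos[of "\<lambda>i. if i = k then 1 else 0"] by auto
  have A': "qform I A' u = qform I A u - (\<Sum>i\<in>I. A k i * u i)\<^sup>2 / a" for u
  proof -
    have "qform I A' u = (\<Sum>i\<in>I. \<Sum>j\<in>I. A i j * u i * u j - (A k i * u i) * (A k j * u j) / a)"
      unfolding qform_def A'_def by (intro sum.cong refl) (simp add: algebra_simps)
    also have "\<dots> = qform I A u - (\<Sum>i\<in>I. \<Sum>j\<in>I. (A k i * u i) * (A k j * u j)) / a"
      by (simp only: sum_subtractf sum_divide_distrib qform_def)
    finally show ?thesis by (simp only: power2_eq_square sum_product)
  qed
  have bs: "(\<Sum>i\<in>I. b i * u i) = (\<Sum>i\<in>I. A k i * u i) / a" for u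
    by (simp add: b_def sum_divide_distrib)
  show eq: "qform (insert k I) A u = a * (u k + (\<Sum>i\<in>I. b i * u i))\<^sup>2 + qform I A' u" for u
  proof -
    have "a * (p + X / a)\<^sup>2 = a * p\<^sup>2 + 2 * p * X + X\<^sup>2 / a" for p X
      using a by (simp add: power2_eq_square field_simps)
    then show ?thesis unfolding ins A' bs a_def[symmetric] by simp
  qed
  show "pos_def_on I A'"
    unfolding pos_def_on_def
  proof (intro conjI allI ballI impI)
    fix i j assume "i \<in> I" "j \<in> I"
    then have "A i j = A j i" by (intro sym) auto
    then show "A' i j = A' j i" by (simp add: A'_def mult.commute)
  next
    fix u assume u: "\<exists>i\<in>I. u i \<noteq> (0::real)"
    define w where "w = u(k := - (\<Sum>i\<in>I. b i * u i))"
    have wI: "w i = u i" if "i \<in> I" for i using that assms(2) by (auto simp: w_def)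
    have "(\<Sum>i\<in>I. b i * w i) = (\<Sum>i\<in>I. b i * u i)" using wI by simp
    then have "qform (insert k I) A w = qform I A' w" by (simp add: eq w_def)
    also have "\<dots> = qform I A' u" by (rule qform_cong) (rule wI)
    finally show "qform I A' u > 0" using pos[of w] u wI by auto
  qed
qed

text \<open>Dual to the Schur complement: if V' is the inverse of A', then the inverse of the form a
  (u_k + b.u)^2 + A'(u) has the quadratic form t_k^2 / a + V'(t - t_k b). \<open>V\<close> is this
  form written as a matrix.\<close>

lemma pos_def_on_extend:
  assumes "finite I" "k \<notin> I" and pd: "pos_def_on I V'" and a: "a > 0"
  obtains V where "pos_def_on (insert k I) V"
    "\<And>t. qform (insert k I) V t = (t k)\<^sup>2 / a + qform I V' (\<lambda>i. t i - t k * b i)"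
proof
  define w where "w i = - (\<Sum>j\<in>I. V' i j * b j)" for i
  define V where "V i j = (if i = k then (if j = k then 1 / a + qform I V' b else w j)
      else (if j = k then w i else V' i j))" for i j
  have sym: "V' i j = V' j i" if "i \<in> I" "j \<in> I" for i j
    using pos_def_on_sym[OF pd] that by blast
  have VI: "qform I V t = qform I V' t" for t
    unfolding qform_def by (intro sum.cong refl) (use assms(2) in \<open>auto simp: V_def\<close>)
  have Vk: "(\<Sum>i\<in>I. V k i * t i) = - (\<Sum>i\<in>I. (\<Sum>j\<in>I. V' i j * b j) * t i)" for t
    unfolding sum_negf[symmetric] by (intro sum.cong refl) (use assms(2) in \<open>auto simp: V_def w_def\<close>)
  show eq: "qform (insert k I) V t = (t k)\<^sup>2 / a + qform I V' (\<lambda>i. t i - t k * b i)" for t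
  proof -
    have "qform (insert k I) V t = V k k * (t k)\<^sup>2 + 2 * t k * (\<Sum>i\<in>I. V k i * t i) + qform I V t"
      by (rule qform_insert[OF assms(1,2)]) (use assms(2) in \<open>auto simp: V_def\<close>)
    also have "\<dots> = (t k)\<^sup>2 / a + (qform I V' t + 2 * (- t k) * (\<Sum>i\<in>I. (\<Sum>j\<in>I. V' i j * b j) * t i)
        + (- t k)\<^sup>2 * qform I V' b)"
      unfolding VI Vk by (simp add: V_def algebra_simps)
    also have "\<dots> = (t k)\<^sup>2 / a + qform I V' (\<lambda>i. t i + (- t k) * b i)"
      by (subst qform_add[OF sym]) auto
    finally show ?thesis by simp
  qed
  show "pos_def_on (insert k I) V"
    unfolding pos_def_on_def
  proof (intro conjI allI ballI impI)
    fix i j assume "i \<in> insert k I" "j \<in> insert k I"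
    then show "V i j = V j i" using sym[of i j] by (auto simp: V_def)
  next
    fix t assume t: "\<exists>i\<in>insert k I. t i \<noteq> (0::real)"
    note nn = pos_def_on_nonneg[OF pd]
    show "qform (insert k I) V t > 0"
    proof (cases "t k = 0")
      case True
      then obtain i where "i \<in> I" "t i - t k * b i \<noteq> 0" using t by auto
      then have "qform I V' (\<lambda>i. t i - t k * b i) > 0" by (rule pos_def_on_pos[OF pd])
      then show ?thesis by (simp add: eq True)
    next
      case False
      then show ?thesis unfolding eq by (intro add_pos_nonneg nn) (use a in simp)
    qed
  qed
qed

text \<open>Substitute y = x / sqrt a - s to reach the standard normal law; the shift leaves a phase
  behind.\<close>

lemma gaussian_shift_fourier:
  fixes a s t :: real
  assumes a: "a > 0"
  shows "integrable lborel (\<lambda>y. exp (- (a * (y + s)\<^sup>2) / 2))"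
    and "(CLINT y|lborel. exp (- (a * (y + s)\<^sup>2) / 2) * iexp (t * y)) =
      sqrt (2 * pi / a) * exp (- t\<^sup>2 / (2 * a)) * iexp (- (t * s))"
proof -
  define q where "q = sqrt a"
  have q: "q > 0" "q * q = a" using a by (auto simp: q_def)
  have std: "exp (- x\<^sup>2 / 2) = sqrt (2 * pi) * std_normal_density x" for x :: real
    by (simp add: std_normal_density_def)
  have i0: "integrable lborel (\<lambda>x::real. exp (- x\<^sup>2 / 2))"
    unfolding std by (intro integrable_mult_right) simp
  have "integrable lborel (\<lambda>y. exp (- (q * s + q * y)\<^sup>2 / 2))"
    using lborel_integrable_real_affine[OF i0, of q "q * s"] q by simp
  moreover have sq: "(q * s + q * y)\<^sup>2 = a * (y + s)\<^sup>2" for y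
    by (simp add: power2_eq_square algebra_simps flip: q(2))
  ultimately show "integrable lborel (\<lambda>y. exp (- (a * (y + s)\<^sup>2) / 2))" by simp
  have "(CLINT x|std_normal_distribution. iexp (t / q * x)) = exp (- (t / q)\<^sup>2 / 2)"
    using fun_cong[OF char_std_normal_distribution, of "t / q"] by (simp add: char_def)
  then have c: "(CLINT x|lborel. std_normal_density x *\<^sub>R iexp (t / q * x)) = exp (- (t / q)\<^sup>2 / 2)"
    by (subst (asm) integral_density) auto
  have "(CLINT y|lborel. exp (- (a * (y + s)\<^sup>2) / 2) * iexp (t * y)) =
      \<bar>1 / q\<bar> *\<^sub>R (CLINT x|lborel. exp (- (a * ((- s + 1 / q * x) + s)\<^sup>2) / 2) * iexp (t * (- s + 1 / q * x)))"
    by (rule lborel_integral_real_affine) (use q in simp)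
  also have "(\<lambda>x. exp (- (a * ((- s + 1 / q * x) + s)\<^sup>2) / 2) * iexp (t * (- s + 1 / q * x))) =
      (\<lambda>x. (sqrt (2 * pi) * iexp (- (t * s))) * (std_normal_density x *\<^sub>R iexp (t / q * x)))"
  proof
    fix x
    have "a * ((- s + 1 / q * x) + s)\<^sup>2 = (q * q) * (x / q)\<^sup>2" by (simp add: q(2))
    then have "a * ((- s + 1 / q * x) + s)\<^sup>2 = x\<^sup>2" using q(1) by (simp add: power2_eq_square)
    moreover have "iexp (t * (- s + 1 / q * x)) = iexp (- (t * s)) * iexp (t / q * x)"
      by (simp add: exp_add[symmetric] algebra_simps)
    ultimately show "exp (- (a * ((- s + 1 / q * x) + s)\<^sup>2) / 2) * iexp (t * (- s + 1 / q * x)) =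
        (sqrt (2 * pi) * iexp (- (t * s))) * (std_normal_density x *\<^sub>R iexp (t / q * x))"
      by (simp only: std scaleR_conv_of_real of_real_mult mult_ac)
  qed
  also have "\<bar>1 / q\<bar> *\<^sub>R (CLINT x|lborel. (sqrt (2 * pi) * iexp (- (t * s))) * (std_normal_density x *\<^sub>R iexp (t / q * x)))
      = (1 / q * sqrt (2 * pi) * exp (- (t / q)\<^sup>2 / 2)) * iexp (- (t * s))"
    using q by (simp only: integral_mult_right_zero c) (simp add: scaleR_conv_of_real)
  also have "1 / q * sqrt (2 * pi) * exp (- (t / q)\<^sup>2 / 2) = sqrt (2 * pi / a) * exp (- t\<^sup>2 / (2 * a))"
  proof -
    have "(t / q)\<^sup>2 = t\<^sup>2 / a" using q by (simp add: power_divide power2_eq_square)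
    then show ?thesis by (simp add: real_sqrt_divide q_def)
  qed
  finally show "(CLINT y|lborel. exp (- (a * (y + s)\<^sup>2) / 2) * iexp (t * y)) =
      sqrt (2 * pi / a) * exp (- t\<^sup>2 / (2 * a)) * iexp (- (t * s))" by simp
qed

lemma product_sigma_finite_lborel: "product_sigma_finite (\<lambda>_. lborel :: real measure)"
  by standard

lemma sets_PiM_lborel_borel [measurable_cong]: "sets (Pi\<^sub>M I (\<lambda>_. lborel :: real measure)) = sets (Pi\<^sub>M I (\<lambda>_. borel))"
  by (intro sets_PiM_cong) auto

text \<open>Integrate out the coordinate k after completing the square. Its shift S x turns into a
  phase, which changes each remaining frequency t_i into t_i - t_k b_i, matching
  \<open>pos_def_on_extend\<close>. The constant \<open>Z\<close> stays unspecified and is recovered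
  at t = 0 when needed.\<close>

lemma gaussian_fourier:
  assumes "finite I" "pos_def_on I A"
  shows "\<exists>Z>0. \<exists>V. pos_def_on I V \<and>
    integrable (Pi\<^sub>M I (\<lambda>_. lborel)) (\<lambda>u. exp (- qform I A u / 2)) \<and>
    (\<forall>t. (CLINT u|Pi\<^sub>M I (\<lambda>_. lborel). exp (- qform I A u / 2) * iexp (\<Sum>i\<in>I. t i * u i)) =
      of_real (Z * exp (- qform I V t / 2)))"
  using assms
proof (induction I arbitrary: A rule: finite_induct)
  case empty
  have e: "Pi\<^sub>M {} (\<lambda>_. lborel :: real measure) = count_space {\<lambda>_. undefined}"
    by (rule PiM_empty)
  have q: "qform {} B u = 0" for B u by (simp add: qform_def)
  show ?case
  proof (intro exI[of _ 1] conjI exI[of _ A] allI)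
    show "pos_def_on {} A" by (simp add: pos_def_on_def)
    show "integrable (Pi\<^sub>M {} (\<lambda>_. lborel)) (\<lambda>u. exp (- qform {} A u / 2))"
      unfolding e by (rule integrable_count_space) simp
    show "(CLINT u|Pi\<^sub>M {} (\<lambda>_. lborel). exp (- qform {} A u / 2) * iexp (\<Sum>i\<in>{}. t i * u i)) =
        of_real (1 * exp (- qform {} A t / 2))" for t
      unfolding e by (subst lebesgue_integral_count_space_finite) (simp_all add: q)
  qed simp
next
  case (insert k I)
  interpret product_sigma_finite "\<lambda>_::nat. lborel :: real measure" by (rule product_sigma_finite_lborel)
  obtain a A' b where a: "a > 0" and A': "pos_def_on I A'"
    and sq: "\<And>u. qform (insert k I) A u = a * (u k + (\<Sum>i\<in>I. b i * u i))\<^sup>2 + qform I A' u"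
    by (rule pos_def_on_insert[OF insert.hyps insert.prems]) (rule that; assumption)
  obtain Z V' where Z: "Z > 0" and V': "pos_def_on I V'"
    and int': "integrable (Pi\<^sub>M I (\<lambda>_. lborel)) (\<lambda>u. exp (- qform I A' u / 2))"
    and four': "\<And>t. (CLINT u|Pi\<^sub>M I (\<lambda>_. lborel). exp (- qform I A' u / 2) * iexp (\<Sum>i\<in>I. t i * u i)) =
      of_real (Z * exp (- qform I V' t / 2))"
    using insert.IH[OF A'] by blast
  obtain V where V: "pos_def_on (insert k I) V"
    and Vq: "\<And>t. qform (insert k I) V t = (t k)\<^sup>2 / a + qform I V' (\<lambda>i. t i - t k * b i)"
    by (rule pos_def_on_extend[where b = b, OF insert.hyps V' a]) (rule that; assumption)
  define S where "S x = (\<Sum>i\<in>I. b i * x i)" for x :: "nat \<Rightarrow> real"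
  have upd: "qform (insert k I) A (x(k := y)) = a * (y + S x)\<^sup>2 + qform I A' x" for x y
  proof -
    have "(\<Sum>i\<in>I. b i * (x(k := y)) i) = S x" unfolding S_def
    proof (intro sum.cong refl)
      fix i assume "i \<in> I"
      then have "i \<noteq> k" using insert.hyps by blast
      then show "b i * (x(k := y)) i = b i * x i" by simp
    qed
    moreover have "qform I A' (x(k := y)) = qform I A' x"
    proof (rule qform_cong)
      fix i assume "i \<in> I"
      then have "i \<noteq> k" using insert.hyps by blast
      then show "(x(k := y)) i = x i" by simp
    qed
    ultimately show ?thesis by (simp only: sq fun_upd_same)
  qed
  have fin: "finite (insert k I)" using insert.hyps by simp
  note [measurable] = measurable_qform[OF fin] measurable_qform[OF insert.hyps(1)]
  define f where "f u = exp (- qform (insert k I) A u / 2)" for u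
  have [measurable]: "f \<in> borel_measurable (Pi\<^sub>M (insert k I) (\<lambda>_. lborel))"
    unfolding f_def by measurable
  have fu: "f (x(k := y)) = exp (- (a * (y + S x)\<^sup>2) / 2) * exp (- qform I A' x / 2)" for x y
  proof -
    have "exp (- (p + q) / 2) = exp (- p / 2) * exp (- q / 2)" for p q :: real
      by (simp add: exp_add[symmetric] diff_divide_distrib)
    then show ?thesis by (simp only: f_def upd)
  qed
  \<comment> \<open>The one-dimensional transform at frequency 0 is the total mass.\<close>
  have inner: "(\<integral>\<^sup>+ y. ennreal (exp (- (a * (y + s)\<^sup>2) / 2)) \<partial>lborel) = ennreal (sqrt (2 * pi / a))" for s
  proof -
    have "(CLINT y|lborel. exp (- (a * (y + s)\<^sup>2) / 2) * iexp (0 * y)) = of_real (\<integral>y. exp (- (a * (y + s)\<^sup>2) / 2) \<partial>lborel)"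
      by simp
    moreover have "complex_of_real (sqrt (2 * pi / a) * exp (- 0\<^sup>2 / (2 * a))) * iexp (- (0 * s)) =
        of_real (sqrt (2 * pi / a))" by simp
    ultimately have "complex_of_real (\<integral>y. exp (- (a * (y + s)\<^sup>2) / 2) \<partial>lborel) = of_real (sqrt (2 * pi / a))"
      using gaussian_shift_fourier(2)[OF a, of s 0] by (simp only:)
    then have "(\<integral>y. exp (- (a * (y + s)\<^sup>2) / 2) \<partial>lborel) = sqrt (2 * pi / a)"
      by (simp only: of_real_eq_iff)
    then show ?thesis by (subst nn_integral_eq_integral[OF gaussian_shift_fourier(1)[OF a]]) auto
  qed
  have int: "integrable (Pi\<^sub>M (insert k I) (\<lambda>_. lborel)) f"
  proof (rule integrableI_nonneg)
    have "(\<integral>\<^sup>+ u. ennreal (f u) \<partial>Pi\<^sub>M (insert k I) (\<lambda>_. lborel)) =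
        (\<integral>\<^sup>+ x. (\<integral>\<^sup>+ y. ennreal (f (x(k := y))) \<partial>lborel) \<partial>Pi\<^sub>M I (\<lambda>_. lborel))"
      by (rule product_nn_integral_insert[OF insert.hyps]) measurable
    also have "\<dots> = (\<integral>\<^sup>+ x. ennreal (exp (- qform I A' x / 2)) * ennreal (sqrt (2 * pi / a)) \<partial>Pi\<^sub>M I (\<lambda>_. lborel))"
    proof (rule nn_integral_cong)
      fix x
      have "(\<integral>\<^sup>+ y. ennreal (f (x(k := y))) \<partial>lborel) =
          (\<integral>\<^sup>+ y. ennreal (exp (- qform I A' x / 2)) * ennreal (exp (- (a * (y + S x)\<^sup>2) / 2)) \<partial>lborel)"
        by (intro nn_integral_cong) (simp only: fu ennreal_mult[symmetric] exp_ge_zero mult.commute)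
      also have "\<dots> = ennreal (exp (- qform I A' x / 2)) * ennreal (sqrt (2 * pi / a))"
        by (subst nn_integral_cmult) (simp_all only: inner, measurable)
      finally show "(\<integral>\<^sup>+ y. ennreal (f (x(k := y))) \<partial>lborel) =
          ennreal (exp (- qform I A' x / 2)) * ennreal (sqrt (2 * pi / a))" .
    qed
    also have "\<dots> = (\<integral>\<^sup>+ x. ennreal (exp (- qform I A' x / 2)) \<partial>Pi\<^sub>M I (\<lambda>_. lborel)) * ennreal (sqrt (2 * pi / a))"
      by (rule nn_integral_multc) measurable
    also have "\<dots> < \<infinity>"
      using nn_integral_eq_integral[OF int'] by (simp add: ennreal_mult_less_top)
    finally show "(\<integral>\<^sup>+ u. ennreal (f u) \<partial>Pi\<^sub>M (insert k I) (\<lambda>_. lborel)) < \<infinity>" .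
  qed (auto simp: f_def)
  have four: "(CLINT u|Pi\<^sub>M (insert k I) (\<lambda>_. lborel). f u * iexp (\<Sum>i\<in>insert k I. t i * u i)) =
      of_real ((sqrt (2 * pi / a) * Z) * exp (- qform (insert k I) V t / 2))" for t
  proof -
    have intc: "integrable (Pi\<^sub>M (insert k I) (\<lambda>_. lborel)) (\<lambda>u. f u * iexp (\<Sum>i\<in>insert k I. t i * u i))"
    proof (rule Bochner_Integration.integrable_bound[OF int])
      show "(\<lambda>u. f u * iexp (\<Sum>i\<in>insert k I. t i * u i)) \<in> borel_measurable (Pi\<^sub>M (insert k I) (\<lambda>_. lborel))"
        by measurable
    qed (simp add: norm_mult)
    have "(CLINT u|Pi\<^sub>M (insert k I) (\<lambda>_. lborel). f u * iexp (\<Sum>i\<in>insert k I. t i * u i)) =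
        (CLINT x|Pi\<^sub>M I (\<lambda>_. lborel). (CLINT y|lborel. f (x(k := y)) * iexp (\<Sum>i\<in>insert k I. t i * (x(k := y)) i)))"
      by (rule product_integral_insert[OF insert.hyps intc])
    also have "\<dots> = (CLINT x|Pi\<^sub>M I (\<lambda>_. lborel).
        of_real (sqrt (2 * pi / a) * exp (- (t k)\<^sup>2 / (2 * a))) *
        (exp (- qform I A' x / 2) * iexp (\<Sum>i\<in>I. (t i - t k * b i) * x i)))"
    proof (intro Bochner_Integration.integral_cong refl)
      fix x
      have "(\<Sum>i\<in>insert k I. t i * (x(k := y)) i) = t k * y + (\<Sum>i\<in>I. t i * x i)" for y
        using insert.hyps by (auto simp: sum.insert intro!: sum.cong)
      then have "(CLINT y|lborel. f (x(k := y)) * iexp (\<Sum>i\<in>insert k I. t i * (x(k := y)) i)) =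
        (CLINT y|lborel. (exp (- qform I A' x / 2) * iexp (\<Sum>i\<in>I. t i * x i)) *
          (exp (- (a * (y + S x)\<^sup>2) / 2) * iexp (t k * y)))"
        by (simp only: fu of_real_add of_real_mult distrib_left exp_add mult_ac)
      also have "\<dots> = (exp (- qform I A' x / 2) * iexp (\<Sum>i\<in>I. t i * x i)) *
          (of_real (sqrt (2 * pi / a) * exp (- (t k)\<^sup>2 / (2 * a))) * iexp (- (t k * S x)))"
        by (simp only: integral_mult_right_zero gaussian_shift_fourier(2)[OF a])
      also have "\<dots> = of_real (sqrt (2 * pi / a) * exp (- (t k)\<^sup>2 / (2 * a))) *
        (exp (- qform I A' x / 2) * (iexp (\<Sum>i\<in>I. t i * x i) * iexp (- (t k * S x))))"
      proof -
        have "(e * w) * (c * v) = c * (e * (w * v))" for e w c v :: complex by (simp add: mult_ac)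
        then show ?thesis .
      qed
      also have "iexp (\<Sum>i\<in>I. t i * x i) * iexp (- (t k * S x)) = iexp (\<Sum>i\<in>I. (t i - t k * b i) * x i)"
      proof -
        have "(\<Sum>i\<in>I. (t i - t k * b i) * x i) = (\<Sum>i\<in>I. t i * x i) + - (t k * S x)"
          by (simp add: S_def left_diff_distrib sum_subtractf sum_distrib_left mult.assoc)
        then show ?thesis by (simp only: of_real_add distrib_left exp_add)
      qed
      finally show "(CLINT y|lborel. f (x(k := y)) * iexp (\<Sum>i\<in>insert k I. t i * (x(k := y)) i)) =
        of_real (sqrt (2 * pi / a) * exp (- (t k)\<^sup>2 / (2 * a))) *
        (exp (- qform I A' x / 2) * iexp (\<Sum>i\<in>I. (t i - t k * b i) * x i))" .
    qed
    also have "\<dots> = of_real (sqrt (2 * pi / a) * exp (- (t k)\<^sup>2 / (2 * a))) *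
        of_real (Z * exp (- qform I V' (\<lambda>i. t i - t k * b i) / 2))"
      by (simp only: integral_mult_right_zero four')
    also have "\<dots> = of_real ((sqrt (2 * pi / a) * Z) * (exp (- (t k)\<^sup>2 / (2 * a)) * exp (- qform I V' (\<lambda>i. t i - t k * b i) / 2)))"
      by (simp only: of_real_mult mult_ac)
    also have "exp (- (t k)\<^sup>2 / (2 * a)) * exp (- qform I V' (\<lambda>i. t i - t k * b i) / 2) = exp (- qform (insert k I) V t / 2)"
      by (simp add: Vq exp_add[symmetric] field_simps)
    finally show ?thesis .
  qed
  show ?case
  proof (intro exI[of _ "sqrt (2 * pi / a) * Z"] conjI exI[of _ V] allI V)
    show "sqrt (2 * pi / a) * Z > 0" using a Z by simp
    show "integrable (Pi\<^sub>M (insert k I) (\<lambda>_. lborel)) (\<lambda>u. exp (- qform (insert k I) A u / 2))"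
      using int unfolding f_def .
  qed (rule four[unfolded f_def])
qed

section \<open>Rank\<close>

lemma pos_def_on_kernel:
  assumes pd: "pos_def_on I V" and "\<And>k. k \<in> I \<Longrightarrow> (\<Sum>i\<in>I. V k i * u i) = 0" "i \<in> I"
  shows "u i = 0"
proof (rule ccontr)
  assume "u i \<noteq> 0"
  then have "qform I V u > 0" using pos_def_on_pos[OF pd assms(3)] by blast
  moreover have "qform I V u = (\<Sum>k\<in>I. u k * (\<Sum>i\<in>I. V k i * u i))"
    by (simp add: qform_def sum_distrib_left mult_ac)
  ultimately show False using assms(2) by simp
qed

definition pad_mat :: "nat \<Rightarrow> nat set \<Rightarrow> (nat \<Rightarrow> nat \<Rightarrow> real) \<Rightarrow> real mat" where
  "pad_mat l I V = mat l l (\<lambda>(i, j). if Suc i \<in> I \<and> Suc j \<in> I then V (Suc i) (Suc j) else 0)"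

text \<open>Definiteness makes the columns in \<open>I\<close> distinct and independent; the others
  are zero vectors and belong to no independent set, so the former constitute a maximal one.\<close>

lemma rank_pad_mat:
  assumes I: "I \<subseteq> {1..l}" and pd: "pos_def_on I V"
  shows "vec_space.rank l (pad_mat l I V) = card I"
proof -
  interpret vec_space "TYPE(real)" l .
  let ?M = "pad_mat l I V"
  have M: "?M \<in> carrier_mat l l" by (simp add: pad_mat_def)
  have finI: "finite I" using I finite_subset by auto
  define cl where "cl i = col ?M (i - 1)" for i
  have cl_index: "cl i $ (k - 1) = V k i" if "i \<in> I" "k \<in> I" for i k
  proof -
    have "i - 1 < l" "k - 1 < l" "Suc (i - 1) = i" "Suc (k - 1) = k"
      using subsetD[OF I that(1)] subsetD[OF I that(2)] by auto
    then show ?thesis using that by (simp add: cl_def pad_mat_def)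
  qed
  have clc: "cl i \<in> carrier_vec l" for i
    unfolding cl_def by (rule carrier_vecI) (simp add: pad_mat_def)
  have inj: "inj_on cl I"
  proof (rule inj_onI, rule ccontr)
    fix i j assume ij: "i \<in> I" "j \<in> I" "cl i = cl j" "i \<noteq> j"
    \<comment> \<open>Independence is a property of the set of columns, in which equal columns would
      merge and lower the count; equality would put e_i - e_j into the kernel.\<close>
    define u :: "nat \<Rightarrow> real" where "u m = (if m = i then 1 else 0) - (if m = j then 1 else 0)" for m
    have "(\<Sum>m\<in>I. V k m * u m) = 0" if "k \<in> I" for k
    proof -
      have "(\<Sum>m\<in>I. V k m * u m) = V k i - V k j"
        using ij finI by (simp add: u_def right_diff_distrib sum_subtractf if_distrib[where f = "\<lambda>x. _ * x"] cong: if_cong)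
      then show ?thesis using cl_index[OF ij(1) that] cl_index[OF ij(2) that] ij(3) by simp
    qed
    then have "u i = 0" by (rule pos_def_on_kernel[OF pd _ ij(1)])
    then show False using ij(4) by (simp add: u_def)
  qed
  define S where "S = cl ` I"
  have SC: "S \<subseteq> carrier_vec l" using clc by (auto simp: S_def)
  have cols: "set (cols ?M) = cl ` {1..l}"
  proof -
    have "set (cols ?M) = col ?M ` {0..<l}" using M by (simp add: cols_def)
    also have "{0..<l} = (\<lambda>i. i - 1) ` {1..l}" by (force simp: image_def)
    finally show ?thesis by (simp add: image_image cl_def)
  qed
  have zero: "cl i = 0\<^sub>v l" if "i \<in> {1..l} - I" for i
    using that M by (intro eq_vecI) (auto simp: cl_def pad_mat_def)
  have indpt: "lin_indpt S"
  proof
    assume "lin_dep S"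
    then obtain A a v where A: "finite A" "A \<subseteq> S" "lincomb a A = 0\<^sub>v l" "v \<in> A" "a v \<noteq> 0"
      unfolding lin_dep_def by (auto simp: module_vec_simps)
    define J where "J = {i \<in> I. cl i \<in> A}"
    have J: "A = cl ` J" "J \<subseteq> I" using A(2) by (auto simp: J_def S_def)
    define u where "u i = (if i \<in> J then a (cl i) else 0)" for i
    have "(\<Sum>i\<in>I. V k i * u i) = 0" if k: "k \<in> I" for k
    proof -
      have kl: "k - 1 < l" using k I by fastforce
      have "0 = lincomb a A $ (k - 1)" using A(3) kl by simp
      also have "\<dots> = (\<Sum>x\<in>A. a x * x $ (k - 1))"
        by (rule lincomb_index[OF kl]) (use A(2) SC in auto)
      also have "\<dots> = (\<Sum>i\<in>J. a (cl i) * cl i $ (k - 1))"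
        unfolding J(1) using inj_on_subset[OF inj J(2)] by (simp add: sum.reindex)
      also have "\<dots> = (\<Sum>i\<in>J. V k i * u i)"
      proof (intro sum.cong refl)
        fix i assume i: "i \<in> J"
        then show "a (cl i) * cl i $ (k - 1) = V k i * u i"
          using cl_index[of i k] J(2) k by (auto simp: u_def)
      qed
      also have "\<dots> = (\<Sum>i\<in>I. V k i * u i)"
        by (rule sum.mono_neutral_left) (use J(2) finI in \<open>auto simp: u_def\<close>)
      finally show ?thesis by simp
    qed
    note ker = this
    obtain i where i: "i \<in> J" "v = cl i" using A(4) J(1) by blast
    then have "i \<in> I" using J(2) by blast
    with ker have "u i = 0" by (rule pos_def_on_kernel[OF pd])
    then show False using A(5) i by (simp add: u_def)
  qed
  have "maximal S (\<lambda>T. T \<subseteq> set (cols ?M) \<and> lin_indpt T)"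
    unfolding maximal_def
  proof (intro conjI allI impI)
    show "S \<subseteq> set (cols ?M)" unfolding cols S_def using I by auto
    show "lin_indpt S" by (rule indpt)
    fix T assume T: "S \<subseteq> T \<and> T \<subseteq> set (cols ?M) \<and> lin_indpt T"
    then have "T \<subseteq> carrier_vec l" using cols clc by auto
    then have "0\<^sub>v l \<notin> T" using zero_nin_lin_indpt[of T] T by (auto simp: module_vec_simps)
    have "T \<subseteq> S"
    proof
      fix x assume x: "x \<in> T"
      then have "x \<in> cl ` {1..l}" using T cols by auto
      then obtain i where i: "i \<in> {1..l}" "x = cl i" by blast
      have "i \<in> I"
      proof (rule ccontr)
        assume "i \<notin> I"
        then have "x = 0\<^sub>v l" using zero[of i] i by simp
        then show False using x \<open>0\<^sub>v l \<notin> T\<close> by simp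
      qed
      then show "x \<in> S" using i(2) by (simp add: S_def)
    qed
    then show "T = S" using T by simp
  qed
  then have "rank ?M = card S" by (rule rank_card_indpt[OF M])
  then show ?thesis by (simp add: S_def card_image[OF inj])
qed

section \<open>Volumes of the fibres\<close>

text \<open>The entry at 0 is the total mass. The value at a constrained index comes from
  \<open>C\<close>, so an arbitrary \<open>y\<close> is always read as a point of the slice.\<close>

definition full_moments :: "(nat \<rightharpoonup> real) \<Rightarrow> (nat \<Rightarrow> real) \<Rightarrow> nat \<Rightarrow> real" where
  "full_moments C y = (\<lambda>j. if j = 0 then 1 else case C j of Some c \<Rightarrow> c | None \<Rightarrow> y j)"

abbreviation trig_seq :: "(nat \<rightharpoonup> real) \<Rightarrow> (nat \<Rightarrow> real) \<Rightarrow> nat \<Rightarrow> real" where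
  "trig_seq C y \<equiv> cheb_seq (full_moments C y)"

lemma full_moments_0 [simp]: "full_moments C y 0 = 1"
  by (simp add: full_moments_def)

lemma finite_free_indices [simp]: "finite (free_indices C n)"
  by (simp add: free_indices_def)

lemma last_index_ge: "moment_constraint C \<Longrightarrow> i \<in> dom C \<Longrightarrow> i \<le> last_index C"
  unfolding last_index_def moment_constraint_def by (intro Max_ge) auto

lemma free_indices_Suc:
  assumes "moment_constraint C" "last_index C \<le> n"
  shows "free_indices C (Suc n) = insert (Suc n) (free_indices C n)" "Suc n \<notin> free_indices C n" "C (Suc n) = None"
proof -
  have "Suc n \<notin> dom C" using last_index_ge[OF assms(1), of "Suc n"] assms(2) by auto
  then show "free_indices C (Suc n) = insert (Suc n) (free_indices C n)" "C (Suc n) = None"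
    by (auto simp: free_indices_def)
qed (simp add: free_indices_def)

lemma full_moments_cong:
  assumes "\<And>j. j \<in> free_indices C n \<Longrightarrow> y j = z j" "j \<le> n"
  shows "full_moments C y j = full_moments C z j"
proof (cases "j \<in> free_indices C n")
  case False
  then have "j = 0 \<or> C j \<noteq> None" using assms(2) by (auto simp: free_indices_def)
  then show ?thesis by (auto simp: full_moments_def)
qed (simp add: full_moments_def assms(1) split: option.split)

lemma trig_seq_cong:
  assumes "\<And>j. j \<in> free_indices C n \<Longrightarrow> y j = z j" "k \<le> n"
  shows "trig_seq C y k = trig_seq C z k"
  by (rule cheb_seq_cong, rule full_moments_cong[of C n]) (use assms in auto)

lemma measurable_full_moments:
  assumes "j \<le> n"
  shows "(\<lambda>y. full_moments C y j) \<in> borel_measurable (coord_borel (free_indices C n))"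
proof (cases "j \<in> free_indices C n")
  case True
  then have "(\<lambda>y. full_moments C y j) = (\<lambda>y. y j)"
    by (auto simp: full_moments_def free_indices_def split: option.splits)
  then show ?thesis using True by simp
next
  case False
  then have "j = 0 \<or> C j \<noteq> None" using assms by (auto simp: free_indices_def)
  then have "(\<lambda>y. full_moments C y j) = (\<lambda>y. full_moments C (\<lambda>_. 0) j)"
    by (auto simp: full_moments_def)
  then show ?thesis by simp
qed

lemma measurable_trig_seq:
  assumes "k \<le> n"
  shows "(\<lambda>y. trig_seq C y k) \<in> borel_measurable (coord_borel (free_indices C n))"
  unfolding cheb_seq_def
  by (intro borel_measurable_sum borel_measurable_times borel_measurable_const measurable_full_moments)
    (use assms in auto)

text \<open>The coefficients at order m + 1 arise from those at order m by arithmetic operations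
  with total division, so measurability propagates by one joint induction.\<close>

lemma measurable_szego:
  assumes "m \<le> n"
  shows "(\<lambda>y. coeff (opoly (trig_seq C y) m) i) \<in> borel_measurable (coord_borel (free_indices C n)) \<and>
    (\<lambda>y. coeff (rpoly (trig_seq C y) m) i) \<in> borel_measurable (coord_borel (free_indices C n)) \<and>
    (\<lambda>y. opnorm (trig_seq C y) m) \<in> borel_measurable (coord_borel (free_indices C n))"
  using assms
proof (induction m arbitrary: i)
  case 0
  then show ?case by (simp add: opnorm_0)
next
  case (Suc m)
  let ?N = "coord_borel (free_indices C n)"
  have IH: "(\<lambda>y. coeff (opoly (trig_seq C y) m) i) \<in> borel_measurable ?N"
    "(\<lambda>y. coeff (rpoly (trig_seq C y) m) i) \<in> borel_measurable ?N"
    "(\<lambda>y. opnorm (trig_seq C y) m) \<in> borel_measurable ?N" for i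
    using Suc.IH[of i] Suc.prems by auto
  have sh: "(\<lambda>y. coeff (pCons 0 (opoly (trig_seq C y) m)) i) \<in> borel_measurable ?N" for i
    using IH(1) by (cases i) auto
  have "tform (trig_seq C y) (pCons 0 (opoly (trig_seq C y) m)) 1 =
      (\<Sum>i\<le>Suc m. coeff (pCons 0 (opoly (trig_seq C y) m)) i * trig_seq C y i)" for y
    using tform_monom[of "pCons 0 (opoly (trig_seq C y) m)" "Suc m" "trig_seq C y" 0]
    by (simp add: monom_0 one_pCons del: sum.atMost_Suc)
  then have t: "(\<lambda>y. tform (trig_seq C y) (pCons 0 (opoly (trig_seq C y) m)) 1 / opnorm (trig_seq C y) m) =
      (\<lambda>y. (\<Sum>i\<le>Suc m. coeff (pCons 0 (opoly (trig_seq C y) m)) i * trig_seq C y i) / opnorm (trig_seq C y) m)"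
    by (simp only:)
  have v: "(\<lambda>y. verblunsky (trig_seq C y) m) \<in> borel_measurable ?N"
    unfolding verblunsky_def t
    by (intro borel_measurable_divide borel_measurable_sum borel_measurable_times sh IH measurable_trig_seq)
      (use Suc.prems in auto)
  have P: "(\<lambda>y. coeff (opoly (trig_seq C y) (Suc m)) i) \<in> borel_measurable ?N" for i
    unfolding opoly_Suc coeff_diff coeff_smult
    by (intro borel_measurable_diff borel_measurable_times v IH sh)
  have R: "(\<lambda>y. coeff (rpoly (trig_seq C y) (Suc m)) i) \<in> borel_measurable ?N" for i
    unfolding rpoly_Suc coeff_diff coeff_smult
    by (intro borel_measurable_diff borel_measurable_times v IH sh)
  have "opnorm (trig_seq C y) (Suc m) = (\<Sum>i\<le>Suc m. \<Sum>j\<le>Suc m. coeff (opoly (trig_seq C y) (Suc m)) i *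
      coeff (opoly (trig_seq C y) (Suc m)) j * trig_seq C y ((i - j) + (j - i)))" for y
    unfolding opnorm_def by (rule tform_eq_sum) simp_all
  then have t: "(\<lambda>y. opnorm (trig_seq C y) (Suc m)) = (\<lambda>y. \<Sum>i\<le>Suc m. \<Sum>j\<le>Suc m.
      coeff (opoly (trig_seq C y) (Suc m)) i * coeff (opoly (trig_seq C y) (Suc m)) j * trig_seq C y ((i - j) + (j - i)))"
    by (simp only:)
  have "(\<lambda>y. opnorm (trig_seq C y) (Suc m)) \<in> borel_measurable ?N"
    unfolding t by (intro borel_measurable_sum borel_measurable_times P measurable_trig_seq) (use Suc.prems in auto)
  with P R show ?case by blast
qed

section \<open>Integrating out the last moment\<close>

lemma pdef_opnorm_nonzero: "pdef n c \<Longrightarrow> j \<le> n \<Longrightarrow> opnorm c j \<noteq> 0"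
  using pdef_opnorm[of n c j] by simp

text \<open>A Sylvester-type criterion; it reduces measurability of the definite region to finitely
  many inequalities.\<close>

lemma pdef_iff_opnorm: "pdef n c \<longleftrightarrow> (\<forall>j\<le>n. opnorm c j > 0)"
proof (induction n)
  case 0
  then show ?case by (simp add: pdef_0 opnorm_0)
next
  case (Suc n)
  then show ?case by (auto simp: pdef_Suc le_Suc_eq)
qed

lemma measurable_opnorm_trig:
  assumes "m \<le> n"
  shows "(\<lambda>y. opnorm (trig_seq C y) m) \<in> borel_measurable (coord_borel (free_indices C n))"
  using measurable_szego[OF assms] by blast

lemma measurable_pdef_trig:
  assumes "m \<le> n"
  shows "Measurable.pred (coord_borel (free_indices C n)) (\<lambda>y. pdef m (trig_seq C y))"
proof -
  have [measurable]: "(\<lambda>y. opnorm (trig_seq C y) j) \<in> borel_measurable (coord_borel (free_indices C n))"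
    if "j \<in> {..m}" for j using measurable_opnorm_trig that assms by simp
  have "Measurable.pred (coord_borel (free_indices C n)) (\<lambda>y. \<forall>j\<in>{..m}. opnorm (trig_seq C y) j > 0)"
    by measurable
  then show ?thesis by (simp add: pdef_iff_opnorm Ball_def)
qed

text \<open>For \<open>q = 0\<close> this is the indicator of the positive definite region;
  \<open>q\<close> grows by one for each moment integrated out.\<close>

definition pd_weight :: "(nat \<rightharpoonup> real) \<Rightarrow> nat \<Rightarrow> nat \<Rightarrow> (nat \<Rightarrow> real) \<Rightarrow> real" where
  "pd_weight C n q y = (if pdef n (trig_seq C y) then opnorm (trig_seq C y) n ^ q else 0)"

lemma pd_weight_nonneg: "pd_weight C n q y \<ge> 0"
  using pdef_opnorm[of n "trig_seq C y" n] by (auto simp: pd_weight_def less_imp_le)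

lemma measurable_pd_weight [measurable]:
  "pd_weight C n q \<in> borel_measurable (coord_borel (free_indices C n))"
proof -
  note [measurable] = measurable_pdef_trig[OF order_refl] measurable_opnorm_trig[OF order_refl]
  show ?thesis unfolding pd_weight_def[abs_def] by measurable
qed

text \<open>A Beta integral times the Jacobian from the moment to the cosine moment. It depends
  neither on the point nor on the constraint, so it cancels in the normalization.\<close>

definition beta_const :: "nat \<Rightarrow> nat \<Rightarrow> ennreal" where
  "beta_const n q = ennreal (1 / \<bar>coeff (cheb (Suc n)) (Suc n)\<bar>) *
    (\<integral>\<^sup>+s. ennreal (if \<bar>s\<bar> < 1 then (1 - s\<^sup>2) ^ q else 0) \<partial>lborel)"

lemma beta_const: "0 < beta_const n q" "beta_const n q < \<infinity>"
proof -
  let ?f = "\<lambda>s::real. if \<bar>s\<bar> < 1 then (1 - s\<^sup>2) ^ q else 0"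
  have "(\<integral>\<^sup>+s. ennreal (?f s) \<partial>lborel) \<le> (\<integral>\<^sup>+s. indicator {-1..1::real} s \<partial>lborel)"
  proof (rule nn_integral_mono)
    fix s :: real
    have "(1 - s\<^sup>2) ^ q \<le> 1" if "\<bar>s\<bar> < 1"
      using that by (intro power_le_one) (auto simp: abs_square_le_1)
    then show "ennreal (?f s) \<le> indicator {-1..1} s"
      by (auto simp: indicator_def ennreal_le_1)
  qed
  also have "\<dots> < \<infinity>" by simp
  finally show "beta_const n q < \<infinity>" by (simp add: beta_const_def ennreal_mult_less_top)
  have "(\<integral>\<^sup>+s. ennreal (?f s) \<partial>lborel) \<noteq> 0"
  proof
    assume z: "(\<integral>\<^sup>+s. ennreal (?f s) \<partial>lborel) = 0"
    then have "AE s in lborel. ennreal (?f s) = 0" by (subst (asm) nn_integral_0_iff_AE) auto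
    then have "AE s in lborel. s \<notin> {-1<..<1::real}"
    proof eventually_elim
      case (elim s)
      show ?case
      proof
        assume "s \<in> {-1<..<1}"
        then have s: "\<bar>s\<bar> < 1" by auto
        then have p: "1 - s\<^sup>2 > 0" using abs_square_less_1[of s] by simp
        have "ennreal ((1 - s\<^sup>2) ^ q) = 0" using elim s by (simp only: if_True)
        then have "(1 - s\<^sup>2) ^ q \<le> 0" by (simp only: ennreal_eq_0_iff)
        with zero_less_power[OF p, of q] show False by linarith
      qed
    qed
    then have "{-1<..<1::real} \<in> null_sets lborel" by (subst AE_iff_null_sets) auto
    then have "emeasure lborel {-1<..<1::real} = 0" by (rule null_setsD1)
    then show False by simp
  qed
  then show "0 < beta_const n q"
    using coeff_cheb_top[of "Suc n"] by (simp add: beta_const_def ennreal_zero_less_mult_iff zero_less_iff_neq_zero)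
qed

text \<open>Use a_n as the variable of the fibre: it is affine in the last moment with slope
  \<kappa> / r_n, and r_(n+1)^q = r_n^q (1 - a_n^2)^q. The Jacobian supplies the additional factor
  r_n.\<close>

lemma pd_weight_fibre:
  assumes "moment_constraint C" "last_index C \<le> n"
  shows "(\<integral>\<^sup>+t. ennreal (pd_weight C (Suc n) q (x(Suc n := t))) \<partial>lborel) =
    beta_const n q * ennreal (pd_weight C n (Suc q) x)"
proof -
  define c where "c t = trig_seq C (x(Suc n := t))" for t
  note Sn = free_indices_Suc[OF assms]
  have cx: "c t k = trig_seq C x k" if "k \<le> n" for t k
    unfolding c_def by (rule trig_seq_cong[OF _ that]) (use Sn(2) in auto)
  show ?thesis
  proof (cases "pdef n (trig_seq C x)")
    case False
    then have "\<not> pdef (Suc n) (c t)" for t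
      using pdef_cong[of n "c t" "trig_seq C x"] cx by (auto simp: pdef_Suc)
    then show ?thesis using False by (simp add: pd_weight_def c_def)
  next
    case True
    define r where "r = opnorm (trig_seq C x) n"
    define a where "a = verblunsky (c 0) n"
    define \<kappa> where "\<kappa> = coeff (cheb (Suc n)) (Suc n)"
    have \<kappa>: "\<kappa> \<noteq> 0" unfolding \<kappa>_def by (rule coeff_cheb_top)
    have r: "r > 0" unfolding r_def by (rule pdef_opnorm[OF True order_refl])
    have pdc: "pdef n (c t)" for t using True pdef_cong[of n "c t" "trig_seq C x"] cx by blast
    have rc: "opnorm (c t) n = r" for t unfolding r_def by (rule opnorm_cong) (rule cx)
    have v: "verblunsky (c t) n = a + \<kappa> / r * t" for t
    proof -
      have "verblunsky (c t) n - verblunsky (c 0) n = (c t (Suc n) - c 0 (Suc n)) / opnorm (c 0) n"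
        by (rule verblunsky_diff) (simp add: cx)
      also have "c t (Suc n) - c 0 (Suc n) = \<kappa> * (t - 0)"
        unfolding c_def \<kappa>_def
        by (subst cheb_seq_top) (use Sn(3) in \<open>auto simp: full_moments_def split: option.splits\<close>)
      finally show ?thesis by (simp add: rc a_def)
    qed
    have w: "pd_weight C (Suc n) q (x(Suc n := t)) =
        r ^ q * (if \<bar>a + \<kappa> / r * t\<bar> < 1 then (1 - (a + \<kappa> / r * t)\<^sup>2) ^ q else 0)" for t
    proof -
      have "opnorm (c t) (Suc n) = opnorm (c t) n * (1 - (verblunsky (c t) n)\<^sup>2)"
        by (rule opnorm_Suc) (rule pdef_opnorm_nonzero[OF pdc])
      then show ?thesis
        unfolding pd_weight_def c_def[symmetric] by (simp add: pdef_Suc_verblunsky pdc rc v power_mult_distrib)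
    qed
    let ?f = "\<lambda>s::real. if \<bar>s\<bar> < 1 then (1 - s\<^sup>2) ^ q else 0"
    have fnn: "?f s \<ge> 0" for s by (auto simp: abs_square_le_1)
    have "(\<integral>\<^sup>+s. ennreal (?f s) \<partial>lborel) = ennreal \<bar>\<kappa> / r\<bar> * (\<integral>\<^sup>+t. ennreal (?f (a + \<kappa> / r * t)) \<partial>lborel)"
      by (rule nn_integral_real_affine) (use \<kappa> r in auto)
    then have "ennreal \<bar>r / \<kappa>\<bar> * (\<integral>\<^sup>+s. ennreal (?f s) \<partial>lborel) =
        (ennreal \<bar>r / \<kappa>\<bar> * ennreal \<bar>\<kappa> / r\<bar>) * (\<integral>\<^sup>+t. ennreal (?f (a + \<kappa> / r * t)) \<partial>lborel)"
      by (simp only: mult.assoc)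
    also have "ennreal \<bar>r / \<kappa>\<bar> * ennreal \<bar>\<kappa> / r\<bar> = 1"
      using \<kappa> r by (simp flip: ennreal_mult)
    finally have aff: "(\<integral>\<^sup>+t. ennreal (?f (a + \<kappa> / r * t)) \<partial>lborel) = ennreal \<bar>r / \<kappa>\<bar> * (\<integral>\<^sup>+s. ennreal (?f s) \<partial>lborel)"
      by simp
    have "(\<integral>\<^sup>+t. ennreal (pd_weight C (Suc n) q (x(Suc n := t))) \<partial>lborel) =
        (\<integral>\<^sup>+t. ennreal (r ^ q) * ennreal (?f (a + \<kappa> / r * t)) \<partial>lborel)"
      unfolding w by (intro nn_integral_cong ennreal_mult[OF _ fnn]) (use r in simp)
    also have "\<dots> = ennreal (r ^ q) * (\<integral>\<^sup>+t. ennreal (?f (a + \<kappa> / r * t)) \<partial>lborel)"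
      by (rule nn_integral_cmult) measurable
    also have "\<dots> = ennreal (r ^ q) * ennreal \<bar>r / \<kappa>\<bar> * (\<integral>\<^sup>+s. ennreal (?f s) \<partial>lborel)"
      unfolding aff by (simp only: mult.assoc)
    also have "ennreal (r ^ q) * ennreal \<bar>r / \<kappa>\<bar> = ennreal (1 / \<bar>\<kappa>\<bar>) * ennreal (r ^ Suc q)"
      using r by (simp add: ennreal_mult[symmetric] abs_divide field_simps)
    also have "\<dots> * (\<integral>\<^sup>+s. ennreal (?f s) \<partial>lborel) = beta_const n q * ennreal (r ^ Suc q)"
      by (simp only: beta_const_def \<kappa>_def mult_ac)
    finally show ?thesis using True by (simp only: pd_weight_def r_def if_True)
  qed
qed

text \<open>The exponent \<open>q\<close> is general in the induction, since each fibre integral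
  raises it by one. The test function \<open>g\<close> sees the first l moments only, so it passes
  through every fibre.\<close>

lemma pd_weight_marginal:
  assumes C: "moment_constraint C" "last_index C \<le> l" and "l \<le> n"
  shows "\<exists>K. 0 < K \<and> K < \<infinity> \<and> (\<forall>g \<in> borel_measurable (coord_lebesgue (free_indices C l)).
    (\<integral>\<^sup>+y. g (restrict y (free_indices C l)) * ennreal (pd_weight C n q y) \<partial>coord_lebesgue (free_indices C n)) =
    K * (\<integral>\<^sup>+x. g x * ennreal (pd_weight C l (q + (n - l)) x) \<partial>coord_lebesgue (free_indices C l)))"
  using assms(3)
proof (induction n arbitrary: q rule: dec_induct)
  case base
  have "(\<integral>\<^sup>+y. g (restrict y (free_indices C l)) * ennreal (pd_weight C l q y) \<partial>coord_lebesgue (free_indices C l)) =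
      (\<integral>\<^sup>+y. g y * ennreal (pd_weight C l q y) \<partial>coord_lebesgue (free_indices C l))" for g
    by (intro nn_integral_cong) (auto simp: space_PiM PiE_restrict)
  then have eq: "(\<integral>\<^sup>+y. g (restrict y (free_indices C l)) * ennreal (pd_weight C l q y) \<partial>coord_lebesgue (free_indices C l)) =
      1 * (\<integral>\<^sup>+y. g y * ennreal (pd_weight C l (q + (l - l)) y) \<partial>coord_lebesgue (free_indices C l))" for g
    by (simp only: diff_self_eq_0 add_0_right mult_1)
  show ?case
  proof (intro exI[of _ 1] conjI ballI)
    show "0 < (1 :: ennreal)" "(1 :: ennreal) < \<infinity>" by simp_all
  qed (rule eq)
next
  case (step n)
  interpret product_sigma_finite "\<lambda>_::nat. lborel :: real measure" by (rule product_sigma_finite_lborel)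
  have Cn: "last_index C \<le> n" using C step by simp
  note Sn = free_indices_Suc[OF C(1) Cn]
  obtain K where K: "0 < K" "K < \<infinity>" "\<And>g. g \<in> borel_measurable (coord_lebesgue (free_indices C l)) \<Longrightarrow>
    (\<integral>\<^sup>+y. g (restrict y (free_indices C l)) * ennreal (pd_weight C n (Suc q) y) \<partial>coord_lebesgue (free_indices C n)) =
    K * (\<integral>\<^sup>+x. g x * ennreal (pd_weight C l (Suc q + (n - l)) x) \<partial>coord_lebesgue (free_indices C l))"
    using step.IH[of "Suc q"] by blast
  have sub: "free_indices C l \<subseteq> free_indices C n" using step by (auto simp: free_indices_def)
  have ni: "Suc n \<notin> free_indices C l" using sub Sn(2) by blast
  have "(\<integral>\<^sup>+y. g (restrict y (free_indices C l)) * ennreal (pd_weight C (Suc n) q y) \<partial>coord_lebesgue (free_indices C (Suc n))) =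
      (beta_const n q * K) * (\<integral>\<^sup>+x. g x * ennreal (pd_weight C l (q + (Suc n - l)) x) \<partial>coord_lebesgue (free_indices C l))"
    if g[measurable]: "g \<in> borel_measurable (coord_lebesgue (free_indices C l))" for g
  proof -
    have [measurable]: "(\<lambda>y. restrict y (free_indices C l)) \<in> measurable (coord_lebesgue (free_indices C m)) (coord_lebesgue (free_indices C l))"
      if "l \<le> m" for m
      by (rule measurable_restrict_subset) (use that in \<open>auto simp: free_indices_def\<close>)
    have gm: "(\<lambda>y. g (restrict y (free_indices C l)) * ennreal (pd_weight C m p y)) \<in> borel_measurable (coord_lebesgue (free_indices C m))"
      if [simp]: "l \<le> m" for m p by measurable
    have pm: "(\<lambda>t. ennreal (pd_weight C (Suc n) q (x(Suc n := t)))) \<in> borel_measurable lborel"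
      if x: "x \<in> space (coord_lebesgue (free_indices C n))" for x
    proof -
      have "(\<lambda>t. x(Suc n := t)) \<in> measurable lborel (coord_borel (free_indices C (Suc n)))"
        unfolding Sn(1) by (rule measurable_PiM_single') (use x in \<open>auto simp: space_PiM PiE_def extensional_def fun_upd_def\<close>)
      then show ?thesis by measurable
    qed
    have "(\<integral>\<^sup>+y. g (restrict y (free_indices C l)) * ennreal (pd_weight C (Suc n) q y) \<partial>coord_lebesgue (free_indices C (Suc n))) =
      (\<integral>\<^sup>+x. (\<integral>\<^sup>+t. g (restrict (x(Suc n := t)) (free_indices C l)) * ennreal (pd_weight C (Suc n) q (x(Suc n := t))) \<partial>lborel)
        \<partial>coord_lebesgue (free_indices C n))"
      unfolding Sn(1)
      by (rule product_nn_integral_insert[OF finite_free_indices Sn(2)]) (use gm[of "Suc n" q] step Sn(1) in simp)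
    also have "\<dots> = (\<integral>\<^sup>+x. beta_const n q * (g (restrict x (free_indices C l)) * ennreal (pd_weight C n (Suc q) x))
        \<partial>coord_lebesgue (free_indices C n))"
    proof (rule nn_integral_cong)
      fix x assume x: "x \<in> space (coord_lebesgue (free_indices C n))"
      have "restrict (x(Suc n := t)) (free_indices C l) = restrict x (free_indices C l)" for t
        using ni by (auto simp: restrict_def fun_eq_iff)
      then have "(\<integral>\<^sup>+t. g (restrict (x(Suc n := t)) (free_indices C l)) * ennreal (pd_weight C (Suc n) q (x(Suc n := t))) \<partial>lborel) =
        g (restrict x (free_indices C l)) * (\<integral>\<^sup>+t. ennreal (pd_weight C (Suc n) q (x(Suc n := t))) \<partial>lborel)"
        by (simp only:) (rule nn_integral_cmult, rule pm[OF x])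
      then show "(\<integral>\<^sup>+t. g (restrict (x(Suc n := t)) (free_indices C l)) * ennreal (pd_weight C (Suc n) q (x(Suc n := t))) \<partial>lborel) =
        beta_const n q * (g (restrict x (free_indices C l)) * ennreal (pd_weight C n (Suc q) x))"
        by (simp only: pd_weight_fibre[OF C(1) Cn] mult_ac)
    qed
    also have "\<dots> = beta_const n q * (\<integral>\<^sup>+x. g (restrict x (free_indices C l)) * ennreal (pd_weight C n (Suc q) x)
        \<partial>coord_lebesgue (free_indices C n))"
      by (rule nn_integral_cmult) (rule gm, use step in simp)
    also have "\<dots> = beta_const n q * (K * (\<integral>\<^sup>+x. g x * ennreal (pd_weight C l (Suc q + (n - l)) x) \<partial>coord_lebesgue (free_indices C l)))"
      by (simp only: K(3)[OF g])
    also have "Suc q + (n - l) = q + (Suc n - l)" using step by simp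
    finally show ?thesis by (simp only: mult.assoc)
  qed
  moreover have "0 < beta_const n q * K" using beta_const[of n q] K by (simp add: ennreal_zero_less_mult_iff)
  moreover have "beta_const n q * K < \<infinity>" using beta_const[of n q] K by (simp add: ennreal_mult_less_top)
  ultimately show ?case by blast
qed

section \<open>Topology and measurability of the moment sets\<close>

lemma measurable_PiM_into_fun: "(\<lambda>x. x) \<in> measurable (coord_borel I) (borel :: (nat \<Rightarrow> real) measure)"
proof (rule measurable_coordinatewise_then_product)
  fix i
  show "(\<lambda>x. x i) \<in> borel_measurable (coord_borel I)"
  proof (cases "i \<in> I")
    case False
    have "(\<lambda>x. undefined) \<in> borel_measurable (coord_borel I)" by simp
    then show ?thesis
      by (rule measurable_cong[THEN iffD1, rotated]) (use False in \<open>auto simp: space_PiM PiE_def extensional_def\<close>)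
  qed simp
qed

text \<open>Points over \<open>I\<close> are functions equal to \<open>undefined\<close> elsewhere,
  so the product space sits inside the full function type, whose topology can then be used.\<close>

lemma closed_imp_sets_PiM:
  fixes S :: "(nat \<Rightarrow> real) set"
  assumes "closed S" "S \<subseteq> extensional I"
  shows "S \<in> sets (coord_borel I)"
proof -
  have "(\<lambda>x. x) -` S \<inter> space (coord_borel I) \<in> sets (coord_borel I)"
    by (rule measurable_sets[OF measurable_PiM_into_fun]) (use assms in auto)
  moreover have "(\<lambda>x. x) -` S \<inter> space (coord_borel I) = S"
    using assms(2) by (auto simp: space_PiM PiE_def)
  ultimately show ?thesis by simp
qed

lemma continuous_map_imp_continuous_on_restrict:
  fixes f :: "(nat \<Rightarrow> real) \<Rightarrow> real"
  assumes "continuous_map (coord_topology I) euclideanreal f"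
  shows "continuous_on UNIV (\<lambda>x. f (restrict x I))"
proof -
  have "continuous_map (product_topology (\<lambda>_. euclideanreal) UNIV) (coord_topology I) (\<lambda>x. restrict x I)"
    unfolding continuous_map_componentwise
  proof (intro conjI ballI)
    fix i assume "i \<in> I"
    then have eq: "(\<lambda>x. restrict x I i) = (\<lambda>x. x i)" by auto
    show "continuous_map (product_topology (\<lambda>_. euclideanreal) UNIV) euclideanreal (\<lambda>x. restrict x I i)"
      unfolding eq by (rule continuous_map_product_projection) simp
  qed auto
  from continuous_map_compose[OF this assms] show ?thesis
    by (simp add: euclidean_product_topology o_def)
qed

lemma continuous_map_imp_borel_measurable:
  assumes "continuous_map (coord_topology I) euclideanreal f"
  shows "f \<in> borel_measurable (coord_borel I)"
proof -
  have "(\<lambda>x. f (restrict x I)) \<in> borel_measurable borel"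
    by (intro borel_measurable_continuous_onI continuous_map_imp_continuous_on_restrict assms)
  then have "(\<lambda>x. f (restrict x I)) \<in> borel_measurable (coord_borel I)"
    by (rule measurable_compose[OF measurable_PiM_into_fun])
  then show ?thesis
    by (rule measurable_cong[THEN iffD1, rotated]) (auto simp: space_PiM PiE_restrict)
qed

lemma tendsto_fun_iff:
  fixes f :: "nat \<Rightarrow> nat \<Rightarrow> real"
  assumes "f \<longlonglongrightarrow> g"
  shows "(\<lambda>k. f k i) \<longlonglongrightarrow> g i"
  using continuous_on_tendsto_compose[OF continuous_on_product_coordinates[of i] assms] by simp

abbreviation free_moment_set :: "(nat \<rightharpoonup> real) \<Rightarrow> nat \<Rightarrow> (nat \<Rightarrow> real) set" where
  "free_moment_set C n \<equiv> (\<lambda>m. restrict m (free_indices C n)) ` constrained_moment_space C n {0..1}"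

lemma free_moment_set_iff:
  assumes C: "moment_constraint C" "last_index C \<le> n"
  shows "y \<in> free_moment_set C n \<longleftrightarrow> y \<in> extensional (free_indices C n) \<and>
    (\<exists>\<mu>\<in>moment_measures {0..1}. \<forall>j\<in>{1..n}. moment \<mu> j = full_moments C y j)" (is "?l \<longleftrightarrow> ?r")
proof
  assume ?l
  then obtain \<mu> where \<mu>: "\<mu> \<in> constrained_measures C {0..1}" "y = restrict (moment_vector n \<mu>) (free_indices C n)"
    unfolding constrained_moment_space_def by auto
  have "moment \<mu> j = full_moments C y j" if "j \<in> {1..n}" for j
    using \<mu> that by (cases "C j") (auto simp: full_moments_def constrained_measures_def free_indices_def moment_vector_def)
  then have "\<forall>j\<in>{1..n}. moment \<mu> j = full_moments C y j" by blast
  moreover have "y \<in> extensional (free_indices C n)" "\<mu> \<in> moment_measures {0..1}"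
    using \<mu> by (simp_all add: constrained_measures_def)
  ultimately show ?r by blast
next
  assume ?r
  then obtain \<mu> where \<mu>: "\<mu> \<in> moment_measures {0..1}" "\<forall>j\<in>{1..n}. moment \<mu> j = full_moments C y j"
    and y: "y \<in> extensional (free_indices C n)" by blast
  have "moment \<mu> i = c" if "C i = Some c" for i c
  proof -
    have "i \<noteq> 0"
    proof
      assume "i = 0"
      then show False using that C(1) by (auto simp: moment_constraint_def)
    qed
    moreover have "i \<le> n" using last_index_ge[OF C(1) domI[where m = C, OF that]] C(2) by simp
    ultimately show ?thesis using \<mu>(2) that by (auto simp: full_moments_def)
  qed
  then have "\<mu> \<in> constrained_measures C {0..1}" using \<mu>(1) by (simp add: constrained_measures_def)
  moreover have "y = restrict (moment_vector n \<mu>) (free_indices C n)"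
  proof
    fix j
    show "y j = restrict (moment_vector n \<mu>) (free_indices C n) j"
    proof (cases "j \<in> free_indices C n")
      case True
      then have "j \<in> {1..n}" "C j = None" by (auto simp: free_indices_def)
      then have "moment \<mu> j = y j" using \<mu>(2) by (simp add: full_moments_def)
      then show ?thesis using True \<open>j \<in> {1..n}\<close> by (simp add: moment_vector_def)
    qed (use y in \<open>simp add: extensional_def\<close>)
  qed
  ultimately show ?l unfolding constrained_moment_space_def by blast
qed

text \<open>The set is an image of a set of measures; its measurability is obtained from closedness,
  which \<open>moment_limit\<close> provides.\<close>

lemma closed_free_moment_set:
  assumes C: "moment_constraint C" "last_index C \<le> n"
  shows "closed (free_moment_set C n)"
  unfolding closed_sequential_limits
proof (intro allI impI)
  fix x y assume a: "(\<forall>k. x k \<in> free_moment_set C n) \<and> x \<longlonglongrightarrow> y"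
  then have x: "\<And>k. x k \<in> extensional (free_indices C n)"
    and "\<And>k. \<exists>\<mu>\<in>moment_measures {0..1}. \<forall>j\<in>{1..n}. moment \<mu> j = full_moments C (x k) j"
    using free_moment_set_iff[OF C] by auto
  then obtain \<mu> where \<mu>: "\<And>k. \<mu> k \<in> moment_measures {0..1}"
    "\<And>k j. j \<in> {1..n} \<Longrightarrow> moment (\<mu> k) j = full_moments C (x k) j" by metis
  have xy: "(\<lambda>k. x k i) \<longlonglongrightarrow> y i" for i using a tendsto_fun_iff by blast
  have "(\<lambda>k. full_moments C (x k) j) \<longlonglongrightarrow> full_moments C y j" for j
    unfolding full_moments_def by (cases "j = 0"; cases "C j") (auto intro: xy)
  then have "\<exists>\<nu>\<in>moment_measures {0..1}. \<forall>j\<in>{1..n}. moment \<nu> j = full_moments C y j"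
    by (intro moment_limit[OF \<mu>(1)]) (simp add: \<mu>(2))
  moreover have "y i = undefined" if "i \<notin> free_indices C n" for i
    using xy[of i] x that by (simp add: extensional_def LIMSEQ_const_iff)
  ultimately show "y \<in> free_moment_set C n"
    unfolding free_moment_set_iff[OF C] by (simp add: extensional_def)
qed

lemma sets_free_moment_set:
  assumes C: "moment_constraint C" "last_index C \<le> n"
  shows "free_moment_set C n \<in> sets (coord_borel (free_indices C n))"
  by (rule closed_imp_sets_PiM[OF closed_free_moment_set[OF C]]) auto

lemma pdef_imp_measure:
  assumes "pdef n (cheb_seq a)" "a 0 = 1"
  shows "bs_measure (cheb_seq a) n \<in> moment_measures {0..1}"
    and "j \<le> n \<Longrightarrow> moment (bs_measure (cheb_seq a) n) j = a j"
proof -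
  note b = bernstein_szego[OF assms(1)]
  show "bs_measure (cheb_seq a) n \<in> moment_measures {0..1}" by (rule b) (simp add: assms)
  show "j \<le> n \<Longrightarrow> moment (bs_measure (cheb_seq a) n) j = a j"
    by (rule cheb_seq_inj[of n]) (rule b(2), simp_all add: assms)
qed

text \<open>Fubini in the last coordinate: for fixed lower moments the discrepancy is contained in
  the finite set of \<open>finite_boundary_fibre\<close>. The index \<open>Suc n\<close> with
  \<open>last_index C \<le> n\<close> guarantees that the last coordinate is free.\<close>

lemma AE_free_moment_set:
  assumes C: "moment_constraint C" "last_index C \<le> n"
  shows "AE y in coord_lebesgue (free_indices C (Suc n)).
    y \<in> free_moment_set C (Suc n) \<longleftrightarrow> pdef (Suc n) (trig_seq C y)"
proof -
  interpret product_sigma_finite "\<lambda>_::nat. lborel :: real measure" by (rule product_sigma_finite_lborel)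
  let ?N = "coord_lebesgue (free_indices C (Suc n))"
  note Sn = free_indices_Suc[OF C]
  have C': "last_index C \<le> Suc n" using C by simp
  define E where "E = {y \<in> space ?N. y \<in> free_moment_set C (Suc n) \<and> \<not> pdef (Suc n) (trig_seq C y)}"
  note [measurable] = measurable_pdef_trig[OF order_refl] sets_free_moment_set[OF C(1) C']
  have [measurable]: "E \<in> sets ?N" unfolding E_def by measurable
  have "emeasure ?N E = (\<integral>\<^sup>+y. indicator E y \<partial>?N)" by simp
  also have "\<dots> = (\<integral>\<^sup>+x. (\<integral>\<^sup>+t. indicator E (x(Suc n := t)) \<partial>lborel) \<partial>coord_lebesgue (free_indices C n))"
    unfolding Sn(1) by (rule product_nn_integral_insert[OF finite_free_indices Sn(2)])
      (use \<open>E \<in> sets ?N\<close> Sn(1) in simp)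
  also have "\<dots> = (\<integral>\<^sup>+x. 0 \<partial>coord_lebesgue (free_indices C n))"
  proof (rule nn_integral_cong)
    fix x
    define T where "T = {t. \<exists>\<mu>\<in>moment_measures {0..1}. (\<forall>j\<in>{1..n}. moment \<mu> j = full_moments C x j) \<and>
      moment \<mu> (Suc n) = t \<and> \<not> pdef (Suc n) (cheb_seq (moment \<mu>))}"
    have "finite T" unfolding T_def by (rule finite_boundary_fibre)
    then have nT: "T \<in> null_sets lborel" by (rule finite_imp_null_set_lborel)
    have "t \<in> T" if t: "x(Suc n := t) \<in> E" for t
    proof -
      let ?y = "x(Suc n := t)"
      obtain \<mu> where \<mu>: "\<mu> \<in> moment_measures {0..1}" "\<forall>j\<in>{1..Suc n}. moment \<mu> j = full_moments C ?y j"
        and np: "\<not> pdef (Suc n) (trig_seq C ?y)"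
        using t unfolding E_def free_moment_set_iff[OF C(1) C'] by blast
      have m: "moment \<mu> j = full_moments C ?y j" if "j \<le> Suc n" for j
        using \<mu> that moment_measures_facts(6)[OF \<mu>(1)] by (cases "j = 0") auto
      have "cheb_seq (moment \<mu>) k = trig_seq C ?y k" if "k \<le> Suc n" for k
        by (rule cheb_seq_cong) (use m that in auto)
      then have "\<not> pdef (Suc n) (cheb_seq (moment \<mu>))"
        using np pdef_cong[of "Suc n" "cheb_seq (moment \<mu>)" "trig_seq C ?y"] by blast
      moreover have "moment \<mu> (Suc n) = t" using m[of "Suc n"] Sn(3) by (simp add: full_moments_def)
      moreover have "moment \<mu> j = full_moments C x j" if "j \<in> {1..n}" for j
      proof -
        have "full_moments C ?y j = full_moments C x j"
          by (rule full_moments_cong[of C n]) (use that Sn(2) in auto)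
        then show ?thesis using m[of j] that by simp
      qed
      ultimately show ?thesis unfolding T_def using \<mu>(1) by blast
    qed
    then have "AE t in lborel. indicator E (x(Suc n := t)) = (0::ennreal)"
      using AE_not_in[OF nT] by (auto elim!: eventually_mono simp: indicator_def)
    then have "(\<integral>\<^sup>+t. indicator E (x(Suc n := t)) \<partial>lborel) = (\<integral>\<^sup>+(t::real). 0 \<partial>lborel)"
      by (rule nn_integral_cong_AE)
    then show "(\<integral>\<^sup>+t. indicator E (x(Suc n := t)) \<partial>lborel) = 0" by simp
  qed
  finally have "emeasure ?N E = 0" by simp
  then have "E \<in> null_sets ?N" by auto
  then have ae: "AE y in ?N. y \<notin> E" by (rule AE_not_in)
  have "y \<in> free_moment_set C (Suc n) \<longleftrightarrow> pdef (Suc n) (trig_seq C y)" if "y \<in> space ?N" "y \<notin> E" for y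
  proof
    assume "pdef (Suc n) (trig_seq C y)"
    from pdef_imp_measure[OF this full_moments_0]
    have "\<exists>\<mu>\<in>moment_measures {0..1}. \<forall>j\<in>{1..Suc n}. moment \<mu> j = full_moments C y j"
      by (intro bexI[of _ "bs_measure (trig_seq C y) (Suc n)"] ballI) auto
    then show "y \<in> free_moment_set C (Suc n)"
      unfolding free_moment_set_iff[OF C(1) C'] using that(1) by (simp add: space_PiM PiE_def)
  qed (use that in \<open>auto simp: E_def\<close>)
  then show ?thesis using ae AE_space[of ?N] by (auto elim!: eventually_elim2)
qed

text \<open>The density is the fibre volume, that is \<open>pd_weight_marginal\<close> started with
  q = 0; its constant K cancels against the total volume. As l < n, the last of the n moments is
  free and \<open>AE_free_moment_set\<close> applies.\<close>

lemma uniform_marginal: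
  assumes C: "moment_constraint C" "last_index C \<le> l" and ln: "l < n"
    and int: "integrable (coord_lebesgue (free_indices C l)) (pd_weight C l (n - l))"
    and z: "z = (\<integral>x. pd_weight C l (n - l) x \<partial>coord_lebesgue (free_indices C l))" "z > 0"
  shows "distr (uniform_measure (coord_lebesgue (free_indices C n)) (free_moment_set C n))
      (coord_lebesgue (free_indices C l)) (\<lambda>y. restrict y (free_indices C l)) =
    density (coord_lebesgue (free_indices C l)) (\<lambda>x. ennreal (pd_weight C l (n - l) x / z))"
    (is "distr ?U ?L ?R = density ?L ?w")
proof (rule measure_eqI)
  let ?N = "coord_lebesgue (free_indices C n)"
  have Cn: "last_index C \<le> n" using C ln by simp
  have sub: "free_indices C l \<subseteq> free_indices C n" using ln by (auto simp: free_indices_def)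
  note [measurable] = sets_free_moment_set[OF C(1) Cn]
  have R[measurable]: "?R \<in> measurable ?N ?L" by (rule measurable_restrict_subset[OF sub])
  obtain K where K: "0 < K" "K < \<infinity>" "\<And>g. g \<in> borel_measurable ?L \<Longrightarrow>
    (\<integral>\<^sup>+y. g (?R y) * ennreal (pd_weight C n 0 y) \<partial>?N) = K * (\<integral>\<^sup>+x. g x * ennreal (pd_weight C l (n - l) x) \<partial>?L)"
    using pd_weight_marginal[OF C less_imp_le[OF ln], of 0] by auto
  obtain m where m: "n = Suc m" "last_index C \<le> m" using ln C(2) by (cases n) auto
  have ae: "AE y in ?N. y \<in> free_moment_set C n \<longleftrightarrow> pdef n (trig_seq C y)"
    using AE_free_moment_set[OF C(1) m(2)] unfolding m(1) .
  have Zn: "(\<integral>\<^sup>+x. ennreal (pd_weight C l (n - l) x) \<partial>?L) = ennreal z"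
    unfolding z by (rule nn_integral_eq_integral[OF int]) (simp add: pd_weight_nonneg)
  have em: "emeasure ?N (free_moment_set C n \<inter> (?R -` A \<inter> space ?N)) =
      K * (\<integral>\<^sup>+x. indicator A x * ennreal (pd_weight C l (n - l) x) \<partial>?L)"
    if A[measurable]: "A \<in> sets ?L" for A
  proof -
    have [measurable]: "?R -` A \<inter> space ?N \<in> sets ?N" by (rule measurable_sets[OF R A])
    have "emeasure ?N (free_moment_set C n \<inter> (?R -` A \<inter> space ?N)) =
      (\<integral>\<^sup>+y. indicator (free_moment_set C n \<inter> (?R -` A \<inter> space ?N)) y \<partial>?N)"
      by (subst nn_integral_indicator) simp_all
    also have "\<dots> = (\<integral>\<^sup>+y. indicator A (?R y) * ennreal (pd_weight C n 0 y) \<partial>?N)"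
      using ae AE_space[of ?N]
      by (intro nn_integral_cong_AE) (auto elim!: eventually_elim2 simp: indicator_def pd_weight_def)
    also have "\<dots> = K * (\<integral>\<^sup>+x. indicator A x * ennreal (pd_weight C l (n - l) x) \<partial>?L)"
      by (rule K(3)) measurable
    finally show ?thesis .
  qed
  have tot: "emeasure ?N (free_moment_set C n) = K * ennreal z"
  proof -
    have "free_moment_set C n \<inter> (?R -` space ?L \<inter> space ?N) = free_moment_set C n"
      using sets.sets_into_space[OF sets_free_moment_set[OF C(1) Cn]] measurable_space[OF R]
      by (auto simp: space_PiM)
    moreover have "(\<integral>\<^sup>+x. indicator (space ?L) x * ennreal (pd_weight C l (n - l) x) \<partial>?L) = ennreal z"
      unfolding Zn[symmetric] by (intro nn_integral_cong) simp
    ultimately show ?thesis using em[of "space ?L"] by simp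
  qed
  show "sets (distr ?U ?L ?R) = sets (density ?L ?w)" by simp
  fix A assume "A \<in> sets (distr ?U ?L ?R)"
  then have A[measurable]: "A \<in> sets ?L" by simp
  have [measurable]: "?R -` A \<inter> space ?N \<in> sets ?N" by (rule measurable_sets[OF R A])
  have "emeasure (distr ?U ?L ?R) A = emeasure ?U (?R -` A \<inter> space ?N)"
    by (subst emeasure_distr) auto
  also have "\<dots> = emeasure ?N (free_moment_set C n \<inter> (?R -` A \<inter> space ?N)) / emeasure ?N (free_moment_set C n)"
    by (rule emeasure_uniform_measure) measurable
  also have "\<dots> = ((\<integral>\<^sup>+x. indicator A x * ennreal (pd_weight C l (n - l) x) \<partial>?L) * K) / (ennreal z * K)"
    by (simp only: em[OF A] tot mult.commute)
  also have "\<dots> = (\<integral>\<^sup>+x. indicator A x * ennreal (pd_weight C l (n - l) x) \<partial>?L) / ennreal z"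
    by (rule divide_mult_eq) (use K in auto)
  also have "\<dots> = (\<integral>\<^sup>+x. indicator A x * ennreal (pd_weight C l (n - l) x) / ennreal z \<partial>?L)"
    by (rule nn_integral_divide[symmetric]) measurable
  also have "\<dots> = (\<integral>\<^sup>+x. ennreal (pd_weight C l (n - l) x / z) * indicator A x \<partial>?L)"
    using z(2) by (intro nn_integral_cong) (auto simp: indicator_def divide_ennreal pd_weight_nonneg)
  also have "\<dots> = emeasure (density ?L ?w) A"
    by (rule emeasure_density[symmetric]) measurable
  finally show "emeasure (distr ?U ?L ?R) A = emeasure (density ?L ?w) A" .
qed

lemma measurable_affine_full_moments:
  assumes "l \<le> n"
  shows "(\<lambda>x. \<lambda>j\<in>{1..l}. s * (full_moments C x j - b j)) \<in> measurable (coord_borel (free_indices C n)) (coord_borel {1..l})"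
  by (rule measurable_restrict)
    (use assms in \<open>auto intro!: borel_measurable_times borel_measurable_diff measurable_full_moments\<close>)

lemma uniform_moments_expectation:
  fixes f :: "(nat \<Rightarrow> real) \<Rightarrow> real"
  assumes C: "moment_constraint C" "last_index C \<le> l" and ln: "l < n"
    and int: "integrable (coord_lebesgue (free_indices C l)) (pd_weight C l (n - l))"
    and z: "z = (\<integral>x. pd_weight C l (n - l) x \<partial>coord_lebesgue (free_indices C l))" "z > 0"
    and f: "f \<in> borel_measurable (coord_borel {1..l})"
  shows "(\<integral>x. f x \<partial>distr (uniform_moments C n) (coord_borel {1..l}) (\<lambda>m. \<lambda>j\<in>{1..l}. s * (m j - b j))) =
    (\<integral>x. pd_weight C l (n - l) x * f (\<lambda>j\<in>{1..l}. s * (full_moments C x j - b j)) \<partial>coord_lebesgue (free_indices C l)) / z"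
proof -
  let ?N = "coord_lebesgue (free_indices C n)" and ?L = "coord_lebesgue (free_indices C l)"
  let ?U = "uniform_measure ?N (free_moment_set C n)"
  let ?R = "\<lambda>y. restrict y (free_indices C l)"
  let ?F = "\<lambda>m. \<lambda>j\<in>{1..l}. s * (m j - b j)"
  let ?G = "\<lambda>x. \<lambda>j\<in>{1..l}. s * (full_moments C x j - b j)"
  have sub: "free_indices C l \<subseteq> free_indices C n" using ln by (auto simp: free_indices_def)
  have R[measurable]: "?R \<in> measurable ?N ?L" by (rule measurable_restrict_subset[OF sub])
  have F[measurable]: "?F \<in> measurable (coord_borel {1..n}) (coord_borel {1..l})"
    by (rule measurable_restrict) (use ln in auto)
  \<comment> \<open>Written in the affine shape with factor 1 and shift 0 so that
    \<open>measurable_affine_full_moments\<close> covers it.\<close>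
  have fill: "fill_in C n = (\<lambda>y. \<lambda>j\<in>{1..n}. 1 * (full_moments C y j - 0))"
    by (intro ext) (auto simp: fill_in_def full_moments_def restrict_def)
  have fm[measurable]: "fill_in C n \<in> measurable ?N (coord_borel {1..n})"
    unfolding fill using measurable_affine_full_moments[OF order_refl] by measurable
  have G[measurable]: "?G \<in> measurable ?L (coord_borel {1..l})"
    using measurable_affine_full_moments[OF order_refl] by measurable
  have comp: "?F (fill_in C n y) = ?G (?R y)" for y
  proof
    fix j show "?F (fill_in C n y) j = ?G (?R y) j"
    proof (cases "j \<in> {1..l}")
      case True
      then have "full_moments C (?R y) j = full_moments C y j"
        by (intro full_moments_cong[of C l]) auto
      then show ?thesis using True ln by (simp add: fill_in_def full_moments_def)
    qed auto
  qed
  have "distr (uniform_moments C n) (coord_borel {1..l}) ?F = distr ?U (coord_borel {1..l}) (?F \<circ> fill_in C n)"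
    unfolding uniform_moments_def by (rule distr_distr[OF F]) (use fm in simp)
  also have "?F \<circ> fill_in C n = ?G \<circ> ?R" using comp by (simp add: fun_eq_iff)
  also have "distr ?U (coord_borel {1..l}) (?G \<circ> ?R) = distr (distr ?U ?L ?R) (coord_borel {1..l}) ?G"
    by (rule distr_distr[OF G, symmetric]) (use R in simp)
  also have "distr ?U ?L ?R = density ?L (\<lambda>x. ennreal (pd_weight C l (n - l) x / z))"
    by (rule uniform_marginal[OF C ln int z])
  finally have "(\<integral>x. f x \<partial>distr (uniform_moments C n) (coord_borel {1..l}) ?F) =
      (\<integral>x. f x \<partial>distr (density ?L (\<lambda>x. ennreal (pd_weight C l (n - l) x / z))) (coord_borel {1..l}) ?G)"
    by (simp only:)
  also have "\<dots> = (\<integral>x. f (?G x) \<partial>density ?L (\<lambda>x. ennreal (pd_weight C l (n - l) x / z)))"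
    by (rule integral_distr) (use f in measurable)
  also have "\<dots> = (\<integral>x. (pd_weight C l (n - l) x / z) *\<^sub>R f (?G x) \<partial>?L)"
  proof (rule integral_density)
    show "(\<lambda>x. f (?G x)) \<in> borel_measurable ?L" using measurable_compose[OF G f] .
  qed (use z in \<open>auto simp: pd_weight_nonneg\<close>)
  also have "\<dots> = (\<integral>x. pd_weight C l (n - l) x * f (?G x) \<partial>?L) / z"
    by (simp add: integral_divide_zero[symmetric] del: integral_divide_zero)
  finally show ?thesis .
qed

section \<open>Affine substitutions\<close>

lemma nn_integral_PiM_affine:
  assumes "finite I" "s > 0" "h \<in> borel_measurable (coord_lebesgue I)"
  shows "(\<integral>\<^sup>+x. h x \<partial>coord_lebesgue I) =
    ennreal (s ^ card I) * (\<integral>\<^sup>+u. h (\<lambda>i\<in>I. a i + s * u i) \<partial>coord_lebesgue I)"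
  using assms(1,3)
proof (induction I arbitrary: h rule: finite_induct)
  case empty
  have e: "Pi\<^sub>M {} (\<lambda>_. lborel :: real measure) = count_space {\<lambda>_. undefined}" by (rule PiM_empty)
  show ?case unfolding e by (simp add: nn_integral_count_space_finite restrict_def)
next
  case (insert k I)
  interpret product_sigma_finite "\<lambda>_::nat. lborel :: real measure" by (rule product_sigma_finite_lborel)
  note [measurable] = insert.prems
  have T: "(\<lambda>u. \<lambda>i\<in>J. a i + s * u i) \<in> measurable (coord_lebesgue J) (coord_lebesgue J)" for J
    by (rule measurable_restrict) auto
  have upd: "(\<lambda>p. (fst p)(k := snd p)) \<in> measurable (coord_lebesgue I \<Otimes>\<^sub>M lborel) (coord_lebesgue (insert k I))"
    by (rule measurable_fun_upd[where J = I]) auto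
  have hupd: "(\<lambda>p. h ((fst p)(k := snd p))) \<in> borel_measurable (coord_lebesgue I \<Otimes>\<^sub>M lborel)"
    by (rule measurable_compose[OF upd insert.prems])
  have hy: "(\<lambda>y. h (x(k := y))) \<in> borel_measurable borel" if "x \<in> space (coord_lebesgue I)" for x
    using measurable_compose[OF measurable_Pair1'[OF that] hupd] by simp
  define H where "H x = (\<integral>\<^sup>+y. h (x(k := a k + s * y)) \<partial>lborel)" for x
  have H: "H \<in> borel_measurable (coord_lebesgue I)"
  proof -
    have "(\<lambda>p. h ((fst p)(k := a k + s * snd p))) \<in> borel_measurable (coord_lebesgue I \<Otimes>\<^sub>M lborel)"
    proof -
      have "(\<lambda>p. (fst p, a k + s * snd p)) \<in> measurable (coord_lebesgue I \<Otimes>\<^sub>M lborel) (coord_lebesgue I \<Otimes>\<^sub>M lborel)"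
        by measurable
      from measurable_compose[OF this hupd] show ?thesis by simp
    qed
    then show ?thesis unfolding H_def
      using lborel.borel_measurable_nn_integral_fst[of "\<lambda>p. h ((fst p)(k := a k + s * snd p))" "coord_lebesgue I"] by simp
  qed
  have "(\<integral>\<^sup>+x. h x \<partial>coord_lebesgue (insert k I)) = (\<integral>\<^sup>+x. (\<integral>\<^sup>+y. h (x(k := y)) \<partial>lborel) \<partial>coord_lebesgue I)"
    by (rule product_nn_integral_insert[OF insert.hyps insert.prems])
  also have "\<dots> = (\<integral>\<^sup>+x. ennreal s * H x \<partial>coord_lebesgue I)"
    unfolding H_def using assms(2)
    by (intro nn_integral_cong) (subst nn_integral_real_affine[of _ s "a k"], auto intro!: hy)
  also have "\<dots> = ennreal s * (\<integral>\<^sup>+x. H x \<partial>coord_lebesgue I)"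
    by (rule nn_integral_cmult[OF H])
  also have "\<dots> = ennreal s * (ennreal (s ^ card I) * (\<integral>\<^sup>+u. H (\<lambda>i\<in>I. a i + s * u i) \<partial>coord_lebesgue I))"
    by (simp only: insert.IH[OF H])
  also have "\<dots> = ennreal (s ^ card (insert k I)) * (\<integral>\<^sup>+u. H (\<lambda>i\<in>I. a i + s * u i) \<partial>coord_lebesgue I)"
    using insert.hyps assms(2) by (simp add: ennreal_mult mult.assoc)
  also have "(\<integral>\<^sup>+u. H (\<lambda>i\<in>I. a i + s * u i) \<partial>coord_lebesgue I) =
      (\<integral>\<^sup>+u. h (\<lambda>i\<in>insert k I. a i + s * u i) \<partial>coord_lebesgue (insert k I))"
  proof -
    have e: "(\<lambda>i\<in>I. a i + s * u i)(k := a k + s * y) = (\<lambda>i\<in>insert k I. a i + s * (u(k := y)) i)" for u y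
      using insert.hyps by (auto simp: fun_eq_iff)
    have "(\<integral>\<^sup>+u. h (\<lambda>i\<in>insert k I. a i + s * u i) \<partial>coord_lebesgue (insert k I)) =
      (\<integral>\<^sup>+u. (\<integral>\<^sup>+y. h (\<lambda>i\<in>insert k I. a i + s * (u(k := y)) i) \<partial>lborel) \<partial>coord_lebesgue I)"
      by (rule product_nn_integral_insert[OF insert.hyps measurable_compose[OF T insert.prems]])
    then show ?thesis by (simp only: H_def e)
  qed
  finally show ?case .
qed

lemma integral_PiM_affine:
  fixes f :: "(nat \<Rightarrow> real) \<Rightarrow> real"
  assumes "finite I" "s > 0" and f: "f \<in> borel_measurable (coord_lebesgue I)"
  shows "(\<integral>x. f x \<partial>coord_lebesgue I) = s ^ card I * (\<integral>u. f (\<lambda>i\<in>I. a i + s * u i) \<partial>coord_lebesgue I)"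
    and "integrable (coord_lebesgue I) (\<lambda>u. f (\<lambda>i\<in>I. a i + s * u i)) \<Longrightarrow> integrable (coord_lebesgue I) f"
proof -
  let ?L = "coord_lebesgue I" and ?T = "\<lambda>u. \<lambda>i\<in>I. a i + s * u i"
  have T[measurable]: "?T \<in> measurable ?L ?L" by (rule measurable_restrict) auto
  \<comment> \<open>Lebesgue measure is a multiple of its own image under the affine map; this form
    transfers integrals of signed functions and integrability alike.\<close>
  have eq: "?L = density (distr ?L ?L ?T) (\<lambda>_. ennreal (s ^ card I))"
  proof (rule measure_eqI)
    fix A assume A: "A \<in> sets ?L"
    then have "emeasure ?L A = (\<integral>\<^sup>+x. indicator A x \<partial>?L)" by simp
    also have "\<dots> = ennreal (s ^ card I) * (\<integral>\<^sup>+u. indicator A (?T u) \<partial>?L)"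
      by (rule nn_integral_PiM_affine[OF assms(1,2)]) (use A in simp)
    also have "(\<integral>\<^sup>+u. indicator A (?T u) \<partial>?L) = (\<integral>\<^sup>+x. indicator A x \<partial>distr ?L ?L ?T)"
      by (rule nn_integral_distr[OF T, symmetric]) (use A in simp)
    also have "ennreal (s ^ card I) * \<dots> = emeasure (density (distr ?L ?L ?T) (\<lambda>_. ennreal (s ^ card I))) A"
      using A by (subst emeasure_density) (auto simp: nn_integral_cmult)
    finally show "emeasure ?L A = emeasure (density (distr ?L ?L ?T) (\<lambda>_. ennreal (s ^ card I))) A" .
  qed simp
  have fT: "f \<in> borel_measurable (distr ?L ?L ?T)" using f by simp
  have "(\<integral>x. f x \<partial>?L) = (\<integral>x. f x \<partial>density (distr ?L ?L ?T) (\<lambda>_. ennreal (s ^ card I)))"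
    using eq by simp
  also have "\<dots> = (\<integral>x. s ^ card I *\<^sub>R f x \<partial>distr ?L ?L ?T)"
    by (rule integral_density) (use fT assms(2) in auto)
  also have "\<dots> = (\<integral>u. s ^ card I *\<^sub>R f (?T u) \<partial>?L)"
    by (rule integral_distr[OF T]) (use f in simp)
  finally show "(\<integral>x. f x \<partial>?L) = s ^ card I * (\<integral>u. f (?T u) \<partial>?L)" by simp
  assume i: "integrable ?L (\<lambda>u. f (?T u))"
  have "integrable (distr ?L ?L ?T) f" by (subst integrable_distr_eq[OF T]) (use i f in simp_all)
  then have "integrable (density (distr ?L ?L ?T) (\<lambda>_. ennreal (s ^ card I))) f"
    by (subst integrable_density) (use fT assms(2) in auto)
  then show "integrable ?L f" using eq by simp
qed

section \<open>The entropy minimizer\<close>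

text \<open>Integrate \<open>ln (h / P) \<ge> 1 - P / h\<close> against the arcsine law, where \<open>h\<close> is its density
  with respect to \<open>\<nu>\<close>.\<close>

lemma kullback_min:
  assumes Ppos: "\<And>x. x \<in> {0..1} \<Longrightarrow> poly P x > 0"
    and \<mu>: "\<mu> = density arcsine (\<lambda>x. ennreal (1 / poly P x))" "\<mu> \<in> moment_measures {0..1}"
    and \<nu>: "\<nu> \<in> moment_measures {0..1}" "(\<integral>x. poly P x \<partial>\<nu>) = 1"
  shows "kullback arcsine \<mu> \<le> kullback arcsine \<nu>"
    and "kullback arcsine \<nu> \<le> kullback arcsine \<mu> \<Longrightarrow> \<nu> = \<mu>"
proof -
  interpret A: prob_space arcsine by (rule prob_space_arcsine)
  note AE01 = AE_arcsine
  have int_lnP: "integrable arcsine (\<lambda>x. ln (poly P x))"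
    by (rule arcsine_integral) (auto intro!: continuous_intros dest: Ppos)
  have log_exp: "log (exp 1) x = ln x" for x by (simp add: log_def)
  define E where "E = (\<integral>x. ln (poly P x) \<partial>arcsine)"
  have KL_\<mu>: "kullback arcsine \<mu> = ereal E"
  proof -
    interpret M: prob_space \<mu> by (rule moment_measures_facts(1)[OF \<mu>(2)])
    have s: "sets \<mu> = sets borel" by (rule moment_measures_facts(2)[OF \<mu>(2)])
    have [measurable_cong]: "sets \<mu> = sets borel" by (rule s)
    have "density \<mu> (\<lambda>x. ennreal (poly P x)) = density arcsine (\<lambda>x. ennreal (1 / poly P x) * ennreal (poly P x))"
      unfolding \<mu>(1) by (rule density_density_eq) measurable
    also have "\<dots> = density arcsine (\<lambda>_. 1)"
    proof (rule density_cong)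
      show "AE x in arcsine. ennreal (1 / poly P x) * ennreal (poly P x) = 1"
        using AE01 by eventually_elim (use Ppos in \<open>simp add: ennreal_mult[symmetric] less_imp_le less_imp_neq[symmetric]\<close>)
    qed measurable
    also have "\<dots> = arcsine" by (rule density_1)
    finally have dens: "density \<mu> (\<lambda>x. ennreal (poly P x)) = arcsine" .
    have "AE x in \<mu>. ennreal (poly P x) = RN_deriv \<mu> arcsine x"
      by (rule M.RN_deriv_unique[OF _ dens]) measurable
    then have "AE x in density \<mu> (\<lambda>x. ennreal (poly P x)). ennreal (poly P x) = RN_deriv \<mu> arcsine x"
      by (subst AE_density) (measurable, auto elim: eventually_mono)
    then have ae: "AE x in arcsine. entropy_density (exp 1) \<mu> arcsine x = ln (poly P x)"
      unfolding dens using AE01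
    proof eventually_elim
      case (elim x)
      have "poly P x > 0" using Ppos elim(2) by blast
      then show ?case using elim(1)[symmetric] by (simp add: entropy_density_def log_exp)
    qed
    have ac: "absolutely_continuous \<mu> arcsine"
      unfolding dens[symmetric] by (rule absolutely_continuousI_density) measurable
    have [measurable]: "entropy_density (exp 1) \<mu> arcsine \<in> borel_measurable arcsine"
      unfolding entropy_density_def by measurable
    have "integrable arcsine (entropy_density (exp 1) \<mu> arcsine)"
      by (subst integrable_cong_AE[OF _ _ ae]) (auto intro: int_lnP)
    moreover have "KL_divergence (exp 1) \<mu> arcsine = E"
      unfolding KL_divergence_def E_def by (rule integral_cong_AE[OF _ _ ae]) measurable
    ultimately show ?thesis using ac by (simp add: kullback_def)
  qed
  have main: "E \<le> KL_divergence (exp 1) \<nu> arcsine \<and> (KL_divergence (exp 1) \<nu> arcsine \<le> E \<longrightarrow> \<nu> = \<mu>)"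
    if ac: "absolutely_continuous \<nu> arcsine" and inte: "integrable arcsine (entropy_density (exp 1) \<nu> arcsine)"
  proof -
    note f = moment_measures_facts[OF \<nu>(1)]
    interpret N: prob_space \<nu> by (rule f)
    have [measurable_cong]: "sets \<nu> = sets borel" by (rule f)
    define h where "h x = enn2real (RN_deriv \<nu> arcsine x)" for x
    have [measurable]: "h \<in> borel_measurable borel"
      using borel_measurable_RN_deriv[of \<nu> arcsine] f(2) unfolding h_def by (simp cong: measurable_cong_sets)
    have h0: "h x \<ge> 0" for x by (simp add: h_def)
    have "AE x in \<nu>. RN_deriv \<nu> arcsine x \<noteq> \<infinity>"
      by (rule N.RN_deriv_finite[OF _ ac]) (auto simp: f(2) A.sigma_finite_measure_axioms)
    then have hae: "AE x in \<nu>. RN_deriv \<nu> arcsine x = ennreal (h x)"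
      by eventually_elim (simp add: h_def less_top)
    have dens: "arcsine = density \<nu> (\<lambda>x. ennreal (h x))"
    proof -
      have "density \<nu> (RN_deriv \<nu> arcsine) = arcsine" by (rule N.density_RN_deriv[OF ac]) (simp add: f(2))
      moreover have "density \<nu> (RN_deriv \<nu> arcsine) = density \<nu> (\<lambda>x. ennreal (h x))"
        by (rule density_cong[OF _ _ hae]) measurable
      ultimately show ?thesis by simp
    qed
    have hpos: "AE x in arcsine. h x > 0"
      by (subst dens, subst AE_density) auto
    have Pnn: "AE x in \<nu>. poly P x > 0" using f(4) by eventually_elim (rule Ppos)
    have "(\<integral>\<^sup>+x. ennreal (poly P x / h x) \<partial>arcsine) = (\<integral>\<^sup>+x. ennreal (h x) * ennreal (poly P x / h x) \<partial>\<nu>)"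
      by (subst dens, subst nn_integral_density) auto
    also have "\<dots> = (\<integral>\<^sup>+x. ennreal (poly P x * indicator {x. h x > 0} x) \<partial>\<nu>)"
      by (rule nn_integral_cong_AE, use Pnn in eventually_elim)
        (use h0 in \<open>auto simp: indicator_def ennreal_mult[symmetric] less_le\<close>)
    finally have nnP: "(\<integral>\<^sup>+x. ennreal (poly P x / h x) \<partial>arcsine) = (\<integral>\<^sup>+x. ennreal (poly P x * indicator {x. h x > 0} x) \<partial>\<nu>)" .
    have intP: "integrable \<nu> (poly P)" by (rule f)
    have intPi: "integrable \<nu> (\<lambda>x. poly P x * indicator {x. h x > 0} x)"
      by (rule Bochner_Integration.integrable_bound[OF intP]) (auto simp: indicator_def)
    \<comment> \<open>The measure \<nu> may charge the set where \<open>h\<close> vanishes, which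
      the arcsine law does not see, so an inequality is all that holds in general.\<close>
    have PiL: "(\<integral>x. poly P x * indicator {x. h x > 0} x \<partial>\<nu>) \<le> 1"
      unfolding \<nu>(2)[symmetric]
      by (rule integral_mono_AE[OF intPi intP], use Pnn in eventually_elim) (auto simp: indicator_def)
    have nnP': "(\<integral>\<^sup>+x. ennreal (poly P x / h x) \<partial>arcsine) = ennreal (\<integral>x. poly P x * indicator {x. h x > 0} x \<partial>\<nu>)"
      unfolding nnP by (rule nn_integral_eq_integral[OF intPi], use Pnn in eventually_elim) (auto simp: indicator_def)
    have Ph_nn: "AE x in arcsine. poly P x / h x \<ge> 0"
      using AE01 hpos by eventually_elim (use Ppos in \<open>simp add: less_imp_le\<close>)
    have Phi: "integrable arcsine (\<lambda>x. poly P x / h x)"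
      by (rule integrableI_nonneg) (use Ph_nn nnP' in auto)
    have PhE: "(\<integral>x. poly P x / h x \<partial>arcsine) = (\<integral>x. poly P x * indicator {x. h x > 0} x \<partial>\<nu>)"
    proof -
      have "(\<integral>x. poly P x * indicator {x. h x > 0} x \<partial>\<nu>) \<ge> 0"
        by (rule integral_nonneg_AE, use Pnn in eventually_elim) (auto simp: indicator_def)
      then show ?thesis using nn_integral_eq_integral[OF Phi Ph_nn] nnP'
        by (simp add: integral_nonneg_AE[OF Ph_nn])
    qed
    have ed: "entropy_density (exp 1) \<nu> arcsine x = ln (h x)" for x
      by (simp add: entropy_density_def log_exp h_def)
    have inth: "integrable arcsine (\<lambda>x. ln (h x))" using inte by (simp add: ed[abs_def])
    have KL: "KL_divergence (exp 1) \<nu> arcsine = (\<integral>x. ln (h x) \<partial>arcsine)"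
      by (simp add: KL_divergence_def ed[abs_def])
    \<comment> \<open>With t = P / h this is t - 1 - ln t, nonnegative and zero only at t =
      1.\<close>
    define D where "D x = ln (h x) - ln (poly P x) - (1 - poly P x / h x)" for x
    have Dpos: "AE x in arcsine. D x \<ge> 0 \<and> (D x = 0 \<longrightarrow> h x = poly P x)"
      using AE01 hpos
    proof eventually_elim
      case (elim x)
      have p: "poly P x > 0" by (rule Ppos[OF elim(1)])
      define t where "t = poly P x / h x"
      have t: "t > 0" using p elim by (simp add: t_def)
      have Dt: "D x = t - 1 - ln t" using p elim by (simp add: D_def t_def ln_div)
      have "D x \<ge> 0" using ln_le_minus_one[OF t] by (simp add: Dt)
      moreover have "t = 1" if "D x = 0" using ln_eq_minus_one[OF t] that by (simp add: Dt)
      ultimately show ?case using elim by (auto simp: t_def)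
    qed
    have i1: "integrable arcsine (\<lambda>x. ln (h x) - ln (poly P x))"
      by (rule Bochner_Integration.integrable_diff[OF inth int_lnP])
    have i2: "integrable arcsine (\<lambda>x. 1 - poly P x / h x)"
      by (rule Bochner_Integration.integrable_diff[OF A.integrable_const Phi])
    have intD: "integrable arcsine D"
      unfolding D_def by (rule Bochner_Integration.integrable_diff[OF i1 i2])
    have "(\<integral>x. D x \<partial>arcsine) = (\<integral>x. ln (h x) - ln (poly P x) \<partial>arcsine) - (\<integral>x. 1 - poly P x / h x \<partial>arcsine)"
      unfolding D_def by (rule Bochner_Integration.integral_diff[OF i1 i2])
    also have "(\<integral>x. ln (h x) - ln (poly P x) \<partial>arcsine) = KL_divergence (exp 1) \<nu> arcsine - E"
      unfolding KL E_def by (rule Bochner_Integration.integral_diff[OF inth int_lnP])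
    also have "(\<integral>x. 1 - poly P x / h x \<partial>arcsine) = (\<integral>x. 1 \<partial>arcsine) - (\<integral>x. poly P x / h x \<partial>arcsine)"
      by (rule Bochner_Integration.integral_diff[OF A.integrable_const Phi])
    also have "(\<integral>x. 1 \<partial>arcsine) = (1 :: real)" using A.prob_space by simp
    finally have ID: "(\<integral>x. D x \<partial>arcsine) = KL_divergence (exp 1) \<nu> arcsine - E - (1 - (\<integral>x. poly P x * indicator {x. h x > 0} x \<partial>\<nu>))"
      by (simp only: PhE)
    have D_nn: "AE x in arcsine. 0 \<le> D x" using Dpos by eventually_elim simp
    then have ID0: "(\<integral>x. D x \<partial>arcsine) \<ge> 0" by (rule integral_nonneg_AE)
    show ?thesis
    proof (intro conjI impI)
      show "E \<le> KL_divergence (exp 1) \<nu> arcsine" using ID ID0 PiL by linarith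
      assume le: "KL_divergence (exp 1) \<nu> arcsine \<le> E"
      have D0: "(\<integral>x. D x \<partial>arcsine) = 0" and P1: "(\<integral>x. poly P x * indicator {x. h x > 0} x \<partial>\<nu>) = 1"
        using ID ID0 PiL le by linarith+
      have "AE x in arcsine. D x = 0"
        using integral_nonneg_eq_0_iff_AE[OF intD D_nn] D0 by simp
      then have "AE x in arcsine. h x = poly P x" using Dpos by eventually_elim blast
      then have "AE x in density \<nu> (\<lambda>x. ennreal (h x)). h x = poly P x" by (simp only: dens[symmetric])
      then have e1: "AE x in \<nu>. h x > 0 \<longrightarrow> h x = poly P x" by (subst (asm) AE_density) auto
      \<comment> \<open>Equality also excludes \<nu>-mass on {h = 0}, since P is positive
        there.\<close>
      have "(\<integral>x. poly P x - poly P x * indicator {x. h x > 0} x \<partial>\<nu>) = 0"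
        using P1 \<nu>(2) by (simp add: Bochner_Integration.integral_diff intP intPi)
      moreover have "integrable \<nu> (\<lambda>x. poly P x - poly P x * indicator {x. h x > 0} x)"
        by (intro Bochner_Integration.integrable_diff intP intPi)
      moreover have "AE x in \<nu>. 0 \<le> poly P x - poly P x * indicator {x. h x > 0} x"
        using Pnn by eventually_elim (auto simp: indicator_def)
      ultimately have "AE x in \<nu>. poly P x - poly P x * indicator {x. h x > 0} x = 0"
        using integral_nonneg_eq_0_iff_AE by blast
      then have hP: "AE x in \<nu>. h x = poly P x \<and> poly P x > 0"
        using e1 Pnn by eventually_elim (auto simp: indicator_def split: if_splits)
      have "\<mu> = density (density \<nu> (\<lambda>x. ennreal (h x))) (\<lambda>x. ennreal (1 / poly P x))"
        by (subst \<mu>(1), subst dens) (rule refl)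
      also have "\<dots> = density \<nu> (\<lambda>x. ennreal (h x) * ennreal (1 / poly P x))"
        by (rule density_density_eq) measurable
      also have "\<dots> = density \<nu> (\<lambda>_. 1)"
        by (rule density_cong, measurable, use hP in eventually_elim) (simp add: ennreal_mult[symmetric])
      also have "\<dots> = \<nu>" by (rule density_1)
      finally show "\<nu> = \<mu>" by simp
    qed
  qed
  show "kullback arcsine \<mu> \<le> kullback arcsine \<nu>"
    using main unfolding KL_\<mu> by (simp add: kullback_def)
  show "\<nu> = \<mu>" if "kullback arcsine \<nu> \<le> kullback arcsine \<mu>"
    using main that unfolding KL_\<mu> by (auto simp: kullback_def split: if_splits)
qed

section \<open>The maximizer of the fibre volume\<close>

lemma tform_tendsto:
  assumes "\<And>i. (\<lambda>k. c k i) \<longlonglongrightarrow> d i"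
  shows "(\<lambda>k. tform (c k) p q) \<longlonglongrightarrow> tform d p q"
  unfolding tform_def by (intro tendsto_intros assms)

lemma full_moments_tendsto:
  assumes "\<And>i. (\<lambda>k. y k i) \<longlonglongrightarrow> z i"
  shows "(\<lambda>k. full_moments C (y k) j) \<longlonglongrightarrow> full_moments C z j"
  unfolding full_moments_def by (cases "j = 0"; cases "C j") (auto intro: assms)

lemma trig_seq_tendsto:
  assumes "\<And>i. (\<lambda>k. y k i) \<longlonglongrightarrow> z i"
  shows "(\<lambda>k. trig_seq C (y k) j) \<longlonglongrightarrow> trig_seq C z j"
  unfolding cheb_seq_def by (intro tendsto_intros full_moments_tendsto assms)

text \<open>Tychonoff, with singletons {undefined} as factors off \<open>I\<close>; the maximizing
  sequence gets its convergent subsequence from this.\<close>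

lemma compact_PiE_interval:
  "compact {y :: nat \<Rightarrow> real. y \<in> extensional I \<and> (\<forall>i\<in>I. y i \<in> {0..1})}"
proof -
  let ?S = "\<lambda>i. if i \<in> I then {0..1::real} else {undefined}"
  have "compactin (product_topology (\<lambda>_. euclideanreal) UNIV) (PiE UNIV ?S)"
    by (subst compactin_PiE) auto
  then have "compact (PiE UNIV ?S)" by (simp add: euclidean_product_topology)
  moreover have "PiE UNIV ?S = {y. y \<in> extensional I \<and> (\<forall>i\<in>I. y i \<in> {0..1})}"
    by (auto simp: PiE_def extensional_def Pi_def split: if_splits)
  ultimately show ?thesis by simp
qed

lemma pdef_extend:
  assumes "pdef n (cheb_seq a)" "n \<le> l"
  shows "\<exists>b. (\<forall>j\<le>n. b j = a j) \<and> pdef l (cheb_seq b)"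
  using assms(2)
proof (induction l rule: dec_induct)
  case base
  then show ?case using assms(1) by blast
next
  case (step m)
  then obtain b where b: "\<forall>j\<le>n. b j = a j" "pdef m (cheb_seq b)" by blast
  define \<kappa> r v where "\<kappa> = coeff (cheb (Suc m)) (Suc m)" and "r = opnorm (cheb_seq b) m"
    and "v = verblunsky (cheb_seq b) m"
  have \<kappa>: "\<kappa> \<noteq> 0" unfolding \<kappa>_def by (rule coeff_cheb_top)
  have r: "r > 0" unfolding r_def by (rule pdef_opnorm[OF b(2) order_refl])
  \<comment> \<open>This value of the new moment makes the next coefficient a equal to 0, the
    midpoint of its range.\<close>
  define b' where "b' = b(Suc m := b (Suc m) - v * r / \<kappa>)"
  have low: "cheb_seq b k = cheb_seq b' k" if "k \<le> m" for k
    by (rule cheb_seq_cong) (use that in \<open>auto simp: b'_def\<close>)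
  have "cheb_seq b' (Suc m) - cheb_seq b (Suc m) = \<kappa> * (b' (Suc m) - b (Suc m))"
    unfolding \<kappa>_def by (rule cheb_seq_top) (simp add: b'_def)
  also have "\<dots> = - (v * r)" using \<kappa> by (simp add: b'_def)
  finally have "verblunsky (cheb_seq b') m - v = - v"
    unfolding v_def using verblunsky_diff[of m "cheb_seq b" "cheb_seq b'", OF low] r by (simp add: r_def)
  moreover have "pdef m (cheb_seq b')" using b(2) pdef_cong[of m "cheb_seq b" "cheb_seq b'"] low by blast
  ultimately have "pdef (Suc m) (cheb_seq b')" by (simp add: pdef_Suc_verblunsky)
  moreover have "\<forall>j\<le>n. b' j = a j" using b(1) step by (simp add: b'_def)
  ultimately show ?case by blast
qed

lemma admissible_pdef:
  assumes C: "moment_constraint C" "last_index C \<le> l" and adm: "admissible C {0..1}"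
  shows "\<exists>y\<in>extensional (free_indices C l). pdef l (trig_seq C y)"
proof -
  obtain \<mu> where \<mu>: "\<mu> \<in> constrained_measures C {0..1}" "moment_vector (last_index C) \<mu> \<in>
      coord_topology {1..last_index C} interior_of moment_space (last_index C) {0..1}"
    using adm unfolding admissible_def constrained_moment_space_def by blast
  then have m: "\<mu> \<in> moment_measures {0..1}" by (simp add: constrained_measures_def)
  obtain b where b: "\<And>j. j \<le> last_index C \<Longrightarrow> b j = moment \<mu> j" "pdef l (cheb_seq b)"
    using pdef_extend[OF interior_moment_space_pdef[OF m \<mu>(2)] C(2)] by blast
  define y where "y = restrict b (free_indices C l)"
  have "full_moments C y j = b j" if "j \<le> l" for j
  proof (cases "j \<in> free_indices C l")
    case True
    then show ?thesis using that by (auto simp: full_moments_def y_def free_indices_def split: option.splits)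
  next
    case False
    show ?thesis
    proof (cases "j = 0")
      case True
      then show ?thesis using b(1)[of 0] moment_measures_facts(6)[OF m] by simp
    next
      case nz: False
      then have jd: "j \<in> dom C" using that False by (auto simp: free_indices_def)
      then obtain c where c: "C j = Some c" by blast
      have "b j = moment \<mu> j" by (rule b(1)) (rule last_index_ge[OF C(1) jd])
      also have "\<dots> = c" using \<mu>(1) c by (simp add: constrained_measures_def)
      finally show ?thesis using c nz by (simp add: full_moments_def)
    qed
  qed
  then have "pdef l (trig_seq C y)"
    using b(2) pdef_cong[of l "cheb_seq b" "trig_seq C y"] cheb_seq_cong by (metis le_trans)
  then show ?thesis unfolding y_def by blast
qed

lemma opnorm_le_one:
  assumes "pdef l c" shows "opnorm c l \<le> c 0"
proof -
  have "opnorm c l \<le> tform c (monom 1 l) (monom 1 l)"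
    by (rule opnorm_minimal[OF assms]) (simp_all add: degree_monom_le)
  also have "\<dots> = tform c 1 1" using tform_monom_mult[of c l 1 1] by simp
  finally show ?thesis by (simp add: tform_def)
qed

text \<open>\<open>opnorm\<close> is an infimum of linear functionals, hence upper semicontinuous, and a positive infimum
  forces the limit form to be positive definite.\<close>

lemma exists_maximizer:
  assumes C: "moment_constraint C" "last_index C \<le> l" and adm: "admissible C {0..1}"
  obtains y where "y \<in> extensional (free_indices C l)" "pdef l (trig_seq C y)"
    "\<And>y'. pdef l (trig_seq C y') \<Longrightarrow> opnorm (trig_seq C y') l \<le> opnorm (trig_seq C y) l"
proof -
  let ?I = "free_indices C l"
  define S where "S = {y \<in> extensional ?I. pdef l (trig_seq C y)}"
  define R where "R y = opnorm (trig_seq C y) l" for y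
  obtain y0 where y0: "y0 \<in> S" using admissible_pdef[OF C adm] by (auto simp: S_def)
  have bdd: "bdd_above (R ` S)"
    by (rule bdd_aboveI[of _ 1]) (use opnorm_le_one in \<open>fastforce simp: S_def R_def\<close>)
  define s where "s = Sup (R ` S)"
  have Rs: "R y \<le> s" if "y \<in> S" for y unfolding s_def by (rule cSup_upper) (use that bdd in auto)
  have "R y0 > 0" using y0 pdef_opnorm[of l "trig_seq C y0" l] by (simp add: S_def R_def)
  then have s0: "s > 0" using Rs[OF y0] by linarith
  have "\<exists>y\<in>S. s - 1 / real (Suc k) < R y" for k
  proof -
    have "s - 1 / real (Suc k) < Sup (R ` S)" by (simp add: s_def)
    then show ?thesis using less_cSup_iff[OF _ bdd] y0 by auto
  qed
  then obtain y where y: "\<And>k. y k \<in> S" "\<And>k. s - 1 / real (Suc k) < R (y k)" by metis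
  \<comment> \<open>Bernstein--Szego measures realize these points, so the coordinates are moments
    and lie in [0,1].\<close>
  have "y k \<in> {y. y \<in> extensional ?I \<and> (\<forall>i\<in>?I. y i \<in> {0..1})}" for k
  proof -
    have pd: "pdef l (trig_seq C (y k))" using y(1)[of k] by (simp add: S_def)
    have "y k i \<in> {0..1}" if "i \<in> ?I" for i
    proof -
      have "i \<le> l" "full_moments C (y k) i = y k i" using that by (auto simp: free_indices_def full_moments_def split: option.splits)
      then show ?thesis
        using pdef_imp_measure(2)[OF pd, of i] moment_bounds[OF pdef_imp_measure(1)[OF pd], of i] by simp
    qed
    then show ?thesis using y(1)[of k] by (simp add: S_def)
  qed
  then have mem: "\<forall>k. y k \<in> {y. y \<in> extensional ?I \<and> (\<forall>i\<in>?I. y i \<in> {0..1})}" by blast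
  obtain z t where z: "z \<in> {y. y \<in> extensional ?I \<and> (\<forall>i\<in>?I. y i \<in> {0..1})}"
    and t: "strict_mono t" and lim: "(y \<circ> t) \<longlonglongrightarrow> z"
    by (rule seq_compactE[OF compact_imp_seq_compact[OF compact_PiE_interval] mem])
  have limi: "(\<lambda>k. y (t k) i) \<longlonglongrightarrow> z i" for i
    using tendsto_fun_iff[OF lim] by (simp add: o_def)
  have conv: "(\<lambda>k. tform (trig_seq C (y (t k))) p p) \<longlonglongrightarrow> tform (trig_seq C z) p p" for p
    by (intro tform_tendsto trig_seq_tendsto limi)
  \<comment> \<open>For fixed \<open>p\<close> the form is continuous in the moments, so the
    minimality bound passes to the limit without continuity of \<open>opnorm\<close>.\<close>
  have lb: "s \<le> tform (trig_seq C z) p p" if "degree p \<le> l" "coeff p l = 1" for p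
  proof (rule LIMSEQ_le[OF _ conv])
    have "(\<lambda>k. s - 1 / real (Suc k)) \<longlonglongrightarrow> s - 0"
      by (intro tendsto_intros lim_1_over_n[THEN LIMSEQ_Suc])
    from LIMSEQ_subseq_LIMSEQ[OF this t] show "(\<lambda>k. s - 1 / real (Suc (t k))) \<longlonglongrightarrow> s" by (simp add: o_def)
    have "s - 1 / real (Suc (t k)) \<le> tform (trig_seq C (y (t k))) p p" for k
      using y(2)[of "t k"] opnorm_minimal[OF _ that, of "trig_seq C (y (t k))"] y(1)[of "t k"]
      by (simp add: S_def R_def)
    then show "\<exists>N. \<forall>k\<ge>N. s - 1 / real (Suc (t k)) \<le> tform (trig_seq C (y (t k))) p p" by blast
  qed
  have pd: "pdef l (trig_seq C z)"
    unfolding pdef_def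
  proof (intro allI impI)
    fix p :: "real poly" assume p: "p \<noteq> 0" "degree p \<le> l"
    define a where "a = 1 / lead_coeff p"
    \<comment> \<open>Normalizing to a monic polynomial of degree l changes the form only by the
      factor a^2, since multiplication by z is an isometry.\<close>
    define q where "q = monom 1 (l - degree p) * smult a p"
    have a: "a \<noteq> 0" using p(1) by (simp add: a_def)
    have dq: "degree q = l" using p a by (simp add: q_def degree_mult_eq degree_monom_eq)
    have "lead_coeff q = 1" using p(1) by (simp add: q_def lead_coeff_mult a_def degree_monom_eq)
    then have "s \<le> tform (trig_seq C z) q q" by (intro lb) (simp_all add: dq)
    also have "\<dots> = a * (a * tform (trig_seq C z) p p)" by (simp add: q_def tform_monom_mult tform_linear)
    finally have "a\<^sup>2 * tform (trig_seq C z) p p > 0" using s0 by (simp add: power2_eq_square mult.assoc)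
    then show "tform (trig_seq C z) p p > 0" by (simp add: zero_less_mult_iff)
  qed
  show ?thesis
  proof (rule that[of z])
    show "z \<in> extensional ?I" using z by simp
    show "pdef l (trig_seq C z)" by (rule pd)
    fix y' assume pd': "pdef l (trig_seq C y')"
    define w where "w = restrict y' ?I"
    have e: "trig_seq C y' k = trig_seq C w k" if "k \<le> l" for k
      by (rule trig_seq_cong[OF _ that]) (simp add: w_def)
    have "w \<in> S" using pd' pdef_cong[of l "trig_seq C y'" "trig_seq C w"] e by (auto simp: S_def w_def)
    then have "opnorm (trig_seq C w) l \<le> s" using Rs by (simp add: R_def)
    also have "s \<le> opnorm (trig_seq C z) l" unfolding opnorm_def by (rule lb) simp_all
    finally show "opnorm (trig_seq C y') l \<le> opnorm (trig_seq C z) l"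
      using opnorm_cong[of l "trig_seq C y'" "trig_seq C w"] e by simp
  qed
qed

section \<open>First-order condition and identification of the entropy minimizer\<close>

definition free_dir :: "(nat \<rightharpoonup> real) \<Rightarrow> nat \<Rightarrow> (nat \<Rightarrow> real) \<Rightarrow> nat \<Rightarrow> real" where
  "free_dir C l u = (\<lambda>j. if j \<in> free_indices C l then u j else 0)"

lemma trig_seq_shift:
  assumes "k \<le> l"
  shows "trig_seq C (\<lambda>j. y j + u j) k = trig_seq C y k + cheb_seq (free_dir C l u) k"
proof -
  have "full_moments C (\<lambda>j. y j + u j) j = full_moments C y j + free_dir C l u j" if "j \<le> l" for j
    using that by (auto simp: full_moments_def free_dir_def free_indices_def split: option.splits)
  then have "trig_seq C (\<lambda>j. y j + u j) k = cheb_seq (\<lambda>j. full_moments C y j + free_dir C l u j) k"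
    using assms by (intro cheb_seq_cong) simp
  then show ?thesis by (simp add: cheb_seq_add)
qed

text \<open>If the linear term G were nonzero, moving by \<tau> in the direction of its sign would
  raise the norm by at least \<tau> |G| - 2 \<tau>^2 B, which is positive for small \<tau>. The
  quantitative lower bound takes the place of a derivative.\<close>

lemma maximizer_first_order:
  assumes pd: "pdef l (trig_seq C y)"
    and max: "\<And>y'. pdef l (trig_seq C y') \<Longrightarrow> opnorm (trig_seq C y') l \<le> opnorm (trig_seq C y) l"
  shows "tform (cheb_seq (free_dir C l u)) (opoly (trig_seq C y) l) (opoly (trig_seq C y) l) = 0"
proof (rule ccontr)
  let ?c = "trig_seq C y" and ?d = "cheb_seq (free_dir C l u)"
  define G B where "G = tform ?d (opoly ?c l) (opoly ?c l)" and "B = second_order ?c l ?d"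
  assume "tform ?d (opoly ?c l) (opoly ?c l) \<noteq> 0"
  then have G: "G \<noteq> 0" by (simp add: G_def)
  obtain K where K: "K > 0" "\<And>d M p. \<lbrakk>degree p \<le> l; \<And>k. k \<le> l \<Longrightarrow> \<bar>d k\<bar> \<le> M\<rbrakk> \<Longrightarrow> \<bar>tform d p p\<bar> \<le> K * M * tform ?c p p"
    using pdef_dominates[OF pd] by blast
  define M where "M = (\<Sum>k\<le>l. \<bar>?d k\<bar>)"
  have dM: "\<bar>?d k\<bar> \<le> M" if "k \<le> l" for k unfolding M_def by (rule member_le_sum) (use that in auto)
  have M0: "M \<ge> 0" by (simp add: M_def sum_nonneg)
  have B0: "B \<ge> 0" unfolding B_def by (rule second_order_nonneg[OF pd])
  \<comment> \<open>The first bound makes the relative size K \<tau> M at most 1/2, so the quadratic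
    term costs at most 2 \<tau>^2 B; the second makes 2 \<tau> B smaller than |G|. The added ones
    keep the denominators positive.\<close>
  define \<tau> where "\<tau> = min (1 / (2 * K * M + 1)) (\<bar>G\<bar> / (4 * B + 1))"
  have \<tau>: "\<tau> > 0" "\<tau> \<le> 1 / (2 * K * M + 1)" "\<tau> \<le> \<bar>G\<bar> / (4 * B + 1)"
    using G B0 M0 K(1) by (auto simp: \<tau>_def intro!: divide_pos_pos add_nonneg_pos)
  define s where "s = sgn G * \<tau>"
  have s: "\<bar>s\<bar> = \<tau>" "s * G = \<tau> * \<bar>G\<bar>" using G \<tau> by (auto simp: s_def abs_mult sgn_real_def)
  have "K * (\<tau> * M) \<le> 1 / 2"
  proof -
    have "2 * (K * (\<tau> * M)) \<le> \<tau> * (2 * K * M + 1)" using \<tau>(1) by (simp add: algebra_simps)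
    also have "\<dots> \<le> 1" using \<tau>(2) K(1) M0 by (simp add: pos_le_divide_eq add_nonneg_pos)
    finally show ?thesis by simp
  qed
  moreover have "0 \<le> K * (\<tau> * M)" using K(1) M0 \<tau>(1) by simp
  ultimately have L: "0 \<le> K * (\<tau> * M)" "K * (\<tau> * M) < 1" "1 - K * (\<tau> * M) \<ge> 1 / 2" by auto
  define d where "d k = s * ?d k" for k
  have dom: "\<bar>tform d p p\<bar> \<le> K * (\<tau> * M) * tform ?c p p" if "degree p \<le> l" for p
    by (rule K(2)[OF that]) (use dM s(1) \<tau>(1) in \<open>auto simp: d_def abs_mult intro!: mult_left_mono\<close>)
  note low = opnorm_perturb_lower[OF pd L(1,2) dom]
  have e: "trig_seq C (\<lambda>j. y j + s * u j) k = ?c k + d k" if "k \<le> l" for k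
  proof -
    have "free_dir C l (\<lambda>j. s * u j) = (\<lambda>j. s * free_dir C l u j)" by (auto simp: free_dir_def)
    then show ?thesis by (simp add: trig_seq_shift[OF that] d_def cheb_seq_scale)
  qed
  have "pdef l (trig_seq C (\<lambda>j. y j + s * u j))"
    using low(1) pdef_cong[of l "trig_seq C (\<lambda>j. y j + s * u j)" "\<lambda>k. ?c k + d k"] e by blast
  then have "opnorm (trig_seq C (\<lambda>j. y j + s * u j)) l \<le> opnorm ?c l" by (rule max)
  moreover have "opnorm (trig_seq C (\<lambda>j. y j + s * u j)) l = opnorm (\<lambda>k. ?c k + d k) l"
    by (rule opnorm_cong) (rule e)
  ultimately have le: "tform d (opoly ?c l) (opoly ?c l) \<le> second_order ?c l d / (1 - K * (\<tau> * M))"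
    using low(2) by linarith
  have "tform d (opoly ?c l) (opoly ?c l) = \<tau> * \<bar>G\<bar>"
    unfolding d_def tform_scale using s(2) by (simp add: G_def)
  moreover have "second_order ?c l d = \<tau>\<^sup>2 * B"
    unfolding d_def second_order_scale B_def using s(1) by (metis power2_abs)
  moreover have "\<tau>\<^sup>2 * B / (1 - K * (\<tau> * M)) \<le> \<tau>\<^sup>2 * B / (1 / 2)"
    by (intro divide_left_mono) (use L B0 in auto)
  ultimately have "\<tau> * \<bar>G\<bar> \<le> \<tau> * (\<tau> * (2 * B))" using le by (simp add: power2_eq_square mult_ac)
  then have "\<bar>G\<bar> \<le> \<tau> * (2 * B)" using \<tau>(1) by simp
  also have "\<dots> \<le> \<bar>G\<bar> / (4 * B + 1) * (2 * B)" by (intro mult_right_mono \<tau>(3)) (use B0 in simp)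
  also have "\<dots> < \<bar>G\<bar>"
  proof -
    have "\<bar>G\<bar> * (2 * B) < \<bar>G\<bar> * (4 * B + 1)" using G B0 by (intro mult_strict_left_mono) auto
    then show ?thesis using B0 by (simp add: divide_less_eq)
  qed
  finally show False by simp
qed

lemma maximizer_minimizes_entropy:
  assumes C: "moment_constraint C" "last_index C \<le> l"
    and pd: "pdef l (trig_seq C y)"
    and max: "\<And>y'. pdef l (trig_seq C y') \<Longrightarrow> opnorm (trig_seq C y') l \<le> opnorm (trig_seq C y) l"
  shows "constraint_minimizer C = bs_measure (trig_seq C y) l"
proof -
  let ?c = "trig_seq C y" and ?\<mu> = "bs_measure (trig_seq C y) l"
  define W where "W = bs_weight ?c l"
  have m: "?\<mu> \<in> moment_measures {0..1}" by (rule pdef_imp_measure(1)[OF pd]) simp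
  have mom: "moment ?\<mu> j = full_moments C y j" if "j \<le> l" for j
    by (rule pdef_imp_measure(2)[OF pd _ that]) simp
  have r: "opnorm ?c l > 0" by (rule pdef_opnorm[OF pd order_refl])
  have dT: "degree (toep_poly (opoly ?c l) (opoly ?c l)) \<le> l" by (rule degree_toep_poly) simp_all
  then have dW: "degree W \<le> l" unfolding W_def bs_weight_def by (rule order_trans[OF degree_smult_le])
  have W: "(\<Sum>j\<le>l. coeff W j * a j) = tform (cheb_seq a) (opoly ?c l) (opoly ?c l) / opnorm ?c l" for a
    using tform_cheb_seq[of "opoly ?c l" l "opoly ?c l" a]
    by (simp add: W_def bs_weight_def sum_divide_distrib)
  \<comment> \<open>Each free coefficient of W is the derivative of \<open>opnorm\<close> in a
    coordinate direction, divided by \<open>opnorm\<close>.\<close>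
  have W0: "coeff W i = 0" if i: "i \<in> free_indices C l" for i
  proof -
    have "(\<Sum>j\<le>l. coeff W j * free_dir C l (\<lambda>j. if j = i then 1 else 0) j) = 0"
      unfolding W by (simp add: maximizer_first_order[OF pd max])
    moreover have "free_dir C l (\<lambda>j. if j = i then 1 else 0) = (\<lambda>j. if j = i then 1 else 0)"
      using i by (auto simp: free_dir_def)
    ultimately show ?thesis using i by (simp add: free_indices_def if_distrib[where f = "\<lambda>x. _ * x"] cong: if_cong)
  qed
  have one: "(\<integral>x. poly W x \<partial>\<nu>) = 1" if \<nu>: "\<nu> \<in> constrained_measures C {0..1}" for \<nu>
  proof -
    have n: "\<nu> \<in> moment_measures {0..1}" using \<nu> by (simp add: constrained_measures_def)
    have "coeff W j * moment \<nu> j = coeff W j * full_moments C y j" if "j \<le> l" for j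
    proof (cases "j \<in> free_indices C l")
      case False
      then have "j = 0 \<or> (j \<noteq> 0 \<and> (\<exists>c. C j = Some c))" using that by (auto simp: free_indices_def)
      then consider "j = 0" | c where "j \<noteq> 0" "C j = Some c" by blast
      then show ?thesis
        using \<nu> moment_measures_facts(6)[OF n] by cases (auto simp: full_moments_def constrained_measures_def)
    qed (simp add: W0)
    then have "(\<integral>x. poly W x \<partial>\<nu>) = (\<Sum>j\<le>l. coeff W j * full_moments C y j)"
      unfolding integral_poly[OF n dW] by (intro sum.cong refl) simp
    also have "\<dots> = 1" unfolding W using r by (simp add: opnorm_def)
    finally show ?thesis .
  qed
  have cm: "?\<mu> \<in> constrained_measures C {0..1}"
    unfolding constrained_measures_def
  proof (intro CollectI conjI allI impI m)
    fix i c assume i: "C i = Some c"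
    have "i \<le> l" using last_index_ge[OF C(1) domI[where m = C, OF i]] C(2) by simp
    moreover have "i \<noteq> 0" using C(1) domI[where m = C, OF i] by (auto simp: moment_constraint_def)
    ultimately show "moment ?\<mu> i = c" using mom i by (simp add: full_moments_def)
  qed
  have dens: "?\<mu> = density arcsine (\<lambda>x. ennreal (1 / poly W x))" by (simp add: bs_measure_def W_def)
  have Wpos: "poly W x > 0" if "x \<in> {0..1}" for x unfolding W_def by (rule bs_weight_pos[OF pd that])
  have km: "kullback arcsine ?\<mu> \<le> kullback arcsine \<nu>" "kullback arcsine \<nu> \<le> kullback arcsine ?\<mu> \<Longrightarrow> \<nu> = ?\<mu>"
    if \<nu>: "\<nu> \<in> constrained_measures C {0..1}" for \<nu>
  proof -
    have "\<nu> \<in> moment_measures {0..1}" using \<nu> by (simp add: constrained_measures_def)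
    from kullback_min[OF Wpos dens m this one[OF \<nu>]]
    show "kullback arcsine ?\<mu> \<le> kullback arcsine \<nu>" "kullback arcsine \<nu> \<le> kullback arcsine ?\<mu> \<Longrightarrow> \<nu> = ?\<mu>"
      by blast+
  qed
  show ?thesis unfolding constraint_minimizer_def
  proof (rule the_equality)
    show "is_arg_min (kullback arcsine) (\<lambda>\<mu>. \<mu> \<in> constrained_measures C {0..1}) ?\<mu>"
      unfolding is_arg_min_def using cm km(1) by (auto simp: not_less)
  next
    fix \<nu> assume "is_arg_min (kullback arcsine) (\<lambda>\<mu>. \<mu> \<in> constrained_measures C {0..1}) \<nu>"
    then have "\<nu> \<in> constrained_measures C {0..1}" "\<not> kullback arcsine ?\<mu> < kullback arcsine \<nu>"
      unfolding is_arg_min_def using cm by auto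
    then show "\<nu> = ?\<mu>" using km(2) by (simp add: not_less)
  qed
qed

section \<open>The Laplace method\<close>

lemma qform_scale: "qform I (\<lambda>i j. s * A i j) u = s * qform I A u"
  by (simp add: qform_def sum_distrib_left mult.assoc)

lemma pos_def_on_scale: "pos_def_on I A \<Longrightarrow> s > 0 \<Longrightarrow> pos_def_on I (\<lambda>i j. s * A i j)"
  by (auto simp: pos_def_on_def qform_scale)

lemma one_minus_power_bounds:
  fixes t :: real
  shows "t \<le> 1 \<Longrightarrow> (1 - t) ^ q \<le> exp (- (real q * t))"
    and "0 \<le> t \<Longrightarrow> t \<le> 1 / 2 \<Longrightarrow> exp (- (real q * t) - 2 * real q * t\<^sup>2) \<le> (1 - t) ^ q"
proof -
  assume t: "t \<le> 1"
  have "(1 - t) ^ q \<le> exp (- t) ^ q"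
    using t exp_ge_add_one_self[of "- t"] by (intro power_mono) auto
  then show "(1 - t) ^ q \<le> exp (- (real q * t))" by (simp add: exp_of_nat_mult[symmetric])
next
  assume t: "0 \<le> t" "t \<le> 1 / 2"
  have "exp (- t - 2 * t\<^sup>2) \<le> exp (ln (1 - t))"
    using ln_one_minus_pos_lower_bound[OF t] by simp
  then have "exp (- t - 2 * t\<^sup>2) ^ q \<le> (1 - t) ^ q" using t by (intro power_mono) auto
  then show "exp (- (real q * t) - 2 * real q * t\<^sup>2) \<le> (1 - t) ^ q"
    by (simp add: exp_of_nat_mult[symmetric] algebra_simps)
qed

locale constrained_maximum =
  fixes C :: "nat \<rightharpoonup> real" and l :: nat and y :: "nat \<Rightarrow> real"
  assumes C: "moment_constraint C" "last_index C \<le> l"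
    and pd: "pdef l (trig_seq C y)"
    and max: "\<And>y'. pdef l (trig_seq C y') \<Longrightarrow> opnorm (trig_seq C y') l \<le> opnorm (trig_seq C y) l"
begin

definition "I = free_indices C l"
definition "c = trig_seq C y"
definition "r = opnorm c l"
definition "dir u = cheb_seq (free_dir C l u)"
definition "B u = second_order c l (dir u)"

text \<open>Each pairing with Phi_m is linear in u, so \<open>B\<close> is a sum of squares of
  linear forms and this is its matrix; at the maximizer \<open>opnorm\<close> has Hessian -2 times
  it on the free coordinates.\<close>

definition "hess i j = (\<Sum>m<l. coeff (toep_poly (opoly c l) (opoly c m)) i *
  coeff (toep_poly (opoly c l) (opoly c m)) j / opnorm c m)"

lemma finite_I [simp]: "finite I"
  by (simp add: I_def)

lemma I_subset: "I \<subseteq> {1..l}"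
  by (auto simp: I_def free_indices_def)

lemma r_pos: "r > 0"
  unfolding r_def c_def by (rule pdef_opnorm[OF pd order_refl])

lemma c_0: "c 0 = 1"
  by (simp add: c_def)

lemma first_order: "tform (dir u) (opoly c l) (opoly c l) = 0"
  unfolding dir_def c_def by (rule maximizer_first_order[OF pd max])

lemma B_nonneg: "B u \<ge> 0"
  unfolding B_def by (rule second_order_nonneg) (simp add: c_def pd)

lemma B_eq_qform: "B u = qform I hess u"
proof -
  have t: "tform (dir u) (opoly c l) (opoly c m) = (\<Sum>i\<in>I. coeff (toep_poly (opoly c l) (opoly c m)) i * u i)"
    if "m < l" for m
  proof -
    have "tform (dir u) (opoly c l) (opoly c m) =
        (\<Sum>i\<le>l. coeff (toep_poly (opoly c l) (opoly c m)) i * free_dir C l u i)"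
      unfolding dir_def by (rule tform_cheb_seq) (use that in simp_all)
    also have "\<dots> = (\<Sum>i\<in>I. coeff (toep_poly (opoly c l) (opoly c m)) i * free_dir C l u i)"
      by (rule sum.mono_neutral_right) (use I_subset in \<open>auto simp: I_def free_dir_def\<close>)
    also have "\<dots> = (\<Sum>i\<in>I. coeff (toep_poly (opoly c l) (opoly c m)) i * u i)"
      by (intro sum.cong refl) (simp add: I_def free_dir_def)
    finally show ?thesis .
  qed
  define v where "v m i = coeff (toep_poly (opoly c l) (opoly c m)) i" for m i
  have "B u = (\<Sum>m<l. (\<Sum>i\<in>I. v m i * u i)\<^sup>2 / opnorm c m)"
    unfolding B_def second_order_def v_def by (intro sum.cong refl) (simp add: t)
  also have "\<dots> = (\<Sum>m<l. \<Sum>i\<in>I. \<Sum>j\<in>I. v m i * v m j / opnorm c m * u i * u j)"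
    by (simp add: power2_eq_square sum_product sum_divide_distrib mult_ac)
  also have "\<dots> = (\<Sum>i\<in>I. \<Sum>m<l. \<Sum>j\<in>I. v m i * v m j / opnorm c m * u i * u j)"
    by (rule sum.swap)
  also have "\<dots> = (\<Sum>i\<in>I. \<Sum>j\<in>I. \<Sum>m<l. v m i * v m j / opnorm c m * u i * u j)"
    by (intro sum.cong refl sum.swap)
  also have "\<dots> = qform I hess u"
    unfolding qform_def hess_def v_def by (simp add: sum_distrib_right)
  finally show ?thesis .
qed

lemma pos_def_hess: "pos_def_on I hess"
  unfolding pos_def_on_def
proof (intro conjI ballI allI impI)
  fix i j show "hess i j = hess j i" by (simp add: hess_def mult.commute)
next
  fix u assume "\<exists>i\<in>I. u i \<noteq> (0::real)"
  then obtain i where i: "i \<in> I" "u i \<noteq> 0" by blast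
  have "\<exists>k\<le>l. dir u k \<noteq> 0"
  proof (rule ccontr)
    assume "\<not> (\<exists>k\<le>l. dir u k \<noteq> 0)"
    then have "cheb_seq (free_dir C l u) k = cheb_seq (\<lambda>_. 0) k" if "k \<le> l" for k
      using that by (simp add: dir_def cheb_seq_def)
    then have "free_dir C l u i = 0" by (rule cheb_seq_inj[of l]) (use i I_subset in auto)
    then show False using i by (simp add: free_dir_def I_def)
  qed
  then obtain k where "k \<le> l" "dir u k \<noteq> 0" by blast
  then have "B u > 0"
    unfolding B_def by (rule second_order_pos[rotated 2]) (simp_all add: first_order[unfolded c_def] pd c_def)
  then show "qform I hess u > 0" by (simp add: B_eq_qform)
qed

lemma trig_seq_T:
  assumes "k \<le> l"
  shows "trig_seq C (\<lambda>i\<in>I. y i + s * u i) k = c k + s * dir u k"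
proof -
  have "trig_seq C (\<lambda>i\<in>I. y i + s * u i) k = trig_seq C (\<lambda>i. y i + s * u i) k"
    by (rule trig_seq_cong[OF _ assms]) (simp add: I_def)
  moreover have "free_dir C l (\<lambda>j. s * u j) = (\<lambda>j. s * free_dir C l u j)" by (auto simp: free_dir_def)
  ultimately show ?thesis by (simp add: trig_seq_shift[OF assms] c_def dir_def cheb_seq_scale)
qed

text \<open>The fibre weight at y + s u divided by its maximal value r^q, so that a limit exists
  when s^2 is of order 1/q.\<close>

definition "W s q u = pd_weight C l q (\<lambda>i\<in>I. y i + s * u i) / r ^ q"

lemma W_eq: "W s q u = (if pdef l (\<lambda>k. c k + s * dir u k) then (opnorm (\<lambda>k. c k + s * dir u k) l / r) ^ q else 0)"
proof -
  let ?T = "\<lambda>i\<in>I. y i + s * u i"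
  have "pdef l (trig_seq C ?T) \<longleftrightarrow> pdef l (\<lambda>k. c k + s * dir u k)"
    by (rule pdef_cong) (rule trig_seq_T)
  moreover have "opnorm (trig_seq C ?T) l = opnorm (\<lambda>k. c k + s * dir u k) l"
    by (rule opnorm_cong) (rule trig_seq_T)
  ultimately show ?thesis by (simp add: W_def pd_weight_def power_divide)
qed

lemma W_nonneg: "W s q u \<ge> 0"
  unfolding W_def using r_pos by (simp add: pd_weight_nonneg)

lemma second_order_dir: "second_order c l (\<lambda>k. s * dir u k) = s\<^sup>2 * B u"
  by (simp add: second_order_scale B_def)

lemma tform_dir_opoly: "tform (\<lambda>k. s * dir u k) (opoly c l) (opoly c l) = 0"
  by (simp add: tform_scale first_order)

lemma exists_K:
  "\<exists>K>0. \<forall>d M p. degree p \<le> l \<longrightarrow> (\<forall>k\<le>l. \<bar>d k\<bar> \<le> M) \<longrightarrow> \<bar>tform d p p\<bar> \<le> K * M * tform c p p"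
proof -
  obtain K where "K > 0" "\<And>d M p. \<lbrakk>degree p \<le> l; \<And>k. k \<le> l \<Longrightarrow> \<bar>d k\<bar> \<le> M\<rbrakk> \<Longrightarrow> \<bar>tform d p p\<bar> \<le> K * M * tform c p p"
    using pdef_dominates[OF pd] unfolding c_def[symmetric] by blast
  then show ?thesis by blast
qed

definition "K = (SOME K. K > 0 \<and> (\<forall>d M p. degree p \<le> l \<longrightarrow> (\<forall>k\<le>l. \<bar>d k\<bar> \<le> M) \<longrightarrow> \<bar>tform d p p\<bar> \<le> K * M * tform c p p))"

lemma K: "K > 0" "\<lbrakk>degree p \<le> l; \<And>k. k \<le> l \<Longrightarrow> \<bar>d k\<bar> \<le> M\<rbrakk> \<Longrightarrow> \<bar>tform d p p\<bar> \<le> K * M * tform c p p"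
  using someI_ex[OF exists_K] unfolding K_def[symmetric] by blast+

text \<open>Rate of the Gaussian envelope in \<open>W_bound\<close>: the 2 in \<open>K * 2\<close>
  bounds the displacement of the cosine moments, and the factor 1/2 pays for n - l >= n / 2.\<close>

definition "\<kappa> = 1 / (2 * r * (1 + K * 2))"

lemma \<kappa>_pos: "\<kappa> > 0"
  using r_pos K(1) by (simp add: \<kappa>_def add_pos_pos)

lemma upper_gen:
  assumes pd': "pdef l (\<lambda>k. c k + s * dir u k)" and M: "M \<ge> 0" "\<And>k. k \<le> l \<Longrightarrow> \<bar>s * dir u k\<bar> \<le> M"
  shows "opnorm (\<lambda>k. c k + s * dir u k) l / r \<le> 1 - s\<^sup>2 * B u / (r * (1 + K * M))"
proof -
  have "opnorm (\<lambda>k. c k + s * dir u k) l \<le>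
    opnorm c l + tform (\<lambda>k. s * dir u k) (opoly c l) (opoly c l) - second_order c l (\<lambda>k. s * dir u k) / (1 + K * M)"
  proof (rule opnorm_perturb_upper[OF _ pd'])
    show "pdef l c" by (simp add: c_def pd)
    show "0 \<le> K * M" using K(1) M(1) by simp
    show "\<bar>tform (\<lambda>k. s * dir u k) p p\<bar> \<le> K * M * tform c p p" if "degree p \<le> l" for p
      by (rule K(2)[OF that M(2)])
  qed
  then have "opnorm (\<lambda>k. c k + s * dir u k) l \<le> r - s\<^sup>2 * B u / (1 + K * M)"
    by (simp add: tform_dir_opoly second_order_dir r_def)
  then have "opnorm (\<lambda>k. c k + s * dir u k) l / r \<le> (r - s\<^sup>2 * B u / (1 + K * M)) / r"
    using r_pos by (intro divide_right_mono) auto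
  also have "\<dots> = 1 - s\<^sup>2 * B u / (r * (1 + K * M))"
    using r_pos by (simp add: diff_divide_distrib mult.commute)
  finally show ?thesis .
qed

lemma lower_gen:
  assumes M: "M \<ge> 0" "K * M < 1" "\<And>k. k \<le> l \<Longrightarrow> \<bar>s * dir u k\<bar> \<le> M"
  shows "pdef l (\<lambda>k. c k + s * dir u k)"
    and "1 - s\<^sup>2 * B u / (r * (1 - K * M)) \<le> opnorm (\<lambda>k. c k + s * dir u k) l / r"
proof -
  have pdc: "pdef l c" by (simp add: c_def pd)
  have L: "0 \<le> K * M" using K(1) M(1) by simp
  have dom: "\<bar>tform (\<lambda>k. s * dir u k) p p\<bar> \<le> K * M * tform c p p" if "degree p \<le> l" for p
    by (rule K(2)[OF that M(3)])
  note low = opnorm_perturb_lower[OF pdc L M(2) dom]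
  show "pdef l (\<lambda>k. c k + s * dir u k)" by (rule low(1))
  have "r - s\<^sup>2 * B u / (1 - K * M) \<le> opnorm (\<lambda>k. c k + s * dir u k) l"
    using low(2) by (simp add: tform_dir_opoly second_order_dir r_def)
  then have "(r - s\<^sup>2 * B u / (1 - K * M)) / r \<le> opnorm (\<lambda>k. c k + s * dir u k) l / r"
    using r_pos by (intro divide_right_mono) auto
  moreover have "(r - s\<^sup>2 * B u / (1 - K * M)) / r = 1 - s\<^sup>2 * B u / (r * (1 - K * M))"
    using r_pos by (simp add: diff_divide_distrib mult.commute)
  ultimately show "1 - s\<^sup>2 * B u / (r * (1 - K * M)) \<le> opnorm (\<lambda>k. c k + s * dir u k) l / r" by simp
qed

text \<open>Where the weight is nonzero, both sequences have mass one and entries in [-1,1], so the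
  displacement is at most 2 for every u. One Gaussian envelope therefore covers the whole slice,
  with no separate treatment of remote u.\<close>

lemma W_bound:
  assumes n: "n \<ge> 2 * l" "n > 0"
  shows "W (1 / sqrt (real n)) (n - l) u \<le> exp (- (\<kappa> * B u))"
proof (cases "pdef l (\<lambda>k. c k + 1 / sqrt (real n) * dir u k)")
  case False
  then show ?thesis unfolding W_eq by simp
next
  case pd': True
  let ?s = "1 / sqrt (real n)"
  have d0: "dir u 0 = 0" by (simp add: dir_def free_dir_def free_indices_def)
  have "\<bar>?s * dir u k\<bar> \<le> 2" if "k \<le> l" for k
  proof -
    have "\<bar>c k + ?s * dir u k\<bar> \<le> 1" using pdef_abs_le[OF pd' that] by (simp add: d0 c_0)
    moreover have "\<bar>c k\<bar> \<le> 1" using pdef_abs_le[of l c k] that pd c_0 by (simp add: c_def)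
    ultimately show ?thesis by linarith
  qed
  from upper_gen[OF pd' _ this]
  have up: "opnorm (\<lambda>k. c k + ?s * dir u k) l / r \<le> 1 - ?s\<^sup>2 * B u / (r * (1 + K * 2))" by simp
  define t where "t = ?s\<^sup>2 * B u / (r * (1 + K * 2))"
  have te: "t = 2 * \<kappa> * B u / real n"
    using n r_pos K(1) by (simp add: t_def \<kappa>_def power_divide)
  have pos: "opnorm (\<lambda>k. c k + ?s * dir u k) l / r > 0"
    using pdef_opnorm[OF pd' order_refl] r_pos by simp
  have "W ?s (n - l) u \<le> (1 - t) ^ (n - l)"
    unfolding W_eq using pd' up pos by (simp add: t_def power_mono)
  also have "\<dots> \<le> exp (- (real (n - l) * t))"
    by (rule one_minus_power_bounds(1)) (use up pos in \<open>simp add: t_def\<close>)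
  also have "\<dots> \<le> exp (- (\<kappa> * B u))"
  proof -
    have "real n \<le> 2 * real (n - l)" using n by (simp add: of_nat_diff)
    then have "\<kappa> * B u * real n \<le> \<kappa> * B u * (2 * real (n - l))"
      using \<kappa>_pos B_nonneg[of u] by (intro mult_left_mono) auto
    then show ?thesis using n by (simp add: te field_simps)
  qed
  finally show ?thesis .
qed

text \<open>For fixed u the displacement tends to zero, the factors 1 + L and 1 - L tend to 1, and
  (n - l) s^2 tends to 1, so both exponential bounds meet at exp(-B u / r).\<close>

lemma W_limit: "(\<lambda>n. W (1 / sqrt (real n)) (n - l) u) \<longlonglongrightarrow> exp (- (B u / r))"
proof -
  define M where "M = (\<Sum>k\<le>l. \<bar>dir u k\<bar>)"
  have dM: "\<bar>dir u k\<bar> \<le> M" if "k \<le> l" for k unfolding M_def by (rule member_le_sum) (use that in auto)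
  have M0: "M \<ge> 0" by (simp add: M_def sum_nonneg)
  define s where "s n = 1 / sqrt (real n)" for n
  define L where "L n = K * (s n * M)" for n
  define t1 where "t1 n = (s n)\<^sup>2 * B u / (r * (1 - L n))" for n
  define t2 where "t2 n = (s n)\<^sup>2 * B u / (r * (1 + L n))" for n
  have s_lim: "s \<longlonglongrightarrow> 0" unfolding s_def[abs_def]
    by (rule tendsto_divide_0[OF tendsto_const])
       (intro filterlim_at_top_imp_at_infinity filterlim_compose[OF sqrt_at_top filterlim_real_sequentially])
  have L_lim: "L \<longlonglongrightarrow> 0" unfolding L_def[abs_def]
    using tendsto_mult[OF tendsto_const[of K] tendsto_mult[OF s_lim tendsto_const[of M]]] by simp
  have q_lim: "(\<lambda>n. real (n - l) / real n) \<longlonglongrightarrow> 1"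
  proof -
    have "(\<lambda>n. 1 - real l / real n) \<longlonglongrightarrow> 1 - 0" by (intro tendsto_intros lim_const_over_n)
    moreover have "\<forall>\<^sub>F n in sequentially. 1 - real l / real n = real (n - l) / real n"
      using eventually_ge_at_top[of "Suc l"] by eventually_elim (simp add: of_nat_diff field_simps)
    ultimately show ?thesis by (simp add: filterlim_cong)
  qed
  have s2: "(s n)\<^sup>2 = 1 / real n" for n by (simp add: s_def power_divide)
  have qt1: "(\<lambda>n. real (n - l) * t1 n) \<longlonglongrightarrow> B u / r"
  proof -
    have "(\<lambda>n. (real (n - l) / real n) * (B u / (r * (1 - L n)))) \<longlonglongrightarrow> 1 * (B u / (r * (1 - 0)))"
      by (intro tendsto_intros q_lim L_lim) (use r_pos in auto)
    then show ?thesis by (simp add: t1_def s2)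
  qed
  have qt2: "(\<lambda>n. real (n - l) * t2 n) \<longlonglongrightarrow> B u / r"
  proof -
    have "(\<lambda>n. (real (n - l) / real n) * (B u / (r * (1 + L n)))) \<longlonglongrightarrow> 1 * (B u / (r * (1 + 0)))"
      by (intro tendsto_intros q_lim L_lim) (use r_pos in auto)
    then show ?thesis by (simp add: t2_def s2)
  qed
  have t1_lim: "t1 \<longlonglongrightarrow> 0"
  proof -
    have "(\<lambda>n. (s n)\<^sup>2 * B u / (r * (1 - L n))) \<longlonglongrightarrow> 0\<^sup>2 * B u / (r * (1 - 0))"
      by (intro tendsto_intros s_lim L_lim) (use r_pos in auto)
    then show ?thesis by (simp add: t1_def[abs_def])
  qed
  have low_lim: "(\<lambda>n. exp (- (real (n - l) * t1 n) - 2 * real (n - l) * (t1 n)\<^sup>2)) \<longlonglongrightarrow> exp (- (B u / r))"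
  proof -
    have "(\<lambda>n. exp (- (real (n - l) * t1 n) - 2 * (real (n - l) * t1 n) * t1 n)) \<longlonglongrightarrow> exp (- (B u / r) - 2 * (B u / r) * 0)"
      by (intro tendsto_intros qt1 t1_lim)
    then show ?thesis by (simp add: power2_eq_square mult.assoc)
  qed
  have up_lim: "(\<lambda>n. exp (- (real (n - l) * t2 n))) \<longlonglongrightarrow> exp (- (B u / r))"
    by (intro tendsto_intros qt2)
  have ev: "\<forall>\<^sub>F n in sequentially. L n < 1 / 2 \<and> t1 n < 1 / 2"
    using order_tendstoD(2)[OF L_lim, of "1/2"] order_tendstoD(2)[OF t1_lim, of "1/2"]
    by (simp add: eventually_conj)
  have both: "\<forall>\<^sub>F n in sequentially. exp (- (real (n - l) * t1 n) - 2 * real (n - l) * (t1 n)\<^sup>2) \<le> W (s n) (n - l) u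
      \<and> W (s n) (n - l) u \<le> exp (- (real (n - l) * t2 n))"
    using ev
  proof eventually_elim
    case (elim n)
    have s0: "s n \<ge> 0" by (simp add: s_def)
    have M': "s n * M \<ge> 0" "\<bar>s n * dir u k\<bar> \<le> s n * M" if "k \<le> l" for k
      using s0 M0 dM[OF that] by (simp_all add: abs_mult mult_left_mono)
    have sM: "s n * M \<ge> 0" using s0 M0 by simp
    have KM: "K * (s n * M) < 1" using elim by (simp add: L_def)
    note low = lower_gen[OF sM KM M'(2)]
    define R where "R = opnorm (\<lambda>k. c k + s n * dir u k) l / r"
    have W: "W (s n) (n - l) u = R ^ (n - l)" unfolding W_eq R_def using low(1) by simp
    have R: "1 - t1 n \<le> R" "R \<le> 1 - t2 n"
      using low(2) upper_gen[OF low(1) sM M'(2)] by (simp_all add: R_def t1_def t2_def L_def)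
    have R0: "R \<ge> 0" unfolding R_def using pdef_opnorm[OF low(1) order_refl] r_pos by simp
    have t10: "t1 n \<ge> 0" unfolding t1_def using r_pos elim B_nonneg[of u] by (intro divide_nonneg_nonneg mult_nonneg_nonneg) auto
    have "exp (- (real (n - l) * t1 n) - 2 * real (n - l) * (t1 n)\<^sup>2) \<le> (1 - t1 n) ^ (n - l)"
      by (rule one_minus_power_bounds(2)) (use t10 elim in auto)
    also have "\<dots> \<le> R ^ (n - l)" by (rule power_mono) (use R elim in auto)
    finally have 1: "exp (- (real (n - l) * t1 n) - 2 * real (n - l) * (t1 n)\<^sup>2) \<le> W (s n) (n - l) u" by (simp add: W)
    have "R ^ (n - l) \<le> (1 - t2 n) ^ (n - l)" by (rule power_mono) (use R R0 in auto)
    also have "\<dots> \<le> exp (- (real (n - l) * t2 n))"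
      by (rule one_minus_power_bounds(1)) (use R R0 in linarith)
    finally show ?case using 1 by (simp add: W)
  qed
  show ?thesis unfolding s_def[symmetric]
    by (rule tendsto_sandwich[OF _ _ low_lim up_lim]) (use both in \<open>auto elim: eventually_mono\<close>)
qed

lemma measurable_T: "(\<lambda>u. \<lambda>i\<in>I. y i + s * u i) \<in> measurable (coord_lebesgue I) (coord_lebesgue I)"
  by (rule measurable_restrict) auto

lemma measurable_W: "W s q \<in> borel_measurable (coord_lebesgue I)"
proof -
  have "pd_weight C l q \<in> borel_measurable (coord_lebesgue I)"
    using measurable_pd_weight[of C l q] by (simp add: I_def cong: measurable_cong_sets)
  from measurable_compose[OF measurable_T this] show ?thesis
    unfolding W_def[abs_def] by (intro borel_measurable_divide) auto
qed

lemma integrable_B: "t > 0 \<Longrightarrow> integrable (coord_lebesgue I) (\<lambda>u. exp (- (t * B u)))"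
  using gaussian_fourier[OF finite_I pos_def_on_scale[OF pos_def_hess, of "2 * t"]]
  by (auto simp: qform_scale B_eq_qform)

lemma W_integral_limit:
  fixes F :: "(nat \<Rightarrow> real) \<Rightarrow> real"
  assumes F: "F \<in> borel_measurable (coord_lebesgue I)" "\<And>u. \<bar>F u\<bar> \<le> b"
  shows "(\<lambda>n. \<integral>u. W (1 / sqrt (real n)) (n - l) u * F u \<partial>coord_lebesgue I)
    \<longlonglongrightarrow> (\<integral>u. exp (- (B u / r)) * F u \<partial>coord_lebesgue I)"
    and "n \<ge> 2 * l \<Longrightarrow> n > 0 \<Longrightarrow> integrable (coord_lebesgue I) (\<lambda>u. W (1 / sqrt (real n)) (n - l) u * F u)"
proof -
  let ?N = "coord_lebesgue I"
  have Bm: "(\<lambda>u. B u) \<in> borel_measurable ?N"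
    unfolding B_eq_qform using measurable_qform[OF finite_I] by (simp cong: measurable_cong_sets)
  have b: "b \<ge> 0" using F(2)[of undefined] by linarith
  have dom: "integrable ?N (\<lambda>u. exp (- (\<kappa> * B u)) * b)"
    by (intro integrable_mult_left integrable_B \<kappa>_pos)
  have bound: "norm (W (1 / sqrt (real n)) (n - l) u * F u) \<le> exp (- (\<kappa> * B u)) * b"
    if "n \<ge> 2 * l" "n > 0" for n u
    unfolding real_norm_def abs_mult
    by (intro mult_mono) (use W_bound[OF that] W_nonneg F(2) in auto)
  show "integrable ?N (\<lambda>u. W (1 / sqrt (real n)) (n - l) u * F u)" if "n \<ge> 2 * l" "n > 0" for n
  proof (rule Bochner_Integration.integrable_bound[OF dom])
    show "(\<lambda>u. W (1 / sqrt (real n)) (n - l) u * F u) \<in> borel_measurable ?N"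
      by (intro borel_measurable_times measurable_W F(1))
    show "AE u in ?N. norm (W (1 / sqrt (real n)) (n - l) u * F u) \<le> norm (exp (- (\<kappa> * B u)) * b)"
      using bound[OF that] b by (intro AE_I2) (simp only: real_norm_def abs_mult abs_exp_cancel abs_of_nonneg[OF b])
  qed
  \<comment> \<open>Starting at 2 l + 1 makes the envelope valid for every term of the shifted
    sequence, as dominated convergence requires.\<close>
  let ?k = "Suc (2 * l)"
  have "(\<lambda>n. \<integral>u. W (1 / sqrt (real (n + ?k))) (n + ?k - l) u * F u \<partial>?N)
    \<longlonglongrightarrow> (\<integral>u. exp (- (B u / r)) * F u \<partial>?N)"
  proof (rule integral_dominated_convergence[OF _ _ dom])
    show "(\<lambda>u. exp (- (B u / r)) * F u) \<in> borel_measurable ?N"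
      using Bm F(1) by measurable
    show "(\<lambda>u. W (1 / sqrt (real (n + ?k))) (n + ?k - l) u * F u) \<in> borel_measurable ?N" for n
      by (intro borel_measurable_times measurable_W F(1))
    show "AE u in ?N. norm (W (1 / sqrt (real (n + ?k))) (n + ?k - l) u * F u) \<le> exp (- (\<kappa> * B u)) * b" for n
      by (intro AE_I2 bound) auto
    show "AE u in ?N. (\<lambda>n. W (1 / sqrt (real (n + ?k))) (n + ?k - l) u * F u) \<longlonglongrightarrow> exp (- (B u / r)) * F u"
      by (intro AE_I2 tendsto_mult tendsto_const LIMSEQ_ignore_initial_segment[OF W_limit])
  qed
  then show "(\<lambda>n. \<integral>u. W (1 / sqrt (real n)) (n - l) u * F u \<partial>?N)
    \<longlonglongrightarrow> (\<integral>u. exp (- (B u / r)) * F u \<partial>?N)"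
    by (rule LIMSEQ_offset)
qed

text \<open>Under x = y + u / sqrt n in numerator and normalization, the Jacobian and the factor
  r^(n-l) cancel, and both integrals converge by domination.\<close>

lemma expectation_limit:
  fixes f :: "(nat \<Rightarrow> real) \<Rightarrow> real"
  assumes f: "f \<in> borel_measurable (coord_borel {1..l})" "\<And>x. x \<in> extensional {1..l} \<Longrightarrow> \<bar>f x\<bar> \<le> b"
  defines "Z \<equiv> (\<integral>u. exp (- (B u / r)) \<partial>coord_lebesgue I)"
  assumes Z: "Z > 0"
  shows "(\<lambda>n. \<integral>x. f x \<partial>distr (uniform_moments C n) (coord_borel {1..l})
      (\<lambda>m. \<lambda>j\<in>{1..l}. sqrt (real n) * (m j - full_moments C y j)))
    \<longlonglongrightarrow> (\<integral>u. exp (- (B u / r)) * f (\<lambda>j\<in>{1..l}. free_dir C l u j) \<partial>coord_lebesgue I) / Z"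
proof -
  let ?N = "coord_lebesgue I"
  define F where "F u = f (\<lambda>j\<in>{1..l}. free_dir C l u j)" for u
  have "(\<lambda>u. \<lambda>j\<in>{1..l}. free_dir C l u j) \<in> measurable ?N (coord_borel {1..l})"
  proof (rule measurable_restrict)
    fix j
    show "(\<lambda>u. free_dir C l u j) \<in> borel_measurable ?N"
      unfolding free_dir_def I_def[symmetric] by (cases "j \<in> I") auto
  qed
  then have Fm: "F \<in> borel_measurable ?N" unfolding F_def by (rule measurable_compose[OF _ f(1)])
  have Fb: "\<bar>F u\<bar> \<le> b" for u unfolding F_def by (rule f(2)) simp
  define z where "z n = (\<integral>u. W (1 / sqrt (real n)) (n - l) u \<partial>?N)" for n
  have z_lim: "z \<longlonglongrightarrow> Z"
    using W_integral_limit(1)[of "\<lambda>_. 1" 1] by (simp add: z_def[abs_def] Z_def)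
  have num_lim: "(\<lambda>n. \<integral>u. W (1 / sqrt (real n)) (n - l) u * F u \<partial>?N) \<longlonglongrightarrow> (\<integral>u. exp (- (B u / r)) * F u \<partial>?N)"
    by (rule W_integral_limit(1)[OF Fm Fb])
  have "\<forall>\<^sub>F n in sequentially. (\<integral>x. f x \<partial>distr (uniform_moments C n) (coord_borel {1..l})
      (\<lambda>m. \<lambda>j\<in>{1..l}. sqrt (real n) * (m j - full_moments C y j))) =
      (\<integral>u. W (1 / sqrt (real n)) (n - l) u * F u \<partial>?N) / z n"
    using order_tendstoD(1)[OF z_lim Z] eventually_gt_at_top[of "2 * l"]
  proof eventually_elim
    case (elim n)
    then have n: "n \<ge> 2 * l" "n > 0" "l < n" by auto
    let ?s = "1 / sqrt (real n)"
    let ?T = "\<lambda>u. \<lambda>i\<in>I. y i + ?s * u i"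
    let ?w = "pd_weight C l (n - l)"
    have s: "?s > 0" using n by simp
    have wT: "?w (?T u) = r ^ (n - l) * W ?s (n - l) u" for u
      using r_pos by (simp add: W_def)
    have wm: "?w \<in> borel_measurable ?N"
      using measurable_pd_weight[of C l "n - l"] by (simp add: I_def cong: measurable_cong_sets)
    have "integrable ?N (\<lambda>u. W ?s (n - l) u * 1)" by (rule W_integral_limit(2)[of "\<lambda>_. 1" 1, OF _ _ n(1,2)]) simp_all
    then have "integrable ?N (\<lambda>u. ?w (?T u))" unfolding wT by simp
    then have wi: "integrable ?N ?w" by (rule integral_PiM_affine(2)[OF finite_I s wm])
    define q where "q = ?s ^ card I * r ^ (n - l)"
    have q: "q > 0" using s r_pos by (simp add: q_def)
    have wz: "(\<integral>x. ?w x \<partial>?N) = q * z n"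
      unfolding integral_PiM_affine(1)[OF finite_I s wm, of y] wT z_def q_def by simp
    define G where "G x = f (\<lambda>j\<in>{1..l}. sqrt (real n) * (full_moments C x j - full_moments C y j))" for x
    have Gm: "G \<in> borel_measurable ?N" unfolding G_def
      by (rule measurable_compose[OF _ f(1)]) (use measurable_affine_full_moments[OF order_refl, where s = "sqrt (real n)" and C = C and b = "full_moments C y"] in \<open>simp add: I_def cong: measurable_cong_sets\<close>)
    \<comment> \<open>Constrained coordinates agree in both points, so their difference is the 0
      supplied by \<open>free_dir\<close>.\<close>
    have GT: "G (?T u) = F u" for u
    proof -
      have "sqrt (real n) * (full_moments C (?T u) j - full_moments C y j) = free_dir C l u j" if "j \<in> {1..l}" for j
        using that n by (auto simp: full_moments_def free_dir_def I_def free_indices_def split: option.splits)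
      then show ?thesis unfolding G_def F_def by (intro arg_cong[where f = f] restrict_ext)
    qed
    have num: "(\<integral>x. ?w x * G x \<partial>?N) = q * (\<integral>u. W ?s (n - l) u * F u \<partial>?N)"
    proof -
      have "(\<integral>x. ?w x * G x \<partial>?N) = ?s ^ card I * (\<integral>u. ?w (?T u) * G (?T u) \<partial>?N)"
        by (rule integral_PiM_affine(1)[OF finite_I s]) (intro borel_measurable_times wm Gm)
      also have "(\<lambda>u. ?w (?T u) * G (?T u)) = (\<lambda>u. r ^ (n - l) * (W ?s (n - l) u * F u))"
        by (simp only: wT GT mult.assoc)
      finally show ?thesis by (simp add: q_def)
    qed
    have "(\<integral>x. f x \<partial>distr (uniform_moments C n) (coord_borel {1..l})
      (\<lambda>m. \<lambda>j\<in>{1..l}. sqrt (real n) * (m j - full_moments C y j))) = (\<integral>x. ?w x * G x \<partial>?N) / (q * z n)"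
      unfolding G_def I_def
      by (rule uniform_moments_expectation[OF C n(3)]) (use wi wz q elim f(1) in \<open>auto simp: I_def\<close>)
    also have "\<dots> = (\<integral>u. W ?s (n - l) u * F u \<partial>?N) / z n" unfolding num using q by simp
    finally show ?case .
  qed
  moreover have "(\<lambda>n. (\<integral>u. W (1 / sqrt (real n)) (n - l) u * F u \<partial>?N) / z n) \<longlonglongrightarrow> (\<integral>u. exp (- (B u / r)) * F u \<partial>?N) / Z"
    by (intro tendsto_divide num_lim z_lim) (use Z in simp)
  ultimately show ?thesis unfolding F_def by (simp add: filterlim_cong)
qed

end

section \<open>Padding the covariance matrix and the limit law\<close>

lemma card_free_indices:
  assumes "moment_constraint C" "last_index C \<le> l"
  shows "card (free_indices C l) = l - card (dom C)"
proof -
  have "dom C \<subseteq> {1..l}"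
  proof
    fix i assume i: "i \<in> dom C"
    then have "i \<noteq> 0" using assms(1) by (metis moment_constraint_def)
    moreover have "i \<le> l" using last_index_ge[OF assms(1) i] assms(2) by simp
    ultimately show "i \<in> {1..l}" by simp
  qed
  then show ?thesis unfolding free_indices_def by (subst card_Diff_subset) (auto intro: finite_subset)
qed

lemma transpose_pad_mat:
  assumes "pos_def_on I V" shows "transpose_mat (pad_mat l I V) = pad_mat l I V"
  by (rule eq_matI) (use pos_def_on_sym[OF assms] in \<open>auto simp: pad_mat_def\<close>)

lemma pad_mat_entry:
  assumes "i \<in> {1..l}" "j \<in> {1..l}"
  shows "pad_mat l I V $$ (i - 1, j - 1) = (if i \<in> I \<and> j \<in> I then V i j else 0)"
proof -
  have "i - 1 < l" "j - 1 < l" "Suc (i - 1) = i" "Suc (j - 1) = j" using assms by auto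
  then show ?thesis by (simp add: pad_mat_def)
qed

lemma quadratic_form_pad_mat:
  assumes "I \<subseteq> {1..l}"
  shows "(\<Sum>i\<in>{1..l}. \<Sum>j\<in>{1..l}. t i * pad_mat l I V $$ (i - 1, j - 1) * t j) = qform I V t"
proof -
  have "(\<Sum>i\<in>{1..l}. \<Sum>j\<in>{1..l}. t i * pad_mat l I V $$ (i - 1, j - 1) * t j) =
      (\<Sum>i\<in>{1..l}. \<Sum>j\<in>{1..l}. if i \<in> I \<and> j \<in> I then V i j * t i * t j else 0)"
    by (intro sum.cong refl) (simp only: pad_mat_entry, simp)
  also have "\<dots> = (\<Sum>i\<in>I. \<Sum>j\<in>{1..l}. if i \<in> I \<and> j \<in> I then V i j * t i * t j else 0)"
    by (rule sum.mono_neutral_right) (use assms in auto)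
  also have "\<dots> = (\<Sum>i\<in>I. \<Sum>j\<in>I. if i \<in> I \<and> j \<in> I then V i j * t i * t j else 0)"
    by (intro sum.cong refl sum.mono_neutral_right) (use assms in auto)
  also have "\<dots> = qform I V t" unfolding qform_def by (intro sum.cong refl) simp
  finally show ?thesis .
qed

theorem theorem2p5:
  fixes C :: "nat \<rightharpoonup> real" and l :: nat
  assumes "moment_constraint C"
    and "admissible C {0..1}"
    and "last_index C \<le> l"
    and "1 \<le> l"
  shows "\<exists>(V :: real mat) N.
    V \<in> carrier_mat l l \<and>
    vec_space.rank l V = l - card (dom C) \<and>
    (\<forall>i\<in>dom C. \<forall>j\<in>{1..l}. V $$ (i - 1, j - 1) = 0 \<and> V $$ (j - 1, i - 1) = 0) \<and>
    centered_normal l V N \<and>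
    weak_conv_vec l
      (\<lambda>n. distr (uniform_moments C n) (coord_borel {1..l})
         (\<lambda>m. \<lambda>j\<in>{1..l}. sqrt (real n) * (m j - moment (constraint_minimizer C) j)))
      N"
proof -
  obtain y where y: "pdef l (trig_seq C y)"
    "\<And>y'. pdef l (trig_seq C y') \<Longrightarrow> opnorm (trig_seq C y') l \<le> opnorm (trig_seq C y) l"
    by (rule exists_maximizer[OF assms(1,3,2)]) blast
  interpret constrained_maximum C l y
    by standard (use assms y in auto)
  have cm: "constraint_minimizer C = bs_measure (trig_seq C y) l"
    by (rule maximizer_minimizes_entropy[OF assms(1,3) y])
  have mom: "moment (constraint_minimizer C) j = full_moments C y j" if "j \<le> l" for j
    unfolding cm
    by (rule pdef_imp_measure(2)[OF y(1) _ that]) simp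
  let ?N = "coord_lebesgue I"
  \<comment> \<open>The factor 2 / r matches exp(-B / r) with the convention exp(-A / 2) of
    \<open>gaussian_fourier\<close>.\<close>
  define A where "A i j = 2 / r * hess i j" for i j
  have A: "pos_def_on I A" unfolding A_def by (rule pos_def_on_scale[OF pos_def_hess]) (use r_pos in simp)
  have qA: "- qform I A u / 2 = - (B u / r)" for u
    unfolding A_def qform_scale B_eq_qform[symmetric] by simp
  obtain Z V where Z: "Z > 0" and V: "pos_def_on I V"
    and four: "\<And>t. (CLINT u|?N. exp (- (B u / r)) * iexp (\<Sum>i\<in>I. t i * u i)) = of_real (Z * exp (- qform I V t / 2))"
    using gaussian_fourier[OF finite_I A] unfolding qA by blast
  have intB: "integrable ?N (\<lambda>u. exp (- (B u / r)))"
    using integrable_B[of "1 / r"] r_pos by simp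
  \<comment> \<open>Frequency 0 identifies Z as the total mass.\<close>
  have ZE: "(\<integral>u. exp (- (B u / r)) \<partial>?N) = Z"
  proof -
    have "complex_of_real (\<integral>u. exp (- (B u / r)) \<partial>?N) = of_real Z"
      using four[of "\<lambda>_. 0"] by (simp add: qform_def)
    then show ?thesis by (simp only: of_real_eq_iff)
  qed
  define g where "g u = exp (- (B u / r)) / Z" for u
  have gm: "g \<in> borel_measurable ?N"
    unfolding g_def B_eq_qform using measurable_qform[OF finite_I] by (simp cong: measurable_cong_sets)
  have g0: "g u \<ge> 0" for u using Z by (simp add: g_def)
  \<comment> \<open>Embeds the free coordinates into R^l with zeros at the constrained indices; the
    image law is the possibly degenerate normal law.\<close>
  define P where "P u = (\<lambda>j\<in>{1..l}. free_dir C l u j)" for u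
  have Pm: "P \<in> measurable ?N (coord_borel {1..l})"
    unfolding P_def
  proof (rule measurable_restrict)
    fix j
    show "(\<lambda>u. free_dir C l u j) \<in> borel_measurable ?N"
      unfolding free_dir_def I_def[symmetric] by (cases "j \<in> I") auto
  qed
  define G where "G = distr (density ?N (\<lambda>u. ennreal (g u))) (coord_borel {1..l}) P"
  have "prob_space (density ?N (\<lambda>u. ennreal (g u)))"
  proof
    have "emeasure (density ?N (\<lambda>u. ennreal (g u))) (space ?N) = (\<integral>\<^sup>+u. ennreal (g u) \<partial>?N)"
      by (subst emeasure_density) (use gm in \<open>auto intro!: nn_integral_cong\<close>)
    also have "\<dots> = ennreal (\<integral>u. g u \<partial>?N)"
      by (rule nn_integral_eq_integral) (use intB g0 in \<open>auto simp: g_def\<close>)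
    also have "(\<integral>u. g u \<partial>?N) = 1" unfolding g_def using ZE Z by simp
    finally show "emeasure (density ?N (\<lambda>u. ennreal (g u))) (space (density ?N (\<lambda>u. ennreal (g u)))) = 1" by simp
  qed
  then have pG: "prob_space G"
    unfolding G_def by (rule prob_space.prob_space_distr) (use Pm in simp)
  \<comment> \<open>Polymorphic in the codomain: complex values for the characteristic function,
    real ones for the test functions.\<close>
  have integral_G: "(\<integral>x. f x \<partial>G) = (\<integral>u. g u *\<^sub>R f (P u) \<partial>?N)"
    if "f \<in> borel_measurable (coord_borel {1..l})" for f :: "(nat \<Rightarrow> real) \<Rightarrow> 'b :: {banach, second_countable_topology}"
  proof -
    have "(\<integral>x. f x \<partial>G) = (\<integral>u. f (P u) \<partial>density ?N (\<lambda>u. ennreal (g u)))"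
      unfolding G_def by (rule integral_distr) (use Pm that in simp_all)
    also have "\<dots> = (\<integral>u. g u *\<^sub>R f (P u) \<partial>?N)"
      by (rule integral_density) (use measurable_compose[OF Pm that] gm g0 in auto)
    finally show ?thesis .
  qed
  have char_G: "(CLINT x|G. iexp (\<Sum>i\<in>{1..l}. t i * x i)) = of_real (exp (- qform I V t / 2))" for t
  proof -
    have "(\<lambda>x. iexp (\<Sum>i\<in>{1..l}. t i * x i)) \<in> borel_measurable (coord_borel {1..l})" by measurable
    then have "(CLINT x|G. iexp (\<Sum>i\<in>{1..l}. t i * x i)) = (CLINT u|?N. g u *\<^sub>R iexp (\<Sum>i\<in>{1..l}. t i * P u i))"
      by (rule integral_G)
    also have "(\<lambda>u. g u *\<^sub>R iexp (\<Sum>i\<in>{1..l}. t i * P u i)) =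
        (\<lambda>u. of_real (1 / Z) * (exp (- (B u / r)) * iexp (\<Sum>i\<in>I. t i * u i)))"
    proof
      fix u
      have "(\<Sum>i\<in>{1..l}. t i * P u i) = (\<Sum>i\<in>I. t i * P u i)"
        by (rule sum.mono_neutral_right) (use I_subset in \<open>auto simp: P_def free_dir_def I_def\<close>)
      also have "\<dots> = (\<Sum>i\<in>I. t i * u i)"
        by (intro sum.cong refl) (use I_subset in \<open>auto simp: P_def free_dir_def I_def\<close>)
      finally show "g u *\<^sub>R iexp (\<Sum>i\<in>{1..l}. t i * P u i) =
          of_real (1 / Z) * (exp (- (B u / r)) * iexp (\<Sum>i\<in>I. t i * u i))"
        by (simp add: g_def scaleR_conv_of_real)
    qed
    also have "(CLINT u|?N. of_real (1 / Z) * (exp (- (B u / r)) * iexp (\<Sum>i\<in>I. t i * u i))) =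
        of_real (1 / Z) * of_real (Z * exp (- qform I V t / 2))"
      by (simp only: integral_mult_right_zero four)
    also have "\<dots> = of_real (exp (- qform I V t / 2))" using Z by simp
    finally show ?thesis .
  qed
  have normal: "centered_normal l (pad_mat l I V) G"
    unfolding centered_normal_def quadratic_form_pad_mat[OF I_subset]
    using transpose_pad_mat[OF V] pG char_G by (auto simp: pad_mat_def G_def)
  have weak: "weak_conv_vec l (\<lambda>n. distr (uniform_moments C n) (coord_borel {1..l})
         (\<lambda>m. \<lambda>j\<in>{1..l}. sqrt (real n) * (m j - moment (constraint_minimizer C) j))) G"
    unfolding weak_conv_vec_def
  proof (intro allI impI)
    fix f :: "(nat \<Rightarrow> real) \<Rightarrow> real"
    assume f: "continuous_map (coord_topology {1..l}) euclideanreal f"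
      and bdd: "bounded (f ` topspace (coord_topology {1..l}))"
    have fm: "f \<in> borel_measurable (coord_borel {1..l})" by (rule continuous_map_imp_borel_measurable[OF f])
    obtain b where b: "\<And>x. x \<in> extensional {1..l} \<Longrightarrow> \<bar>f x\<bar> \<le> b"
      using bdd unfolding bounded_iff by (auto simp: PiE_def)
    have eq: "(\<lambda>m. \<lambda>j\<in>{1..l}. sqrt (real n) * (m j - moment (constraint_minimizer C) j)) =
        (\<lambda>m. \<lambda>j\<in>{1..l}. sqrt (real n) * (m j - full_moments C y j))" for n
      by (intro ext restrict_ext) (simp add: mom)
    have "(\<integral>x. f x \<partial>G) = (\<integral>u. exp (- (B u / r)) * f (\<lambda>j\<in>{1..l}. free_dir C l u j) \<partial>?N) / Z"
      unfolding integral_G[OF fm] by (simp add: g_def P_def)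
    then show "(\<lambda>n. \<integral>x. f x \<partial>distr (uniform_moments C n) (coord_borel {1..l})
         (\<lambda>m. \<lambda>j\<in>{1..l}. sqrt (real n) * (m j - moment (constraint_minimizer C) j))) \<longlonglongrightarrow> (\<integral>x. f x \<partial>G)"
      unfolding eq using expectation_limit[OF fm b] ZE Z by simp
  qed
  have "vec_space.rank l (pad_mat l I V) = l - card (dom C)"
    using rank_pad_mat[OF I_subset V] card_free_indices[OF assms(1,3)] by (simp add: I_def)
  moreover have "\<forall>i\<in>dom C. \<forall>j\<in>{1..l}. pad_mat l I V $$ (i - 1, j - 1) = 0 \<and> pad_mat l I V $$ (j - 1, i - 1) = 0"
  proof (intro ballI)
    fix i j assume i: "i \<in> dom C" and j: "j \<in> {1..l}"
    have "i \<noteq> 0" using i assms(1) by (metis moment_constraint_def)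
    moreover have "i \<le> l" using last_index_ge[OF assms(1) i] assms(3) by simp
    ultimately have "i \<in> {1..l}" by simp
    moreover have "i \<notin> I" using i by (simp add: I_def free_indices_def)
    ultimately show "pad_mat l I V $$ (i - 1, j - 1) = 0 \<and> pad_mat l I V $$ (j - 1, i - 1) = 0"
      using j by (simp only: pad_mat_entry) simp
  qed
  moreover have "pad_mat l I V \<in> carrier_mat l l" by (simp add: pad_mat_def)
  ultimately show ?thesis using normal weak by blast
qed

end
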